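(* Let $\mathcal T$ be a triangulated category (in the sense of Puppe) and let $\mathsf E:\mathcal T\to\mathsf{Ab}$ be a homology in the classical sense. Then the functor $\mathsf h:\mathsf{Triangles}_0(\mathcal T)\to\mathsf{Ab}$ defined by $\mathsf h([f]):=\mathsf E(C_f)$ is a homology on the pseudo-triangulated category associated to $\mathcal T$. In this way one gets an equivalence between the category of homologies on $\mathcal T$ in the classical sense and the category of ($\mathsf{Ab}$-valued) homologies on the associated pseudo-triangulated category.
   Context: A (Puppe) triangulated category is an additive category $\mathcal T$ with an autoequivalence $A\mapsto A[1]$ and a class of distinguished triangles $X\to Y\to Z\to X[1]$ such that: (TR1) it is closed under isomorphism; (TR2) $X\xrightarrow{\mathrm{id}}X\to0\to X[1]$ is distinguished; (TR3) if $X\xrightarrow{f}Y\xrightarrow{g}Z\xrightarrow{h}X[1]$ is distinguished then so is $Y\xrightarrow{g}Z\xrightarrow{h}X[1]\xrightarrow{-f[1]}Y[1]$; (TR4) every $f$ is the first map of some distinguished triangle; (TR5) any commutative square between the first maps of two distinguished triangles extends to a morphism of triangles. A classical homology is an additive functor $\mathsf E:\mathcal T\to\mathsf{Ab}$ such that $\mathsf E(X)\to\mathsf E(Y)\to\mathsf E(Z)\to\mathsf E(X[1])$ is exact for each distinguished triangle $X\to Y\to Z\to X[1]$. For each $f:A\to B$ a distinguished triangle $A\xrightarrow{f}B\xrightarrow{u_f}C_f\xrightarrow{v_f}A[1]$ is chosen. $\mathsf{Triangles}_0(\mathcal T)$ has objects $[f]$ ($f$ a morphism of $\mathcal T$) and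 morphisms $[f]\to[f']$ the triples $(a:A\to A',b:B\to B',c:C_f\to C_{f'})$ giving morphisms of triangles, so $[f]\mapsto C_f$ is a functor. The associated pseudo-triangulated structure is the singular extension $\pi:\mathsf{Triangles}_0(\mathcal T)\to\mathcal T^{[1]}$, $(a,b,c)\mapsto(a,b)$, where $\mathcal T^{[1]}$ is the category of arrows of $\mathcal T$ (morphisms $f\to f'$ are pairs $(a,b)$ with $bf=f'a$); its kernel is $\Theta(f,f')=\{c:C_f\to C_{f'}\mid cu_f=0,v_{f'}c=0\}$. Write $!_X$ for the object of $\mathsf{Triangles}_0(\mathcal T)$ given by the arrow $0\to X$, and ${}^X!$ for the one given by $X\to0$. A morphism $x:[f]\to[g]$ is excising if $\mathrm{Hom}({}^X!,[f])\to\mathrm{Hom}({}^X!,[g])$, $y\mapsto xy$ (Hom in $\mathsf{Triangles}_0(\mathcal T)$), is an isomorphism for every object $X$. For $f:A\to B$ one has canonical morphisms in $\mathsf{Triangles}_0(\mathcal T)$: $!_f:{!_A}\to{!_B}$ (unique lift of $(0,f)$), $i_f:{!_B}\to[f]$ (unique lift of $(0,\mathrm{id}_B)$), and $j_f=j_A\circ k_f:[f]\to{!_{A[1]}}$, where $k_f:[f]\to{}^A!$ is the unique lift of $(\mathrm{id}_A,0)$ and $j_A:{}^A!\to{!_{A[1]}}$ is the morphism in $\Theta({}^A!,!_{A[1]})$ corresponding to $\mathrm{id}_{A[1]}$ under the isomorphism $\mathrm{Hom}_{\mathcal T}(A[1],A[1])\cong\Theta({}^A!,!_{A[1]})$, $x\mapsto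 u_{f'}xv_{f''}$ ($f''=(A\to0)$, $f'=(0\to A[1])$). A homology on the pseudo-triangulated category is a covariant functor $\mathsf h:\mathsf{Triangles}_0(\mathcal T)\to\mathsf{Ab}$ such that (Exactness) for each $f:A\to B$ the sequence $\mathsf h(!_A)\to\mathsf h(!_B)\to\mathsf h([f])\to\mathsf h(!_{A[1]})$ induced by $!_f,i_f,j_f$ is exact, and (Excision) $\mathsf h(x)$ is an isomorphism for every excising $x$. Morphisms of homologies (in both senses) are natural transformations. *)

theory Defs
  imports "HOL-Algebra.Exact_Sequence"
begin

section \<open>Categories, functors, natural transformations\<close>

text \<open>
  An arrow carries its domain and codomain, so hom-sets are disjoint. Functors, components of
  natural transformations and homomorphisms are extensional functions, so that HOL equality is
  the intended equality.
\<close>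

datatype ('o, 'd) arrow = Arrow (src: 'o) (tgt: 'o) (dat: 'd)

record ('o, 'm) cat =
  Ob :: "'o set"
  Ar :: "'m set"
  Dom :: "'m \<Rightarrow> 'o"
  Cod :: "'m \<Rightarrow> 'o"
  Ident :: "'o \<Rightarrow> 'm"
  Comp :: "'m \<Rightarrow> 'm \<Rightarrow> 'm"  (infixl \<open>\<cdot>\<index>\<close> 70)

definition Hom :: "('o, 'm, 'z) cat_scheme \<Rightarrow> 'o \<Rightarrow> 'o \<Rightarrow> 'm set" where
  "Hom C x y = {f \<in> Ar C. Dom C f = x \<and> Cod C f = y}"

locale category =
  fixes C :: "('o, 'm, 'z) cat_scheme" (structure)
  assumes dom_cod: "f \<in> Ar C \<Longrightarrow> Dom C f \<in> Ob C \<and> Cod C f \<in> Ob C"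
    and ident: "x \<in> Ob C \<Longrightarrow> Ident C x \<in> Hom C x x"
    and comp: "\<lbrakk>f \<in> Hom C x y; g \<in> Hom C y z\<rbrakk> \<Longrightarrow> g \<cdot> f \<in> Hom C x z"
    and ident_right: "f \<in> Hom C x y \<Longrightarrow> f \<cdot> Ident C x = f"
    and ident_left: "f \<in> Hom C x y \<Longrightarrow> Ident C y \<cdot> f = f"
    and assoc: "\<lbrakk>f \<in> Hom C w x; g \<in> Hom C x y; h \<in> Hom C y z\<rbrakk> \<Longrightarrow> h \<cdot> (g \<cdot> f) = (h \<cdot> g) \<cdot> f"

definition is_iso :: "('o, 'm, 'z) cat_scheme \<Rightarrow> 'm \<Rightarrow> bool" where
  "is_iso C f \<longleftrightarrow> f \<in> Ar C \<and>
     (\<exists>g \<in> Hom C (Cod C f) (Dom C f).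
        g \<cdot>\<^bsub>C\<^esub> f = Ident C (Dom C f) \<and> f \<cdot>\<^bsub>C\<^esub> g = Ident C (Cod C f))"

datatype ('o, 'm, 'p, 'n) functr = Functr (omap: "'o \<Rightarrow> 'p") (amap: "'m \<Rightarrow> 'n")

definition is_functor ::
  "('o, 'm, 'z) cat_scheme \<Rightarrow> ('p, 'n, 'w) cat_scheme \<Rightarrow> ('o, 'm, 'p, 'n) functr \<Rightarrow> bool" where
  "is_functor C D F \<longleftrightarrow>
     omap F \<in> Ob C \<rightarrow>\<^sub>E Ob D \<and> amap F \<in> Ar C \<rightarrow>\<^sub>E Ar D \<and>
     (\<forall>x y. \<forall>f \<in> Hom C x y. amap F f \<in> Hom D (omap F x) (omap F y)) \<and>
     (\<forall>x \<in> Ob C. amap F (Ident C x) = Ident D (omap F x)) \<and>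
     (\<forall>x y z. \<forall>f \<in> Hom C x y. \<forall>g \<in> Hom C y z.
        amap F (g \<cdot>\<^bsub>C\<^esub> f) = amap F g \<cdot>\<^bsub>D\<^esub> amap F f)"

definition id_functor :: "('o, 'm, 'z) cat_scheme \<Rightarrow> ('o, 'm, 'o, 'm) functr" where
  "id_functor C = Functr (\<lambda>x \<in> Ob C. x) (\<lambda>f \<in> Ar C. f)"

definition comp_functor ::
  "('o, 'm, 'z) cat_scheme \<Rightarrow> ('p, 'n, 'q, 'k) functr \<Rightarrow> ('o, 'm, 'p, 'n) functr
    \<Rightarrow> ('o, 'm, 'q, 'k) functr" where
  "comp_functor C G F =
     Functr (compose (Ob C) (omap G) (omap F)) (compose (Ar C) (amap G) (amap F))"

definition nat_trans ::
  "('o, 'm, 'z) cat_scheme \<Rightarrow> ('p, 'n, 'w) cat_scheme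
    \<Rightarrow> ('o, 'm, 'p, 'n) functr \<Rightarrow> ('o, 'm, 'p, 'n) functr \<Rightarrow> ('o \<Rightarrow> 'n) \<Rightarrow> bool" where
  "nat_trans C D F G \<eta> \<longleftrightarrow>
     \<eta> \<in> extensional (Ob C) \<and>
     (\<forall>x \<in> Ob C. \<eta> x \<in> Hom D (omap F x) (omap G x)) \<and>
     (\<forall>x y. \<forall>f \<in> Hom C x y. amap G f \<cdot>\<^bsub>D\<^esub> \<eta> x = \<eta> y \<cdot>\<^bsub>D\<^esub> amap F f)"

definition nat_isomorphic ::
  "('o, 'm, 'z) cat_scheme \<Rightarrow> ('p, 'n, 'w) cat_scheme
    \<Rightarrow> ('o, 'm, 'p, 'n) functr \<Rightarrow> ('o, 'm, 'p, 'n) functr \<Rightarrow> bool" where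
  "nat_isomorphic C D F G \<longleftrightarrow> (\<exists>\<eta>. nat_trans C D F G \<eta> \<and> (\<forall>x \<in> Ob C. is_iso D (\<eta> x)))"

definition is_equivalence ::
  "('o, 'm, 'z) cat_scheme \<Rightarrow> ('p, 'n, 'w) cat_scheme \<Rightarrow> ('o, 'm, 'p, 'n) functr \<Rightarrow> bool" where
  "is_equivalence C D F \<longleftrightarrow>
     category C \<and> category D \<and> is_functor C D F \<and>
     (\<exists>G. is_functor D C G \<and>
        nat_isomorphic C C (comp_functor C G F) (id_functor C) \<and>
        nat_isomorphic D D (comp_functor D F G) (id_functor D))"

definition functor_cat ::
  "('o, 'm, 'z) cat_scheme \<Rightarrow> ('p, 'n, 'w) cat_scheme
    \<Rightarrow> (('o, 'm, 'p, 'n) functr, (('o, 'm, 'p, 'n) functr, 'o \<Rightarrow> 'n) arrow) cat" where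
  "functor_cat C D =
     \<lparr>Ob = {F. is_functor C D F},
      Ar = {Arrow F G \<eta> | F G \<eta>. is_functor C D F \<and> is_functor C D G \<and> nat_trans C D F G \<eta>},
      Dom = src,
      Cod = tgt,
      Ident = (\<lambda>F. Arrow F F (\<lambda>x \<in> Ob C. Ident D (omap F x))),
      Comp = (\<lambda>s t. Arrow (src t) (tgt s) (\<lambda>x \<in> Ob C. dat s x \<cdot>\<^bsub>D\<^esub> dat t x))\<rparr>"

definition full_subcat :: "('o, 'm) cat \<Rightarrow> ('o \<Rightarrow> bool) \<Rightarrow> ('o, 'm) cat" where
  "full_subcat C P =
     C\<lparr>Ob := {x \<in> Ob C. P x}, Ar := {f \<in> Ar C. P (Dom C f) \<and> P (Cod C f)}\<rparr>"


section \<open>Additive categories and abelian groups\<close>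

record ('o, 'm) abcat = "('o, 'm) cat" +
  Plus :: "'m \<Rightarrow> 'm \<Rightarrow> 'm"  (infixl \<open>\<boxplus>\<index>\<close> 65)
  Null :: "'o \<Rightarrow> 'o \<Rightarrow> 'm"

definition hom_group :: "('o, 'm, 'z) abcat_scheme \<Rightarrow> 'o \<Rightarrow> 'o \<Rightarrow> 'm monoid" where
  "hom_group C x y = \<lparr>carrier = Hom C x y, mult = Plus C, one = Null C x y\<rparr>"

definition Neg :: "('o, 'm, 'z) abcat_scheme \<Rightarrow> 'm \<Rightarrow> 'm" where
  "Neg C f = inv\<^bsub>hom_group C (Dom C f) (Cod C f)\<^esub> f"

definition zero_object :: "('o, 'm, 'z) cat_scheme \<Rightarrow> 'o \<Rightarrow> bool" where
  "zero_object C z \<longleftrightarrow> z \<in> Ob C \<and>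
     (\<forall>x \<in> Ob C. (\<exists>!f. f \<in> Hom C z x) \<and> (\<exists>!f. f \<in> Hom C x z))"

definition biproduct ::
  "('o, 'm, 'z) abcat_scheme \<Rightarrow> 'o \<Rightarrow> 'o \<Rightarrow> 'o \<Rightarrow> 'm \<Rightarrow> 'm \<Rightarrow> 'm \<Rightarrow> 'm \<Rightarrow> bool" where
  "biproduct C x y s i\<^sub>1 i\<^sub>2 p\<^sub>1 p\<^sub>2 \<longleftrightarrow>
     s \<in> Ob C \<and> i\<^sub>1 \<in> Hom C x s \<and> i\<^sub>2 \<in> Hom C y s \<and> p\<^sub>1 \<in> Hom C s x \<and> p\<^sub>2 \<in> Hom C s y \<and>
     p\<^sub>1 \<cdot>\<^bsub>C\<^esub> i\<^sub>1 = Ident C x \<and> p\<^sub>2 \<cdot>\<^bsub>C\<^esub> i\<^sub>2 = Ident C y \<and>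
     p\<^sub>1 \<cdot>\<^bsub>C\<^esub> i\<^sub>2 = Null C y x \<and> p\<^sub>2 \<cdot>\<^bsub>C\<^esub> i\<^sub>1 = Null C x y \<and>
     (i\<^sub>1 \<cdot>\<^bsub>C\<^esub> p\<^sub>1) \<boxplus>\<^bsub>C\<^esub> (i\<^sub>2 \<cdot>\<^bsub>C\<^esub> p\<^sub>2) = Ident C s"

locale additive_category = category C for C :: "('o, 'm, 'z) abcat_scheme" (structure) +
  assumes hom_group: "\<lbrakk>x \<in> Ob C; y \<in> Ob C\<rbrakk> \<Longrightarrow> comm_group (hom_group C x y)"
    and comp_plus_right:
      "\<lbrakk>f \<in> Hom C x y; f' \<in> Hom C x y; g \<in> Hom C y z\<rbrakk> \<Longrightarrow> g \<cdot> (f \<boxplus> f') = (g \<cdot> f) \<boxplus> (g \<cdot> f')"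
    and comp_plus_left:
      "\<lbrakk>f \<in> Hom C x y; g \<in> Hom C y z; g' \<in> Hom C y z\<rbrakk> \<Longrightarrow> (g \<boxplus> g') \<cdot> f = (g \<cdot> f) \<boxplus> (g' \<cdot> f)"
    and ex_zero_object: "\<exists>z. zero_object C z"
    and ex_biproduct:
      "\<lbrakk>x \<in> Ob C; y \<in> Ob C\<rbrakk> \<Longrightarrow> \<exists>s i\<^sub>1 i\<^sub>2 p\<^sub>1 p\<^sub>2. biproduct C x y s i\<^sub>1 i\<^sub>2 p\<^sub>1 p\<^sub>2"

definition additive_functor ::
  "('o, 'm, 'z) abcat_scheme \<Rightarrow> ('p, 'n, 'w) abcat_scheme \<Rightarrow> ('o, 'm, 'p, 'n) functr \<Rightarrow> bool" where
  "additive_functor C D F \<longleftrightarrow> is_functor C D F \<and>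
     (\<forall>x y. \<forall>f \<in> Hom C x y. \<forall>g \<in> Hom C x y.
        amap F (f \<boxplus>\<^bsub>C\<^esub> g) = amap F f \<boxplus>\<^bsub>D\<^esub> amap F g)"

text \<open>
  The category of abelian groups whose elements are taken from the type \<open>'e\<close>, which plays the
  role of the universe of small sets.
\<close>

type_synonym 'e grp_hom = "('e monoid, 'e \<Rightarrow> 'e) arrow"

definition Ab :: "('e monoid, 'e grp_hom) abcat" where
  "Ab =
     \<lparr>Ob = {G. comm_group G},
      Ar = {Arrow G H \<phi> | G H \<phi>.
              comm_group G \<and> comm_group H \<and> \<phi> \<in> hom G H \<and> \<phi> \<in> extensional (carrier G)},
      Dom = src,
      Cod = tgt,
      Ident = (\<lambda>G. Arrow G G (\<lambda>x \<in> carrier G. x)),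
      Comp = (\<lambda>s t. Arrow (src t) (tgt s) (compose (carrier (src t)) (dat s) (dat t))),
      Plus = (\<lambda>s t. Arrow (src s) (tgt s)
                (\<lambda>x \<in> carrier (src s). dat s x \<otimes>\<^bsub>tgt s\<^esub> dat t x)),
      Null = (\<lambda>G H. Arrow G H (\<lambda>x \<in> carrier G. \<one>\<^bsub>H\<^esub>))\<rparr>"

type_synonym ('o, 'm, 'e) ab_functr = "('o, 'm, 'e monoid, 'e grp_hom) functr"

type_synonym ('o, 'm, 'e) ab_functr_cat =
  "(('o, 'm, 'e) ab_functr, (('o, 'm, 'e) ab_functr, 'o \<Rightarrow> 'e grp_hom) arrow) cat"


section \<open>Triangulated categories in the sense of Puppe\<close>

text \<open>
  \<open>(f, g, h) \<in> Dist T\<close> stands for the distinguished triangle \<open>X \<rightarrow> Y \<rightarrow> Z \<rightarrow> X[1]\<close> with these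
  three arrows. \<open>Zero\<close> is a fixed choice of zero object.
\<close>

record ('o, 'm) tricat = "('o, 'm) abcat" +
  Zero :: 'o
  Shift :: "('o, 'm, 'o, 'm) functr"
  Dist :: "('m \<times> 'm \<times> 'm) set"

abbreviation shift_ob :: "('o, 'm, 'z) tricat_scheme \<Rightarrow> 'o \<Rightarrow> 'o" where
  "shift_ob T \<equiv> omap (Shift T)"

abbreviation shift_ar :: "('o, 'm, 'z) tricat_scheme \<Rightarrow> 'm \<Rightarrow> 'm" where
  "shift_ar T \<equiv> amap (Shift T)"

definition triangle :: "('o, 'm, 'z) tricat_scheme \<Rightarrow> 'm \<times> 'm \<times> 'm \<Rightarrow> bool" where
  "triangle T = (\<lambda>(f, g, h). \<exists>X Y Z.
     f \<in> Hom T X Y \<and> g \<in> Hom T Y Z \<and> h \<in> Hom T Z (shift_ob T X))"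

definition triangle_map ::
  "('o, 'm, 'z) tricat_scheme \<Rightarrow> 'm \<times> 'm \<times> 'm \<Rightarrow> 'm \<times> 'm \<times> 'm \<Rightarrow> 'm \<times> 'm \<times> 'm \<Rightarrow> bool" where
  "triangle_map T = (\<lambda>(f, g, h) (f', g', h') (a, b, c).
     a \<in> Hom T (Dom T f) (Dom T f') \<and>
     b \<in> Hom T (Dom T g) (Dom T g') \<and>
     c \<in> Hom T (Dom T h) (Dom T h') \<and>
     b \<cdot>\<^bsub>T\<^esub> f = f' \<cdot>\<^bsub>T\<^esub> a \<and>
     c \<cdot>\<^bsub>T\<^esub> g = g' \<cdot>\<^bsub>T\<^esub> b \<and>
     shift_ar T a \<cdot>\<^bsub>T\<^esub> h = h' \<cdot>\<^bsub>T\<^esub> c)"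

locale triangulated_category = additive_category T
  for T :: "('o, 'm, 'z) tricat_scheme" (structure) +
  assumes zero: "zero_object T (Zero T)"
    and shift: "is_equivalence T T (Shift T)"
    and dist_triangle: "t \<in> Dist T \<Longrightarrow> triangle T t"
    and TR1: "\<lbrakk>t \<in> Dist T; triangle T t'; triangle_map T t t' (a, b, c);
               is_iso T a; is_iso T b; is_iso T c\<rbrakk> \<Longrightarrow> t' \<in> Dist T"
    and TR2: "X \<in> Ob T \<Longrightarrow>
               (Ident T X, Null T X (Zero T), Null T (Zero T) (shift_ob T X)) \<in> Dist T"
    and TR3: "(f, g, h) \<in> Dist T \<Longrightarrow> (g, h, Neg T (shift_ar T f)) \<in> Dist T"
    and TR4: "f \<in> Ar T \<Longrightarrow> \<exists>g h. (f, g, h) \<in> Dist T"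
    and TR5: "\<lbrakk>(f, g, h) \<in> Dist T; (f', g', h') \<in> Dist T;
               a \<in> Hom T (Dom T f) (Dom T f'); b \<in> Hom T (Cod T f) (Cod T f');
               b \<cdot> f = f' \<cdot> a\<rbrakk>
              \<Longrightarrow> \<exists>c. triangle_map T (f, g, h) (f', g', h') (a, b, c)"

definition classical_homology ::
  "('o, 'm, 'z) tricat_scheme \<Rightarrow> ('o, 'm, 'e) ab_functr \<Rightarrow> bool" where
  "classical_homology T E \<longleftrightarrow> additive_functor T Ab E \<and>
     (\<forall>(f, g, h) \<in> Dist T.
        exact_seq ([omap E (Cod T h), omap E (Dom T h), omap E (Dom T g), omap E (Dom T f)],
                   [dat (amap E h), dat (amap E g), dat (amap E f)]))"

definition classical_homologies ::
  "('o, 'm, 'z) tricat_scheme \<Rightarrow> ('o, 'm, 'e) ab_functr_cat" where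
  "classical_homologies T = full_subcat (functor_cat T Ab) (classical_homology T)"


section \<open>The associated pseudo-triangulated category\<close>

text \<open>\<open>CU T f\<close> and \<open>CV T f\<close> are \<open>u\<^sub>f : B \<rightarrow> C\<^sub>f\<close> and \<open>v\<^sub>f : C\<^sub>f \<rightarrow> A[1]\<close> for \<open>f : A \<rightarrow> B\<close>.\<close>

record ('o, 'm) chosen_tricat = "('o, 'm) tricat" +
  CU :: "'m \<Rightarrow> 'm"
  CV :: "'m \<Rightarrow> 'm"

locale chosen_triangulated_category = triangulated_category T
  for T :: "('o, 'm, 'z) chosen_tricat_scheme" (structure) +
  assumes chosen: "f \<in> Ar T \<Longrightarrow> (f, CU T f, CV T f) \<in> Dist T"

definition Cone :: "('o, 'm, 'z) chosen_tricat_scheme \<Rightarrow> 'm \<Rightarrow> 'o" where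
  "Cone T f = Cod T (CU T f)"

definition arrow_cat :: "('o, 'm, 'z) cat_scheme \<Rightarrow> ('m, ('m, 'm \<times> 'm) arrow) cat" where
  "arrow_cat C =
     \<lparr>Ob = Ar C,
      Ar = {Arrow f f' (a, b) | f f' a b. f \<in> Ar C \<and> f' \<in> Ar C \<and>
              a \<in> Hom C (Dom C f) (Dom C f') \<and> b \<in> Hom C (Cod C f) (Cod C f') \<and>
              b \<cdot>\<^bsub>C\<^esub> f = f' \<cdot>\<^bsub>C\<^esub> a},
      Dom = src,
      Cod = tgt,
      Ident = (\<lambda>f. Arrow f f (Ident C (Dom C f), Ident C (Cod C f))),
      Comp = (\<lambda>s t. case (dat s, dat t) of ((a', b'), (a, b)) \<Rightarrow>
                Arrow (src t) (tgt s) (a' \<cdot>\<^bsub>C\<^esub> a, b' \<cdot>\<^bsub>C\<^esub> b))\<rparr>"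

definition triangles0 ::
  "('o, 'm, 'z) chosen_tricat_scheme \<Rightarrow> ('m, ('m, 'm \<times> 'm \<times> 'm) arrow) abcat" where
  "triangles0 T =
     \<lparr>Ob = Ar T,
      Ar = {Arrow f f' abc | f f' abc. f \<in> Ar T \<and> f' \<in> Ar T \<and>
              triangle_map T (f, CU T f, CV T f) (f', CU T f', CV T f') abc},
      Dom = src,
      Cod = tgt,
      Ident = (\<lambda>f. Arrow f f (Ident T (Dom T f), Ident T (Cod T f), Ident T (Cone T f))),
      Comp = (\<lambda>s t. case (dat s, dat t) of ((a', b', c'), (a, b, c)) \<Rightarrow>
                Arrow (src t) (tgt s) (a' \<cdot>\<^bsub>T\<^esub> a, b' \<cdot>\<^bsub>T\<^esub> b, c' \<cdot>\<^bsub>T\<^esub> c)),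
      Plus = (\<lambda>s t. case (dat s, dat t) of ((a', b', c'), (a, b, c)) \<Rightarrow>
                Arrow (src s) (tgt s) (a' \<boxplus>\<^bsub>T\<^esub> a, b' \<boxplus>\<^bsub>T\<^esub> b, c' \<boxplus>\<^bsub>T\<^esub> c)),
      Null = (\<lambda>f f'. Arrow f f'
                (Null T (Dom T f) (Dom T f'), Null T (Cod T f) (Cod T f'),
                 Null T (Cone T f) (Cone T f')))\<rparr>"

definition proj_functor ::
  "('o, 'm, 'z) chosen_tricat_scheme
    \<Rightarrow> ('m, ('m, 'm \<times> 'm \<times> 'm) arrow, 'm, ('m, 'm \<times> 'm) arrow) functr" where
  "proj_functor T =
     Functr (\<lambda>f \<in> Ob (triangles0 T). f)
       (\<lambda>t \<in> Ar (triangles0 T). case dat t of (a, b, c) \<Rightarrow> Arrow (src t) (tgt t) (a, b))"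

context chosen_triangulated_category begin

lemma tri:
  assumes "f \<in> Ar T"
  shows "f \<in> Hom T (Dom T f) (Cod T f)" "CU T f \<in> Hom T (Cod T f) (Cone T f)"
    "CV T f \<in> Hom T (Cone T f) (shift_ob T (Dom T f))"
    "Dom T (CU T f) = Cod T f" "Dom T (CV T f) = Cone T f"
    "Dom T f \<in> Ob T" "Cod T f \<in> Ob T" "Cone T f \<in> Ob T"
  using dist_triangle[OF chosen[OF assms]] assms dom_cod unfolding triangle_def Cone_def by (auto simp: Hom_def)

lemma shf: "is_functor T T (Shift T)" using shift by (simp add: is_equivalence_def)

lemma triangle_map_comp:
  assumes "f \<in> Ar T" "f' \<in> Ar T" "f'' \<in> Ar T"
    "triangle_map T (f, CU T f, CV T f) (f', CU T f', CV T f') (a,b,c)"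
    "triangle_map T (f', CU T f', CV T f') (f'', CU T f'', CV T f'') (a',b',c')"
  shows "triangle_map T (f, CU T f, CV T f) (f'', CU T f'', CV T f'') (a' \<cdot> a, b' \<cdot> b,c' \<cdot> c)"
proof -
  note t = tri[OF assms(1)] tri[OF assms(2)] tri[OF assms(3)]
  have h: "a \<in> Hom T (Dom T f) (Dom T f')" "b \<in> Hom T (Cod T f) (Cod T f')" "c \<in> Hom T (Cone T f) (Cone T f')"
    "a' \<in> Hom T (Dom T f') (Dom T f'')" "b' \<in> Hom T (Cod T f') (Cod T f'')" "c' \<in> Hom T (Cone T f') (Cone T f'')"
    "b \<cdot> f = f' \<cdot> a" "c \<cdot> CU T f = CU T f' \<cdot> b" "shift_ar T a \<cdot> CV T f = CV T f' \<cdot> c"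
    "b' \<cdot> f' = f'' \<cdot> a'" "c' \<cdot> CU T f' = CU T f'' \<cdot> b'"
    "shift_ar T a' \<cdot> CV T f' = CV T f'' \<cdot> c'"
    using assms t by (auto simp: triangle_map_def)
  have s: "shift_ar T a \<in> Hom T (shift_ob T (Dom T f)) (shift_ob T (Dom T f'))"
    "shift_ar T a' \<in> Hom T (shift_ob T (Dom T f')) (shift_ob T (Dom T f''))"
    "shift_ar T (a' \<cdot> a) = shift_ar T a' \<cdot> shift_ar T a"
    using shf h unfolding is_functor_def by blast+
  have 1: "b' \<cdot> b \<cdot> f = f'' \<cdot> (a' \<cdot> a)"
    using assoc[OF t(1) h(2) h(5)] assoc[OF h(1) tri(1)[OF assms(2)] h(5)]
      assoc[OF h(1) h(4) tri(1)[OF assms(3)]] h(7,10) by simp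
  have 2: "c' \<cdot> c \<cdot> CU T f = CU T f'' \<cdot> (b' \<cdot> b)"
    using assoc[OF t(2) h(3) h(6)] assoc[OF h(2) tri(2)[OF assms(2)] h(6)]
      assoc[OF h(2) h(5) tri(2)[OF assms(3)]] h(8,11) by simp
  have 3: "shift_ar T (a' \<cdot> a) \<cdot> CV T f = CV T f'' \<cdot> (c' \<cdot> c)"
    using assoc[OF t(3) s(1) s(2)] assoc[OF h(3) tri(3)[OF assms(2)] s(2)]
      assoc[OF h(3) h(6) tri(3)[OF assms(3)]] h(9,12) s(3) by simp
  show ?thesis using 1 2 3 h t comp by (auto simp: triangle_map_def)
qed

lemma triangle_map_id:
  assumes "f \<in> Ar T"
  shows "triangle_map T (f, CU T f, CV T f) (f, CU T f, CV T f)
    (Ident T (Dom T f), Ident T (Cod T f), Ident T (Cone T f))"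
proof -
  have "shift_ar T (Ident T (Dom T f)) = Ident T (shift_ob T (Dom T f))"
    using shf tri[OF assms] by (auto simp: is_functor_def)
  then show ?thesis
    using tri[OF assms] ident ident_left ident_right unfolding triangle_map_def by auto
qed

lemma Hom_triangles0:
  "t \<in> Hom (triangles0 T) f g \<longleftrightarrow> (\<exists>a b c. t = Arrow f g (a, b, c) \<and> f \<in> Ar T \<and> g \<in> Ar T \<and>
     triangle_map T (f, CU T f, CV T f) (g, CU T g, CV T g) (a, b, c))"
  unfolding Hom_def by (auto simp: triangles0_def)

lemma Ar_triangles0: "t \<in> Ar (triangles0 T) \<longleftrightarrow> t \<in> Hom (triangles0 T) (src t) (tgt t)"
  unfolding Hom_def by (auto simp: triangles0_def)

lemma Ident_triangles0:
  "f \<in> Ar T \<Longrightarrow> Ident (triangles0 T) f \<in> Hom (triangles0 T) f f"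
  using triangle_map_id unfolding Hom_triangles0 by (simp add: triangles0_def)

lemma Comp_triangles0:
  "\<lbrakk>s \<in> Hom (triangles0 T) f g; t \<in> Hom (triangles0 T) g h\<rbrakk>
    \<Longrightarrow> t \<cdot>\<^bsub>triangles0 T\<^esub> s \<in> Hom (triangles0 T) f h"
  unfolding Hom_triangles0 using triangle_map_comp by (fastforce simp: triangles0_def)

lemma triangle_map_Hom:
  assumes "f \<in> Ar T" "g \<in> Ar T"
    and "triangle_map T (f, CU T f, CV T f) (g, CU T g, CV T g) (a, b, c)"
  shows "a \<in> Hom T (Dom T f) (Dom T g)" "b \<in> Hom T (Cod T f) (Cod T g)"
    "c \<in> Hom T (Cone T f) (Cone T g)"
  using assms tri by (auto simp: triangle_map_def)

lemma category_triangles0: "category (triangles0 T)"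
proof
  fix s f g assume "s \<in> Hom (triangles0 T) f g"
  then obtain a b c where s: "s = Arrow f g (a, b, c)" and fg: "f \<in> Ar T" "g \<in> Ar T"
    "triangle_map T (f, CU T f, CV T f) (g, CU T g, CV T g) (a, b, c)"
    unfolding Hom_triangles0 by blast
  note m = triangle_map_Hom[OF fg]
  show "s \<cdot>\<^bsub>triangles0 T\<^esub> Ident (triangles0 T) f = s"
    unfolding s by (simp add: triangles0_def m[THEN ident_right])
  show "Ident (triangles0 T) g \<cdot>\<^bsub>triangles0 T\<^esub> s = s"
    unfolding s by (simp add: triangles0_def m[THEN ident_left])
next
  fix s t r f g h k
  assume "s \<in> Hom (triangles0 T) f g" "t \<in> Hom (triangles0 T) g h" "r \<in> Hom (triangles0 T) h k"
  then obtain a b c a' b' c' a'' b'' c'' where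
    e: "s = Arrow f g (a, b, c)" "t = Arrow g h (a', b', c')" "r = Arrow h k (a'', b'', c'')" and
    o: "f \<in> Ar T" "g \<in> Ar T" "h \<in> Ar T" "k \<in> Ar T" and
    m: "triangle_map T (f, CU T f, CV T f) (g, CU T g, CV T g) (a, b, c)"
    "triangle_map T (g, CU T g, CV T g) (h, CU T h, CV T h) (a', b', c')"
    "triangle_map T (h, CU T h, CV T h) (k, CU T k, CV T k) (a'', b'', c'')"
    unfolding Hom_triangles0 by blast
  note n = triangle_map_Hom[OF o(1,2) m(1)] triangle_map_Hom[OF o(2,3) m(2)]
    triangle_map_Hom[OF o(3,4) m(3)]
  show "r \<cdot>\<^bsub>triangles0 T\<^esub> (t \<cdot>\<^bsub>triangles0 T\<^esub> s) = r \<cdot>\<^bsub>triangles0 T\<^esub> t \<cdot>\<^bsub>triangles0 T\<^esub> s"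
    unfolding e
    by (simp add: triangles0_def assoc[OF n(1,4,7)] assoc[OF n(2,5,8)] assoc[OF n(3,6,9)])
next
  fix s assume "s \<in> Ar (triangles0 T)"
  then show "Dom (triangles0 T) s \<in> Ob (triangles0 T) \<and> Cod (triangles0 T) s \<in> Ob (triangles0 T)"
    by (auto simp: triangles0_def)
next
  fix f assume "f \<in> Ob (triangles0 T)"
  then show "Ident (triangles0 T) f \<in> Hom (triangles0 T) f f"
    using Ident_triangles0 by (simp add: triangles0_def)
qed (rule Comp_triangles0)

lemma is_functor_proj: "is_functor (triangles0 T) (arrow_cat T) (proj_functor T)"
proof -
  have p: "amap (proj_functor T) (Arrow f g (a, b, c)) = Arrow f g (a, b)"
    if "Arrow f g (a, b, c) \<in> Hom (triangles0 T) f g" for f g a b c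
    using that by (simp add: proj_functor_def Ar_triangles0)
  have o: "omap (proj_functor T) f = (if f \<in> Ar T then f else undefined)" for f
    by (simp add: proj_functor_def triangles0_def)
  have m: "amap (proj_functor T) s \<in> Hom (arrow_cat T) f g" if s: "s \<in> Hom (triangles0 T) f g" for s f g
  proof -
    obtain a b c where e: "s = Arrow f g (a, b, c)" "f \<in> Ar T" "g \<in> Ar T"
      "triangle_map T (f, CU T f, CV T f) (g, CU T g, CV T g) (a, b, c)"
      using s unfolding Hom_triangles0 by blast
    then show ?thesis
      using s triangle_map_Hom[OF e(2-4)]
      by (simp add: p Hom_def[where C = "arrow_cat T"]) (simp add: arrow_cat_def triangle_map_def)
  qed
  show ?thesis
    unfolding is_functor_def
  proof (intro conjI allI ballI)
    show "omap (proj_functor T) \<in> Ob (triangles0 T) \<rightarrow>\<^sub>E Ob (arrow_cat T)"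
      by (simp add: o arrow_cat_def triangles0_def PiE_iff extensional_def)
  next
    have "amap (proj_functor T) s \<in> Ar (arrow_cat T)" if "s \<in> Ar (triangles0 T)" for s
      using m that unfolding Ar_triangles0 by (fastforce simp: Hom_def)
    then show "amap (proj_functor T) \<in> Ar (triangles0 T) \<rightarrow>\<^sub>E Ar (arrow_cat T)"
      by (auto simp: PiE_iff proj_functor_def)
  next
    fix f g s assume s: "s \<in> Hom (triangles0 T) f g"
    then have "f \<in> Ar T" "g \<in> Ar T" unfolding Hom_triangles0 by auto
    then show "amap (proj_functor T) s \<in> Hom (arrow_cat T) (omap (proj_functor T) f) (omap (proj_functor T) g)"
      using m[OF s] by (simp add: o)
  next
    fix f assume "f \<in> Ob (triangles0 T)"
    then have f: "f \<in> Ar T" by (simp add: triangles0_def)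
    then show "amap (proj_functor T) (Ident (triangles0 T) f) = Ident (arrow_cat T) (omap (proj_functor T) f)"
      using p Ident_triangles0[OF f] by (simp add: o) (simp add: triangles0_def arrow_cat_def)
  next
    fix f g h s t assume st: "s \<in> Hom (triangles0 T) f g" "t \<in> Hom (triangles0 T) g h"
    then obtain a b c a' b' c' where
      e: "s = Arrow f g (a, b, c)" "t = Arrow g h (a', b', c')"
      unfolding Hom_triangles0 by blast
    then have c: "t \<cdot>\<^bsub>triangles0 T\<^esub> s = Arrow f h (a' \<cdot> a, b' \<cdot> b, c' \<cdot> c)"
      by (simp add: triangles0_def)
    show "amap (proj_functor T) (t \<cdot>\<^bsub>triangles0 T\<^esub> s)
        = amap (proj_functor T) t \<cdot>\<^bsub>arrow_cat T\<^esub> amap (proj_functor T) s"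
      using p[of f h] Comp_triangles0[OF st] st unfolding c unfolding e
      by (simp add: p) (simp add: arrow_cat_def)
  qed
qed

end

definition unique_lift ::
  "('o, 'm, 'z) chosen_tricat_scheme \<Rightarrow> ('m, 'm \<times> 'm) arrow \<Rightarrow> ('m, 'm \<times> 'm \<times> 'm) arrow" where
  "unique_lift T s = (THE t. t \<in> Ar (triangles0 T) \<and> amap (proj_functor T) t = s)"

definition from_zero :: "('o, 'm, 'z) tricat_scheme \<Rightarrow> 'o \<Rightarrow> 'm" where
  "from_zero T X = Null T (Zero T) X"

definition to_zero :: "('o, 'm, 'z) tricat_scheme \<Rightarrow> 'o \<Rightarrow> 'm" where
  "to_zero T X = Null T X (Zero T)"

definition excising ::
  "('o, 'm, 'z) chosen_tricat_scheme \<Rightarrow> ('m, 'm \<times> 'm \<times> 'm) arrow \<Rightarrow> bool" where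
  "excising T x \<longleftrightarrow> x \<in> Ar (triangles0 T) \<and>
     (\<forall>X \<in> Ob T. (\<lambda>y. x \<cdot>\<^bsub>triangles0 T\<^esub> y) \<in>
        iso (hom_group (triangles0 T) (to_zero T X) (src x))
            (hom_group (triangles0 T) (to_zero T X) (tgt x)))"

definition bang_map ::
  "('o, 'm, 'z) chosen_tricat_scheme \<Rightarrow> 'm \<Rightarrow> ('m, 'm \<times> 'm \<times> 'm) arrow" where
  "bang_map T f =
     unique_lift T (Arrow (from_zero T (Dom T f)) (from_zero T (Cod T f))
       (Null T (Zero T) (Zero T), f))"

definition i_map ::
  "('o, 'm, 'z) chosen_tricat_scheme \<Rightarrow> 'm \<Rightarrow> ('m, 'm \<times> 'm \<times> 'm) arrow" where
  "i_map T f =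
     unique_lift T (Arrow (from_zero T (Cod T f)) f
       (Null T (Zero T) (Dom T f), Ident T (Cod T f)))"

definition k_map ::
  "('o, 'm, 'z) chosen_tricat_scheme \<Rightarrow> 'm \<Rightarrow> ('m, 'm \<times> 'm \<times> 'm) arrow" where
  "k_map T f =
     unique_lift T (Arrow f (to_zero T (Dom T f))
       (Ident T (Dom T f), Null T (Cod T f) (Zero T)))"

text \<open>
  \<open>\<Theta>(f, f')\<close> is the kernel of the projection on hom-sets: its element \<open>c\<close> is identified
  with the morphism \<open>(0, 0, c)\<close>.
\<close>

definition Theta :: "('o, 'm, 'z) chosen_tricat_scheme \<Rightarrow> 'm \<Rightarrow> 'm \<Rightarrow> 'm set" where
  "Theta T f f' = {c \<in> Hom T (Cone T f) (Cone T f').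
     c \<cdot>\<^bsub>T\<^esub> CU T f = Null T (Cod T f) (Cone T f') \<and>
     CV T f' \<cdot>\<^bsub>T\<^esub> c = Null T (Cone T f) (shift_ob T (Dom T f'))}"

definition theta_arrow ::
  "('o, 'm, 'z) chosen_tricat_scheme \<Rightarrow> 'm \<Rightarrow> 'm \<Rightarrow> 'm \<Rightarrow> ('m, 'm \<times> 'm \<times> 'm) arrow" where
  "theta_arrow T f f' = (\<lambda>c \<in> Theta T f f'.
     Arrow f f' (Null T (Dom T f) (Dom T f'), Null T (Cod T f) (Cod T f'), c))"

definition j_ob ::
  "('o, 'm, 'z) chosen_tricat_scheme \<Rightarrow> 'o \<Rightarrow> ('m, 'm \<times> 'm \<times> 'm) arrow" where
  "j_ob T A = (let f'' = to_zero T A; f' = from_zero T (shift_ob T A) in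
     theta_arrow T f'' f' (CU T f' \<cdot>\<^bsub>T\<^esub> Ident T (shift_ob T A) \<cdot>\<^bsub>T\<^esub> CV T f''))"

definition j_map ::
  "('o, 'm, 'z) chosen_tricat_scheme \<Rightarrow> 'm \<Rightarrow> ('m, 'm \<times> 'm \<times> 'm) arrow" where
  "j_map T f = j_ob T (Dom T f) \<cdot>\<^bsub>triangles0 T\<^esub> k_map T f"

definition pt_homology ::
  "('o, 'm, 'z) chosen_tricat_scheme \<Rightarrow> ('m, ('m, 'm \<times> 'm \<times> 'm) arrow, 'e) ab_functr \<Rightarrow> bool" where
  "pt_homology T H \<longleftrightarrow> is_functor (triangles0 T) Ab H \<and>
     (\<forall>f \<in> Ar T.
        exact_seq ([omap H (from_zero T (shift_ob T (Dom T f))), omap H f,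
                    omap H (from_zero T (Cod T f)), omap H (from_zero T (Dom T f))],
                   [dat (amap H (j_map T f)), dat (amap H (i_map T f)),
                    dat (amap H (bang_map T f))])) \<and>
     (\<forall>x. excising T x \<longrightarrow> is_iso Ab (amap H x))"

definition pt_homologies ::
  "('o, 'm, 'z) chosen_tricat_scheme
    \<Rightarrow> ('m, ('m, 'm \<times> 'm \<times> 'm) arrow, 'e) ab_functr_cat" where
  "pt_homologies T = full_subcat (functor_cat (triangles0 T) Ab) (pt_homology T)"


section \<open>From classical homologies to homologies on the pseudo-triangulated category\<close>

definition cone_homology ::
  "('o, 'm, 'z) chosen_tricat_scheme \<Rightarrow> ('o, 'm, 'e) ab_functr
    \<Rightarrow> ('m, ('m, 'm \<times> 'm \<times> 'm) arrow, 'e) ab_functr" where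
  "cone_homology T E =
     Functr (\<lambda>f \<in> Ob (triangles0 T). omap E (Cone T f))
       (\<lambda>t \<in> Ar (triangles0 T). case dat t of (a, b, c) \<Rightarrow> amap E c)"

definition cone_homology_functor ::
  "('o, 'm, 'z) chosen_tricat_scheme
    \<Rightarrow> (('o, 'm, 'e) ab_functr,
        (('o, 'm, 'e) ab_functr, 'o \<Rightarrow> 'e grp_hom) arrow,
        ('m, ('m, 'm \<times> 'm \<times> 'm) arrow, 'e) ab_functr,
        (('m, ('m, 'm \<times> 'm \<times> 'm) arrow, 'e) ab_functr, 'm \<Rightarrow> 'e grp_hom) arrow) functr" where
  "cone_homology_functor T =
     Functr (\<lambda>E \<in> Ob (classical_homologies T). cone_homology T E)
       (\<lambda>\<eta> \<in> Ar (classical_homologies T).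
          Arrow (cone_homology T (src \<eta>)) (cone_homology T (tgt \<eta>))
            (\<lambda>f \<in> Ob (triangles0 T). dat \<eta> (Cone T f)))"

end

theory Submission
  imports Defs
begin

text \<open>
  An arrow out of \<open>to_zero T X\<close> is the same thing as an arrow of \<open>T\<close> from \<open>X[1]\<close> to the cone of its target, so
  excising morphisms are those which induce an isomorphism on cones. In particular
  \<open>(0, u\<^sub>f, u) : [f] \<rightarrow> from_zero T C\<^sub>f\<close> is a natural excising morphism, so a homology \<open>H\<close> is determined by
  \<open>X \<mapsto> H (from_zero T X)\<close>, and the exact sequences of \<open>H\<close> turn into those of a classical homology. Its additivity
  is automatic: a half exact functor which kills the zero object preserves biproducts.
\<close>

section \<open>Categories and functors\<close>

text \<open>Both directions are precomposition: with \<open>cone_functor\<close>, which turns E into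
  h([f]) = E(C_f), and with \<open>bang_functor\<close>, which sends X to the arrow from zero to X.
  The equivalence is then formal, given natural maps from the identities to the two composites which
  become invertible under the functors considered. On T this map is
  \<open>CU T (from_zero T X)\<close>, an isomorphism; on the chosen triangles it is
  \<open>cone_map\<close>, in general only excising. Hence invertibility on that side is used only
  after applying a homology, and no equivalence of the base categories is involved. The obstacle is
  that fill-ins of triangle maps are not unique, so that functoriality of
  \<open>bang_functor\<close> is not automatic. It holds because a map out of
  \<open>from_zero T X\<close> is determined by its second component. The exactness derived from the
  axioms is that of Hom(W, -), so isomorphisms between cones are detected by a covariant Yoneda
  argument. The shift is known only as an equivalence of categories; that it preserves zero arrows
  has to be deduced.\<close>

lemma HomD: "f \<in> Hom C x y \<Longrightarrow> f \<in> Ar C \<and> Dom C f = x \<and> Cod C f = y"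
  by (simp add: Hom_def)

lemma is_iso_iff:
  "f \<in> Hom C x y \<Longrightarrow> is_iso C f \<longleftrightarrow>
    (\<exists>g \<in> Hom C y x. g \<cdot>\<^bsub>C\<^esub> f = Ident C x \<and> f \<cdot>\<^bsub>C\<^esub> g = Ident C y)"
  by (auto simp: is_iso_def Hom_def)

context category
begin

lemma Hom_Ob:
  assumes "f \<in> Hom C x y"
  shows "x \<in> Ob C" "y \<in> Ob C"
  using assms dom_cod by (auto simp: Hom_def)

lemma comp_Ar [simp]:
  assumes "f \<in> Ar C" "g \<in> Ar C" "Cod C f = Dom C g"
  shows "g \<cdot> f \<in> Ar C" "Dom C (g \<cdot> f) = Dom C f" "Cod C (g \<cdot> f) = Cod C g"
  using comp[of f "Dom C f" "Cod C f" g "Cod C g"] assms by (auto simp: Hom_def)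

lemma comp_assoc:
  assumes "f \<in> Ar C" "g \<in> Ar C" "h \<in> Ar C" "Cod C f = Dom C g" "Cod C g = Dom C h"
  shows "(h \<cdot> g) \<cdot> f = h \<cdot> (g \<cdot> f)"
  using assoc[of f "Dom C f" "Cod C f" g "Cod C g" h "Cod C h"] assms by (auto simp: Hom_def)

lemma comp_reassoc:
  assumes "h \<cdot> g = k" "f \<in> Ar C" "g \<in> Ar C" "h \<in> Ar C" "Cod C f = Dom C g" "Cod C g = Dom C h"
  shows "h \<cdot> (g \<cdot> f) = k \<cdot> f"
  using comp_assoc[of f g h] assms by simp

lemma Ident_Ar [simp]:
  assumes "x \<in> Ob C"
  shows "Ident C x \<in> Ar C" "Dom C (Ident C x) = x" "Cod C (Ident C x) = x"
  using ident[OF assms] by (auto simp: Hom_def)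

lemma comp_Ident [simp]:
  assumes "f \<in> Ar C"
  shows "Dom C f = x \<Longrightarrow> f \<cdot> Ident C x = f" "Cod C f = y \<Longrightarrow> Ident C y \<cdot> f = f"
  using assms ident_left ident_right by (auto simp: Hom_def)

lemma iso_cancel_left:
  assumes "is_iso C c" "c \<in> Hom C y z" "f \<in> Hom C x y" "g \<in> Hom C x y" "c \<cdot> f = c \<cdot> g"
  shows "f = g"
proof -
  obtain d where "d \<in> Hom C z y" "d \<cdot> c = Ident C y"
    using assms(1,2) by (auto simp: is_iso_iff)
  then show ?thesis
    using assms(3-5) assoc[OF assms(3,2)] assoc[OF assms(4,2)] ident_left by metis
qed

lemma iso_cancel_right:
  assumes "is_iso C c" "c \<in> Hom C x y" "f \<in> Hom C y z" "g \<in> Hom C y z" "f \<cdot> c = g \<cdot> c"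
  shows "f = g"
proof -
  obtain d where "d \<in> Hom C y x" "c \<cdot> d = Ident C y"
    using assms(1,2) by (auto simp: is_iso_iff)
  then show ?thesis
    using assms(3-5) assoc[OF _ assms(2,3)] assoc[OF _ assms(2,4)] ident_right by metis
qed

lemma is_iso_Ident: "x \<in> Ob C \<Longrightarrow> is_iso C (Ident C x)"
  using is_iso_iff[OF ident] ident by force

lemma is_iso_comp:
  assumes "is_iso C f" "f \<in> Hom C x y" "is_iso C g" "g \<in> Hom C y z"
  shows "is_iso C (g \<cdot> f)"
proof -
  obtain f' g' where f': "f' \<in> Hom C y x" "f' \<cdot> f = Ident C x" "f \<cdot> f' = Ident C y"
    and g': "g' \<in> Hom C z y" "g' \<cdot> g = Ident C y" "g \<cdot> g' = Ident C z"
    using assms by (auto simp: is_iso_iff)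
  have "(f' \<cdot> g') \<cdot> (g \<cdot> f) = f' \<cdot> ((g' \<cdot> g) \<cdot> f)" "(g \<cdot> f) \<cdot> (f' \<cdot> g') = g \<cdot> ((f \<cdot> f') \<cdot> g')"
    using assms f'(1) g'(1) by (auto simp: comp_assoc Hom_def)
  then have "(f' \<cdot> g') \<cdot> (g \<cdot> f) = Ident C x" "(g \<cdot> f) \<cdot> (f' \<cdot> g') = Ident C z"
    using f' g' assms by (auto simp: ident_left)
  then show ?thesis
    using is_iso_iff[OF comp[OF assms(2,4)]] comp[OF g'(1) f'(1)] by blast
qed

lemma is_iso_inverse:
  assumes "is_iso C f" "f \<in> Hom C x y"
  obtains g where "g \<in> Hom C y x" "is_iso C g" "g \<cdot> f = Ident C x" "f \<cdot> g = Ident C y"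
  using assms by (metis is_iso_iff)

text \<open>The preimage \<open>d\<close> of the identity is a right inverse of \<open>c\<close>. It
  is also a left inverse, since \<open>d \<cdot> c\<close> and the identity have the same composite
  with \<open>c\<close>. The criterion speaks of arrows into \<open>x\<close> and \<open>y\<close>
  only, the side on which triangles are shown to be exact.\<close>

lemma is_iso_Yoneda:
  assumes c: "c \<in> Hom C x y"
    and surj: "\<And>w f. f \<in> Hom C w y \<Longrightarrow> \<exists>g \<in> Hom C w x. c \<cdot> g = f"
    and inj: "\<And>w f g. \<lbrakk>f \<in> Hom C w x; g \<in> Hom C w x; c \<cdot> f = c \<cdot> g\<rbrakk> \<Longrightarrow> f = g"
  shows "is_iso C c"
proof -
  obtain d where d: "d \<in> Hom C y x" "c \<cdot> d = Ident C y"
    using surj[OF ident[OF Hom_Ob(2)[OF c]]] by blast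
  have "c \<cdot> (d \<cdot> c) = c \<cdot> Ident C x"
    using assoc[OF c d(1) c] d c ident_left ident_right by metis
  then have "d \<cdot> c = Ident C x"
    using inj[OF comp[OF c d(1)] ident[OF Hom_Ob(1)[OF c]]] by simp
  then show ?thesis
    using d c by (auto simp: is_iso_iff)
qed

end

lemma is_functorD:
  assumes "is_functor C D F"
  shows "x \<in> Ob C \<Longrightarrow> omap F x \<in> Ob D"
    and "f \<in> Hom C x y \<Longrightarrow> amap F f \<in> Hom D (omap F x) (omap F y)"
    and "x \<in> Ob C \<Longrightarrow> amap F (Ident C x) = Ident D (omap F x)"
    and "\<lbrakk>f \<in> Hom C x y; g \<in> Hom C y z\<rbrakk> \<Longrightarrow> amap F (g \<cdot>\<^bsub>C\<^esub> f) = amap F g \<cdot>\<^bsub>D\<^esub> amap F f"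
  using assms unfolding is_functor_def by (auto simp: PiE_iff)

lemma is_functorI:
  assumes "omap F \<in> extensional (Ob C)" "amap F \<in> extensional (Ar C)"
    and "\<And>x. x \<in> Ob C \<Longrightarrow> omap F x \<in> Ob D"
    and "\<And>f x y. f \<in> Hom C x y \<Longrightarrow> amap F f \<in> Hom D (omap F x) (omap F y)"
    and "\<And>x. x \<in> Ob C \<Longrightarrow> amap F (Ident C x) = Ident D (omap F x)"
    and "\<And>f g x y z. \<lbrakk>f \<in> Hom C x y; g \<in> Hom C y z\<rbrakk>
      \<Longrightarrow> amap F (g \<cdot>\<^bsub>C\<^esub> f) = amap F g \<cdot>\<^bsub>D\<^esub> amap F f"
  shows "is_functor C D F"
proof -
  have "amap F f \<in> Ar D" if "f \<in> Ar C" for f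
    using assms(4)[of f "Dom C f" "Cod C f"] that by (simp add: Hom_def)
  then show ?thesis
    unfolding is_functor_def using assms by (auto simp: PiE_iff)
qed

lemma functor_is_iso:
  assumes "category C" "is_functor C D F" "is_iso C f"
  shows "is_iso D (amap F f)"
proof -
  interpret category C by fact
  note F = is_functorD[OF assms(2)]
  let ?x = "Dom C f" and ?y = "Cod C f"
  have f: "f \<in> Hom C ?x ?y"
    using assms(3) by (simp add: is_iso_def Hom_def)
  then obtain g where g: "g \<in> Hom C ?y ?x" "g \<cdot>\<^bsub>C\<^esub> f = Ident C ?x" "f \<cdot>\<^bsub>C\<^esub> g = Ident C ?y"
    using assms(3) by (auto simp: is_iso_def)
  have "amap F g \<cdot>\<^bsub>D\<^esub> amap F f = Ident D (omap F ?x)"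
    using F(4)[OF f g(1)] F(3) Hom_Ob[OF f] g by simp
  moreover have "amap F f \<cdot>\<^bsub>D\<^esub> amap F g = Ident D (omap F ?y)"
    using F(4)[OF g(1) f] F(3) Hom_Ob[OF f] g by simp
  ultimately show ?thesis
    unfolding is_iso_iff[OF F(2)[OF f]] using F(2)[OF g(1)] by blast
qed

lemma is_functor_comp:
  assumes "category C" "is_functor C D F" "is_functor D K G"
  shows "is_functor C K (comp_functor C G F)"
proof -
  interpret category C by fact
  note F = is_functorD[OF assms(2)] and G = is_functorD[OF assms(3)]
  have a: "f \<in> Hom C x y \<Longrightarrow> x \<in> Ob C \<and> y \<in> Ob C \<and> f \<in> Ar C" for f x y
    using dom_cod by (auto simp: Hom_def)
  show ?thesis
  proof (rule is_functorI)
    fix f g x y z assume fg: "f \<in> Hom C x y" "g \<in> Hom C y z"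
    show "amap (comp_functor C G F) (g \<cdot>\<^bsub>C\<^esub> f) =
        amap (comp_functor C G F) g \<cdot>\<^bsub>K\<^esub> amap (comp_functor C G F) f"
      using a[OF fg(1)] a[OF fg(2)] a[OF comp[OF fg]] F(4)[OF fg] G(4)[OF F(2)[OF fg(1)] F(2)[OF fg(2)]]
      by (simp add: comp_functor_def compose_def)
  next
    fix f x y assume "f \<in> Hom C x y"
    then show "amap (comp_functor C G F) f \<in> Hom K (omap (comp_functor C G F) x) (omap (comp_functor C G F) y)"
      using a G(2)[OF F(2)] by (fastforce simp: comp_functor_def compose_def)
  qed (auto simp: comp_functor_def compose_def F G)
qed

lemma is_functor_id:
  assumes "category C"
  shows "is_functor C C (id_functor C)"
proof -
  interpret category C by fact
  show ?thesis
    by (rule is_functorI) (auto simp: id_functor_def Hom_def dom_cod)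
qed

lemma nat_transD:
  assumes "nat_trans C D F G \<eta>"
  shows "\<eta> \<in> extensional (Ob C)"
    and "x \<in> Ob C \<Longrightarrow> \<eta> x \<in> Hom D (omap F x) (omap G x)"
    and "f \<in> Hom C x y \<Longrightarrow> amap G f \<cdot>\<^bsub>D\<^esub> \<eta> x = \<eta> y \<cdot>\<^bsub>D\<^esub> amap F f"
  using assms unfolding nat_trans_def by auto

lemma nat_trans_inverse:
  assumes "category C" "category D" "is_functor C D F" "is_functor C D G"
    and \<eta>: "nat_trans C D F G \<eta>" and iso: "\<And>x. x \<in> Ob C \<Longrightarrow> is_iso D (\<eta> x)"
  obtains \<epsilon> where "nat_trans C D G F \<epsilon>"
    "\<And>x. x \<in> Ob C \<Longrightarrow> \<epsilon> x \<cdot>\<^bsub>D\<^esub> \<eta> x = Ident D (omap F x) \<and> \<eta> x \<cdot>\<^bsub>D\<^esub> \<epsilon> x = Ident D (omap G x) \<and> is_iso D (\<epsilon> x)"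
proof -
  interpret C: category C by fact
  interpret D: category D by fact
  note F = is_functorD[OF assms(3)] and G = is_functorD[OF assms(4)] and n = nat_transD[OF \<eta>]
  have "\<forall>x \<in> Ob C. \<exists>e. e \<in> Hom D (omap G x) (omap F x) \<and> e \<cdot>\<^bsub>D\<^esub> \<eta> x = Ident D (omap F x) \<and>
      \<eta> x \<cdot>\<^bsub>D\<^esub> e = Ident D (omap G x) \<and> is_iso D e"
    using D.is_iso_inverse[OF iso n(2)] by metis
  then obtain e where e: "\<forall>x \<in> Ob C. e x \<in> Hom D (omap G x) (omap F x) \<and> e x \<cdot>\<^bsub>D\<^esub> \<eta> x = Ident D (omap F x) \<and>
      \<eta> x \<cdot>\<^bsub>D\<^esub> e x = Ident D (omap G x) \<and> is_iso D (e x)"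
    by metis
  \<comment> \<open>Naturality of the inverse family is tested after composing with the invertible
    \<open>\<eta> y\<close>.\<close>
  have nat: "amap F f \<cdot>\<^bsub>D\<^esub> e x = e y \<cdot>\<^bsub>D\<^esub> amap G f" if f: "f \<in> Hom C x y" for f x y
  proof (rule D.iso_cancel_left[OF iso n(2)])
    note xy = C.Hom_Ob[OF f]
    show "y \<in> Ob C" "y \<in> Ob C" using xy by auto
    note h = e[rule_format, OF xy(1)] e[rule_format, OF xy(2)] n(2)[OF xy(1)] n(2)[OF xy(2)] F(2)[OF f] G(2)[OF f]
    show "amap F f \<cdot>\<^bsub>D\<^esub> e x \<in> Hom D (omap G x) (omap F y)" "e y \<cdot>\<^bsub>D\<^esub> amap G f \<in> Hom D (omap G x) (omap F y)"
      using h D.comp by blast+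
    have "\<eta> y \<cdot>\<^bsub>D\<^esub> (amap F f \<cdot>\<^bsub>D\<^esub> e x) = amap G f \<cdot>\<^bsub>D\<^esub> (\<eta> x \<cdot>\<^bsub>D\<^esub> e x)"
      using h by (simp add: D.comp_reassoc[OF n(3)[OF f, symmetric]] D.comp_assoc Hom_def)
    also have "\<dots> = amap G f" using h D.ident_right by metis
    also have "\<dots> = \<eta> y \<cdot>\<^bsub>D\<^esub> (e y \<cdot>\<^bsub>D\<^esub> amap G f)"
      using D.assoc[OF G(2)[OF f] conjunct1[OF h(2)] h(4)] h D.ident_left[OF G(2)[OF f]] by simp
    finally show "\<eta> y \<cdot>\<^bsub>D\<^esub> (amap F f \<cdot>\<^bsub>D\<^esub> e x) = \<eta> y \<cdot>\<^bsub>D\<^esub> (e y \<cdot>\<^bsub>D\<^esub> amap G f)" .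
  qed
  have "nat_trans C D G F (restrict e (Ob C))"
    unfolding nat_trans_def using e nat C.Hom_Ob by auto
  then show ?thesis using e that[of "restrict e (Ob C)"] by simp
qed

lemma nat_isomorphic_sym:
  assumes "category C" "category D" "is_functor C D F" "is_functor C D G" "nat_isomorphic C D F G"
  shows "nat_isomorphic C D G F"
  using assms unfolding nat_isomorphic_def by (metis nat_trans_inverse)

section \<open>Equivalences are faithful, full and essentially surjective\<close>

text \<open>By naturality of \<open>\<eta>\<close>, the composite of \<open>f\<close> with
  \<open>\<eta> x\<close> depends only on \<open>amap F f\<close>; the invertible
  \<open>\<eta> x\<close> is then cancelled.\<close>

lemma equivalence_faithful:
  assumes "is_equivalence C D F" "f \<in> Hom C x y" "g \<in> Hom C x y" "amap F f = amap F g"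
  shows "f = g"
proof -
  obtain G \<eta> where G: "is_functor D C G" and \<eta>: "nat_trans C C (comp_functor C G F) (id_functor C) \<eta>"
    and i: "\<forall>x \<in> Ob C. is_iso C (\<eta> x)" and C: "category C"
    using assms(1) by (auto simp: is_equivalence_def nat_isomorphic_def)
  interpret category C by fact
  note xy = Hom_Ob[OF assms(2)]
  have "\<eta> x \<in> Hom C (omap (comp_functor C G F) x) x"
    using nat_transD(2)[OF \<eta> xy(1)] xy by (simp add: id_functor_def)
  moreover have "f \<cdot>\<^bsub>C\<^esub> \<eta> x = g \<cdot>\<^bsub>C\<^esub> \<eta> x"
    using nat_transD(3)[OF \<eta> assms(2)] nat_transD(3)[OF \<eta> assms(3)] assms
    by (simp add: id_functor_def comp_functor_def compose_def Hom_def)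
  ultimately show ?thesis
    using iso_cancel_right[OF i[rule_format, OF xy(1)]] assms by blast
qed

lemma equivalence_inverse:
  assumes "is_equivalence C D F"
  obtains G where "is_equivalence D C G" "is_functor D C G"
    "nat_isomorphic C C (comp_functor C G F) (id_functor C)"
    "nat_isomorphic D D (comp_functor D F G) (id_functor D)"
  using assms by (auto simp: is_equivalence_def)

text \<open>The arrow is \<open>amap G k\<close> conjugated by \<open>\<eta>\<close>. That
  \<open>F\<close> sends it to \<open>k\<close> is seen after applying \<open>G\<close>, which is
  itself an equivalence and therefore faithful.\<close>

lemma equivalence_full:
  assumes eq: "is_equivalence C D F" and xy: "x \<in> Ob C" "y \<in> Ob C"
    and k: "k \<in> Hom D (omap F x) (omap F y)"
  shows "\<exists>f \<in> Hom C x y. amap F f = k"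
proof -
  obtain G where G: "is_equivalence D C G" "is_functor D C G"
    and iso: "nat_isomorphic C C (comp_functor C G F) (id_functor C)"
    using equivalence_inverse[OF eq] .
  interpret C: category C using eq by (simp add: is_equivalence_def)
  have F: "is_functor C D F" using eq by (simp add: is_equivalence_def)
  obtain \<eta> where \<eta>: "nat_trans C C (comp_functor C G F) (id_functor C) \<eta>"
    and i: "\<forall>x \<in> Ob C. is_iso C (\<eta> x)"
    using iso by (auto simp: nat_isomorphic_def)
  have h: "z \<in> Ob C \<Longrightarrow> \<eta> z \<in> Hom C (omap G (omap F z)) z" for z
    using nat_transD(2)[OF \<eta>] by (fastforce simp: id_functor_def comp_functor_def compose_def)
  obtain e where e: "e \<in> Hom C x (omap G (omap F x))" "e \<cdot>\<^bsub>C\<^esub> \<eta> x = Ident C (omap G (omap F x))"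
    using C.is_iso_inverse[OF i[rule_format, OF xy(1)] h[OF xy(1)]] .
  define f where "f = \<eta> y \<cdot>\<^bsub>C\<^esub> amap G k \<cdot>\<^bsub>C\<^esub> e"
  note Gk = is_functorD(2)[OF G(2) k]
  have f: "f \<in> Hom C x y"
    unfolding f_def using C.comp[OF e(1) C.comp[OF Gk h[OF xy(2)]]] .
  have fx: "f \<cdot>\<^bsub>C\<^esub> \<eta> x = \<eta> y \<cdot>\<^bsub>C\<^esub> amap G k"
    using C.assoc[OF h[OF xy(1)] e(1) C.comp[OF Gk h[OF xy(2)]]] e(2)
      C.ident_right[OF C.comp[OF Gk h[OF xy(2)]]] by (simp add: f_def)
  have "f \<cdot>\<^bsub>C\<^esub> \<eta> x = \<eta> y \<cdot>\<^bsub>C\<^esub> amap G (amap F f)"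
    using nat_transD(3)[OF \<eta> f] f by (simp add: id_functor_def comp_functor_def compose_def Hom_def)
  with fx have "amap G k = amap G (amap F f)"
    using C.iso_cancel_left[OF i[rule_format, OF xy(2)] h[OF xy(2)] Gk is_functorD(2)[OF G(2) is_functorD(2)[OF F f]]]
    by simp
  then have "k = amap F f"
    using equivalence_faithful[OF G(1) k is_functorD(2)[OF F f]] by simp
  then show ?thesis using f by blast
qed

lemma equivalence_ess_surj:
  assumes eq: "is_equivalence C D F" and y: "y \<in> Ob D"
  obtains x e where "x \<in> Ob C" "e \<in> Hom D (omap F x) y" "is_iso D e"
proof -
  obtain G where G: "is_functor D C G"
    and iso: "nat_isomorphic D D (comp_functor D F G) (id_functor D)"
    using equivalence_inverse[OF eq] .
  then obtain \<eta> where \<eta>: "nat_trans D D (comp_functor D F G) (id_functor D) \<eta>" "is_iso D (\<eta> y)"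
    using y by (auto simp: nat_isomorphic_def)
  have "\<eta> y \<in> Hom D (omap F (omap G y)) y"
    using nat_transD(2)[OF \<eta>(1) y] y by (simp add: id_functor_def comp_functor_def compose_def)
  then show ?thesis
    using that[of "omap G y"] \<eta>(2) is_functorD(1)[OF G y] by blast
qed

section \<open>Functor categories and their full subcategories\<close>

lemma category_full_subcat:
  assumes "category C"
  shows "category (full_subcat C P)"
proof -
  interpret category C by fact
  have "f \<in> Hom (full_subcat C P) x y \<longleftrightarrow> f \<in> Hom C x y \<and> P x \<and> P y" for f x y
    by (auto simp: full_subcat_def Hom_def)
  then show ?thesis
    by unfold_locales
      (use dom_cod ident comp ident_left ident_right assoc in \<open>auto simp: full_subcat_def\<close>)
qed

lemma Hom_functor_cat:
  "t \<in> Hom (functor_cat C D) F G \<longleftrightarrow>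
    (\<exists>\<eta>. t = Arrow F G \<eta> \<and> is_functor C D F \<and> is_functor C D G \<and> nat_trans C D F G \<eta>)"
  by (auto simp: Hom_def functor_cat_def)

lemma category_functor_cat:
  assumes "category C" "category D"
  shows "category (functor_cat C D)"
proof -
  interpret C: category C by fact
  interpret D: category D by fact
  have id: "nat_trans C D F F (\<lambda>x \<in> Ob C. Ident D (omap F x))" if "is_functor C D F" for F
    unfolding nat_trans_def
    using is_functorD[OF that] by (auto simp: D.ident D.ident_left D.ident_right C.Hom_Ob) 
      (metis C.Hom_Ob D.ident_left D.ident_right)
  have comp: "nat_trans C D F K (\<lambda>x \<in> Ob C. \<epsilon> x \<cdot>\<^bsub>D\<^esub> \<eta> x)"
    if F: "is_functor C D F" "is_functor C D G" "is_functor C D K" and n: "nat_trans C D F G \<eta>" "nat_trans C D G K \<epsilon>"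
    for F G K \<eta> \<epsilon>
    unfolding nat_trans_def
  proof (intro conjI allI ballI)
    fix f x y assume f: "f \<in> Hom C x y"
    note xy = C.Hom_Ob[OF f]
    have "amap K f \<cdot>\<^bsub>D\<^esub> (\<epsilon> x \<cdot>\<^bsub>D\<^esub> \<eta> x) = \<epsilon> y \<cdot>\<^bsub>D\<^esub> \<eta> y \<cdot>\<^bsub>D\<^esub> amap F f"
      using nat_transD(2)[OF n(1) xy(1)] nat_transD(2)[OF n(2) xy(1)] nat_transD(2)[OF n(1) xy(2)]
        nat_transD(2)[OF n(2) xy(2)] nat_transD(3)[OF n(1) f] is_functorD(2)[OF F(1) f]
        is_functorD(2)[OF F(2) f] is_functorD(2)[OF F(3) f]
      by (simp add: D.comp_reassoc[OF nat_transD(3)[OF n(2) f]] D.comp_assoc Hom_def)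
    then show "amap K f \<cdot>\<^bsub>D\<^esub> (\<lambda>x \<in> Ob C. \<epsilon> x \<cdot>\<^bsub>D\<^esub> \<eta> x) x = (\<lambda>x \<in> Ob C. \<epsilon> x \<cdot>\<^bsub>D\<^esub> \<eta> x) y \<cdot>\<^bsub>D\<^esub> amap F f"
      using xy by simp
  qed (use D.comp[OF nat_transD(2)[OF n(1)] nat_transD(2)[OF n(2)]] in auto)
  have ext: "(\<lambda>x \<in> Ob C. \<eta> x) = \<eta>" if "nat_trans C D F G \<eta>" for F G \<eta>
    using nat_transD(1)[OF that] by (simp add: extensional_restrict)
  show ?thesis
  proof unfold_locales
    fix t F G assume "t \<in> Hom (functor_cat C D) F G"
    then obtain \<eta> where t: "t = Arrow F G \<eta>" and n: "nat_trans C D F G \<eta>"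
      unfolding Hom_functor_cat by blast
    have "(\<lambda>x \<in> Ob C. \<eta> x \<cdot>\<^bsub>D\<^esub> Ident D (omap F x)) = \<eta>" "(\<lambda>x \<in> Ob C. Ident D (omap G x) \<cdot>\<^bsub>D\<^esub> \<eta> x) = \<eta>"
      using D.ident_right[OF nat_transD(2)[OF n]] D.ident_left[OF nat_transD(2)[OF n]] ext[OF n]
      by (simp_all cong: restrict_cong)
    then show "t \<cdot>\<^bsub>functor_cat C D\<^esub> Ident (functor_cat C D) F = t"
      "Ident (functor_cat C D) G \<cdot>\<^bsub>functor_cat C D\<^esub> t = t"
      by (simp_all add: t functor_cat_def cong: restrict_cong)
  next
    fix r s t F G K L
    assume "r \<in> Hom (functor_cat C D) F G" "s \<in> Hom (functor_cat C D) G K" "t \<in> Hom (functor_cat C D) K L"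
    then obtain \<eta> \<epsilon> \<theta> where e: "r = Arrow F G \<eta>" "s = Arrow G K \<epsilon>" "t = Arrow K L \<theta>"
      and n: "nat_trans C D F G \<eta>" "nat_trans C D G K \<epsilon>" "nat_trans C D K L \<theta>"
      unfolding Hom_functor_cat by blast
    show "t \<cdot>\<^bsub>functor_cat C D\<^esub> (s \<cdot>\<^bsub>functor_cat C D\<^esub> r) = t \<cdot>\<^bsub>functor_cat C D\<^esub> s \<cdot>\<^bsub>functor_cat C D\<^esub> r"
      using D.assoc[OF nat_transD(2)[OF n(1)] nat_transD(2)[OF n(2)] nat_transD(2)[OF n(3)]]
      by (simp add: e functor_cat_def cong: restrict_cong)
  next
    fix s t F G K
    assume "s \<in> Hom (functor_cat C D) F G" "t \<in> Hom (functor_cat C D) G K"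
    then show "t \<cdot>\<^bsub>functor_cat C D\<^esub> s \<in> Hom (functor_cat C D) F K"
      unfolding Hom_functor_cat using comp by (auto simp: functor_cat_def)
  next
    fix F assume "F \<in> Ob (functor_cat C D)"
    then show "Ident (functor_cat C D) F \<in> Hom (functor_cat C D) F F"
      unfolding Hom_functor_cat using id by (simp add: functor_cat_def)
  qed (auto simp: functor_cat_def)
qed

text \<open>The pointwise inverse stays in the subcategory because the latter is full, so
  isomorphisms of homologies can be checked object by object.\<close>

lemma is_iso_full_subcat_functor_cat:
  assumes "category C" "category D" and FG: "is_functor C D F" "is_functor C D G" "P F" "P G"
    and \<eta>: "nat_trans C D F G \<eta>" and iso: "\<And>x. x \<in> Ob C \<Longrightarrow> is_iso D (\<eta> x)"
  shows "is_iso (full_subcat (functor_cat C D) P) (Arrow F G \<eta>)"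
proof -
  obtain \<epsilon> where \<epsilon>: "nat_trans C D G F \<epsilon>"
    "\<And>x. x \<in> Ob C \<Longrightarrow> \<epsilon> x \<cdot>\<^bsub>D\<^esub> \<eta> x = Ident D (omap F x) \<and> \<eta> x \<cdot>\<^bsub>D\<^esub> \<epsilon> x = Ident D (omap G x) \<and> is_iso D (\<epsilon> x)"
    using nat_trans_inverse[OF assms(1-4) \<eta> iso] by metis
  then show ?thesis
    using FG \<eta> unfolding is_iso_def full_subcat_def functor_cat_def Hom_def
    by (fastforce intro!: bexI[of _ "Arrow G F \<epsilon>"] cong: restrict_cong)
qed

subsection \<open>Precomposition with a functor\<close>

lemma comp_functor_simps [simp]:
  "x \<in> Ob C \<Longrightarrow> omap (comp_functor C G F) x = omap G (omap F x)"
  "f \<in> Ar C \<Longrightarrow> amap (comp_functor C G F) f = amap G (amap F f)"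
  by (simp_all add: comp_functor_def compose_def)

lemma comp_functor_assoc:
  assumes "category A" "is_functor A B K"
  shows "comp_functor A (comp_functor B G H) K = comp_functor A G (comp_functor A H K)"
  using assms unfolding comp_functor_def is_functor_def by (auto simp: compose_def fun_eq_iff PiE_iff)

text \<open>The domain \<open>S\<close> is a parameter because both maps are restricted to its
  objects and arrows. This makes \<open>cone_homology_functor\<close> an instance by equality of
  functors, not merely up to isomorphism.\<close>

definition precomp_functor ::
  "(('p, 'n, 'q, 'k) functr, (('p, 'n, 'q, 'k) functr, 'p \<Rightarrow> 'k) arrow) cat
    \<Rightarrow> ('o, 'm, 'z) cat_scheme \<Rightarrow> ('o, 'm, 'p, 'n) functr
    \<Rightarrow> (('p, 'n, 'q, 'k) functr, (('p, 'n, 'q, 'k) functr, 'p \<Rightarrow> 'k) arrow,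
        ('o, 'm, 'q, 'k) functr, (('o, 'm, 'q, 'k) functr, 'o \<Rightarrow> 'k) arrow) functr" where
  "precomp_functor S A K =
     Functr (\<lambda>E \<in> Ob S. comp_functor A E K)
       (\<lambda>\<eta> \<in> Ar S. Arrow (comp_functor A (src \<eta>) K) (comp_functor A (tgt \<eta>) K) (\<lambda>x \<in> Ob A. dat \<eta> (omap K x)))"

lemma Hom_full_subcat_functor_cat:
  "t \<in> Hom (full_subcat (functor_cat C D) P) F G \<longleftrightarrow>
    (\<exists>\<eta>. t = Arrow F G \<eta> \<and> is_functor C D F \<and> is_functor C D G \<and> P F \<and> P G \<and> nat_trans C D F G \<eta>)"
  by (auto simp: Hom_def functor_cat_def full_subcat_def)

lemma Ob_full_subcat_functor_cat: "F \<in> Ob (full_subcat (functor_cat C D) P) \<longleftrightarrow> is_functor C D F \<and> P F"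
  by (simp add: full_subcat_def functor_cat_def)

lemma Ident_full_subcat_functor_cat:
  "Ident (full_subcat (functor_cat C D) P) F = Arrow F F (\<lambda>x \<in> Ob C. Ident D (omap F x))"
  by (simp add: full_subcat_def functor_cat_def)

lemma Comp_full_subcat_functor_cat:
  "Arrow G' H \<epsilon> \<cdot>\<^bsub>full_subcat (functor_cat C D) P\<^esub> Arrow F G \<eta> = Arrow F H (\<lambda>x \<in> Ob C. \<epsilon> x \<cdot>\<^bsub>D\<^esub> \<eta> x)"
  by (simp add: full_subcat_def functor_cat_def)

lemma Hom_imp_Ar: "f \<in> Hom C x y \<Longrightarrow> f \<in> Ar C"
  by (simp add: Hom_def)

lemma is_functor_precomp:
  assumes A: "category A" and B: "category B" and D: "category D" and K: "is_functor A B K"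
    and PQ: "\<And>E. \<lbrakk>is_functor B D E; P E\<rbrakk> \<Longrightarrow> Q (comp_functor A E K)"
  shows "is_functor (full_subcat (functor_cat B D) P) (full_subcat (functor_cat A D) Q)
    (precomp_functor (full_subcat (functor_cat B D) P) A K)"
    (is "is_functor ?S ?R ?F")
proof -
  interpret A: category A by fact
  interpret S: category ?S by (rule category_full_subcat[OF category_functor_cat[OF B D]])
  note Kd = is_functorD[OF K]
  have o: "omap ?F E = comp_functor A E K" if "is_functor B D E" "P E" for E
    using that by (simp add: precomp_functor_def Ob_full_subcat_functor_cat)
  have a: "amap ?F (Arrow E E' \<eta>) = Arrow (comp_functor A E K) (comp_functor A E' K) (\<lambda>x \<in> Ob A. \<eta> (omap K x))"
    if "Arrow E E' \<eta> \<in> Hom ?S E E'" for E E' \<eta>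
    using Hom_imp_Ar[OF that] by (simp add: precomp_functor_def)
  have nat: "nat_trans A D (comp_functor A E K) (comp_functor A E' K) (\<lambda>x \<in> Ob A. \<eta> (omap K x))"
    if "nat_trans B D E E' \<eta>" for E E' \<eta>
    unfolding nat_trans_def
    using nat_transD(2)[OF that Kd(1)] nat_transD(3)[OF that Kd(2)] A.Hom_Ob Hom_imp_Ar[of _ A] by auto
  show ?thesis
  proof (rule is_functorI)
    fix E assume ES: "E \<in> Ob ?S"
    then have E: "is_functor B D E" "P E" by (simp_all add: Ob_full_subcat_functor_cat)
    show "omap ?F E \<in> Ob ?R"
      using is_functor_comp[OF A K E(1)] PQ[OF E] o[OF E] by (simp add: Ob_full_subcat_functor_cat)
    show "amap ?F (Ident ?S E) = Ident ?R (omap ?F E)"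
      using a[OF S.ident[OF ES, unfolded Ident_full_subcat_functor_cat]] Kd(1)
      by (simp add: Ident_full_subcat_functor_cat o[OF E] cong: restrict_cong)
  next
    fix t E E' assume "t \<in> Hom ?S E E'"
    then obtain \<eta> where t: "t = Arrow E E' \<eta>" "Arrow E E' \<eta> \<in> Hom ?S E E'" and E: "is_functor B D E" "is_functor B D E'" "P E" "P E'"
      and n: "nat_trans B D E E' \<eta>"
      unfolding Hom_full_subcat_functor_cat by blast
    show "amap ?F t \<in> Hom ?R (omap ?F E) (omap ?F E')"
      using is_functor_comp[OF A K E(1)] is_functor_comp[OF A K E(2)] PQ E nat[OF n]
      unfolding t(1) a[OF t(2)] Hom_full_subcat_functor_cat by (simp add: o)
  next
    fix s t E E' E'' assume s: "s \<in> Hom ?S E E'" and t: "t \<in> Hom ?S E' E''"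
    obtain \<eta> \<epsilon> where e: "s = Arrow E E' \<eta>" "t = Arrow E' E'' \<epsilon>"
      using s t unfolding Hom_full_subcat_functor_cat by blast
    show "amap ?F (t \<cdot>\<^bsub>?S\<^esub> s) = amap ?F t \<cdot>\<^bsub>?R\<^esub> amap ?F s"
      using S.comp[OF s t] s t Kd(1) unfolding e Comp_full_subcat_functor_cat
      by (simp add: a Comp_full_subcat_functor_cat cong: restrict_cong)
  qed (auto simp: precomp_functor_def)
qed

text \<open>Whiskering \<open>\<theta>\<close> with \<open>E\<close> gives a map from
  \<open>E\<close> to its composite with \<open>N\<close>. Invertibility is asked of
  \<open>amap E (\<theta> x)\<close> and not of \<open>\<theta> x\<close>, since one of the
  comparison maps to which this is applied is inverted only by homologies.\<close>

lemma nat_isomorphic_precomp: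
  fixes B :: "('o, 'm, 'z) cat_scheme" and D :: "('p, 'n, 'w) cat_scheme"
  assumes S_def: "S = full_subcat (functor_cat B D) P" and B: "category B" and D: "category D" and N: "is_functor B B N"
    and \<theta>: "nat_trans B B (id_functor B) N \<theta>" and \<Phi>: "is_functor S S \<Phi>"
    and omap: "\<And>E. E \<in> Ob S \<Longrightarrow> omap \<Phi> E = comp_functor B E N"
    and amap: "\<And>E E' \<eta>. Arrow E E' \<eta> \<in> Hom S E E' \<Longrightarrow>
      amap \<Phi> (Arrow E E' \<eta>) = Arrow (comp_functor B E N) (comp_functor B E' N) (\<lambda>x \<in> Ob B. \<eta> (omap N x))"
    and iso: "\<And>E x. \<lbrakk>E \<in> Ob S; x \<in> Ob B\<rbrakk> \<Longrightarrow> is_iso D (amap E (\<theta> x))"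
  shows "nat_isomorphic S S (id_functor S) \<Phi>"
proof -
  interpret B: category B by fact
  interpret S: category S unfolding S_def by (rule category_full_subcat[OF category_functor_cat[OF B D]])
  define \<mu> where "\<mu> E = Arrow E (comp_functor B E N) (\<lambda>x \<in> Ob B. amap E (\<theta> x))" for E :: "('o, 'm, 'p, 'n) functr"
  have ob: "E \<in> Ob S \<longleftrightarrow> is_functor B D E \<and> P E" for E
    by (simp add: S_def Ob_full_subcat_functor_cat)
  have \<theta>x: "\<theta> x \<in> Hom B x (omap N x)" if "x \<in> Ob B" for x
    using nat_transD(2)[OF \<theta> that] that by (simp add: id_functor_def)
  have nat: "nat_trans B D E (comp_functor B E N) (\<lambda>x \<in> Ob B. amap E (\<theta> x))" if "is_functor B D E" for E
    unfolding nat_trans_def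
  proof (intro conjI allI ballI)
    fix f x y assume f: "f \<in> Hom B x y"
    note E = is_functorD[OF that] and xy = B.Hom_Ob[OF f]
    have "amap N f \<cdot>\<^bsub>B\<^esub> \<theta> x = \<theta> y \<cdot>\<^bsub>B\<^esub> f"
      using nat_transD(3)[OF \<theta> f] Hom_imp_Ar[OF f] by (simp add: id_functor_def)
    then have "amap E (amap N f) \<cdot>\<^bsub>D\<^esub> amap E (\<theta> x) = amap E (\<theta> y) \<cdot>\<^bsub>D\<^esub> amap E f"
      using E(4)[OF \<theta>x[OF xy(1)] is_functorD(2)[OF N f]] E(4)[OF f \<theta>x[OF xy(2)]] by simp
    then show "amap (comp_functor B E N) f \<cdot>\<^bsub>D\<^esub> (\<lambda>x \<in> Ob B. amap E (\<theta> x)) x = (\<lambda>x \<in> Ob B. amap E (\<theta> x)) y \<cdot>\<^bsub>D\<^esub> amap E f"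
      using xy Hom_imp_Ar[OF f] by simp
  qed (use is_functorD(2)[OF that \<theta>x] in auto)
  have S_comp: "comp_functor B E N \<in> Ob S" if "E \<in> Ob S" for E
    using is_functorD(1)[OF \<Phi> that] omap[OF that] by simp
  have \<mu>Hom: "\<mu> E \<in> Hom S E (comp_functor B E N)" if "E \<in> Ob S" for E
    using that S_comp[OF that] nat unfolding \<mu>_def S_def Hom_full_subcat_functor_cat
    by (simp add: Ob_full_subcat_functor_cat)
  have "nat_trans S S (id_functor S) \<Phi> (restrict \<mu> (Ob S))"
    unfolding nat_trans_def
  proof (intro conjI allI ballI)
    fix E assume "E \<in> Ob S"
    then show "restrict \<mu> (Ob S) E \<in> Hom S (omap (id_functor S) E) (omap \<Phi> E)"
      using \<mu>Hom omap by (simp add: id_functor_def)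
  next
    fix t E E' assume tH: "t \<in> Hom S E E'"
    then obtain \<alpha> where t: "t = Arrow E E' \<alpha>" and n: "nat_trans B D E E' \<alpha>"
      unfolding S_def Hom_full_subcat_functor_cat by blast
    \<comment> \<open>Naturality in \<open>E\<close> is naturality of \<open>\<alpha>\<close> at the
      single arrow \<open>\<theta> x\<close>.\<close>
    have "\<alpha> (omap N x) \<cdot>\<^bsub>D\<^esub> amap E (\<theta> x) = amap E' (\<theta> x) \<cdot>\<^bsub>D\<^esub> \<alpha> x" if "x \<in> Ob B" for x
      using nat_transD(3)[OF n \<theta>x[OF that]] by simp
    then show "amap \<Phi> t \<cdot>\<^bsub>S\<^esub> restrict \<mu> (Ob S) E = restrict \<mu> (Ob S) E' \<cdot>\<^bsub>S\<^esub> amap (id_functor S) t"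
      using S.Hom_Ob[OF tH] Hom_imp_Ar[OF tH] tH amap[of E E' \<alpha>] unfolding t
      by (simp add: \<mu>_def id_functor_def S_def Comp_full_subcat_functor_cat cong: restrict_cong)
  qed simp
  moreover have "is_iso S (\<mu> E)" if "E \<in> Ob S" for E
    unfolding S_def \<mu>_def
    by (rule is_iso_full_subcat_functor_cat[OF B D _ _ _ _ nat])
      (use that S_comp[OF that] iso[OF that] in \<open>simp_all add: ob\<close>)
  ultimately show ?thesis
    unfolding nat_isomorphic_def by (intro exI[of _ "restrict \<mu> (Ob S)"]) simp
qed

text \<open>Precomposing with \<open>K\<close> and then with \<open>L\<close> is precomposing with
  \<open>comp_functor B K L\<close>, so \<open>nat_isomorphic_precomp\<close> applies. The final
  symmetry reverses direction: \<open>\<theta>\<close> starts at the identity, whereas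
  \<open>is_equivalence\<close> asks for maps into it.\<close>

lemma nat_isomorphic_precomp_precomp:
  assumes S: "S = full_subcat (functor_cat B D) P" and R: "R = full_subcat (functor_cat A D) Q"
    and A: "category A" and B: "category B" and D: "category D"
    and K: "is_functor A B K" and L: "is_functor B A L"
    and F: "is_functor S R (precomp_functor S A K)" and G: "is_functor R S (precomp_functor R B L)"
    and \<theta>: "nat_trans B B (id_functor B) (comp_functor B K L) \<theta>"
    and iso: "\<And>E x. \<lbrakk>is_functor B D E; P E; x \<in> Ob B\<rbrakk> \<Longrightarrow> is_iso D (amap E (\<theta> x))"
  shows "nat_isomorphic S S (comp_functor S (precomp_functor R B L) (precomp_functor S A K)) (id_functor S)"
proof -
  let ?\<Phi> = "comp_functor S (precomp_functor R B L) (precomp_functor S A K)"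
  have cS: "category S" unfolding S by (rule category_full_subcat[OF category_functor_cat[OF B D]])
  have \<Phi>: "is_functor S S ?\<Phi>" by (rule is_functor_comp[OF cS F G])
  have "nat_isomorphic S S (id_functor S) ?\<Phi>"
  proof (rule nat_isomorphic_precomp[OF S B D is_functor_comp[OF B L K] \<theta> \<Phi>])
    fix E assume E: "E \<in> Ob S"
    then show "omap ?\<Phi> E = comp_functor B E (comp_functor B K L)"
      using is_functorD(1)[OF F E] comp_functor_assoc[OF B L] by (simp add: precomp_functor_def)
    show "is_iso D (amap E (\<theta> x))" if "x \<in> Ob B" for x
      using E iso that unfolding S Ob_full_subcat_functor_cat by blast
  next
    fix E E' \<eta> assume t: "Arrow E E' \<eta> \<in> Hom S E E'"
    show "amap ?\<Phi> (Arrow E E' \<eta>) =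
        Arrow (comp_functor B E (comp_functor B K L)) (comp_functor B E' (comp_functor B K L))
          (\<lambda>x \<in> Ob B. \<eta> (omap (comp_functor B K L) x))"
      using Hom_imp_Ar[OF t] Hom_imp_Ar[OF is_functorD(2)[OF F t]] is_functorD(1)[OF L]
      by (simp add: precomp_functor_def comp_functor_assoc[OF B L] cong: restrict_cong)
  qed
  then show ?thesis
    by (rule nat_isomorphic_sym[OF cS cS is_functor_id[OF cS] \<Phi>])
qed

text \<open>Both \<open>\<theta>\<close> and \<open>\<xi>\<close> point away from the identity and
  are inverted only by functors satisfying \<open>P\<close> and \<open>Q\<close> respectively. Thus
  the functor categories can be equivalent while \<open>A\<close> and \<open>B\<close> are
  not.\<close>

lemma is_equivalence_precomp:
  assumes A: "category A" and B: "category B" and D: "category D"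
    and K: "is_functor A B K" and L: "is_functor B A L"
    and PQ: "\<And>E. \<lbrakk>is_functor B D E; P E\<rbrakk> \<Longrightarrow> Q (comp_functor A E K)"
    and QP: "\<And>H. \<lbrakk>is_functor A D H; Q H\<rbrakk> \<Longrightarrow> P (comp_functor B H L)"
    and \<theta>: "nat_trans B B (id_functor B) (comp_functor B K L) \<theta>"
    and \<theta>_iso: "\<And>E x. \<lbrakk>is_functor B D E; P E; x \<in> Ob B\<rbrakk> \<Longrightarrow> is_iso D (amap E (\<theta> x))"
    and \<xi>: "nat_trans A A (id_functor A) (comp_functor A L K) \<xi>"
    and \<xi>_iso: "\<And>H x. \<lbrakk>is_functor A D H; Q H; x \<in> Ob A\<rbrakk> \<Longrightarrow> is_iso D (amap H (\<xi> x))"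
  shows "is_equivalence (full_subcat (functor_cat B D) P) (full_subcat (functor_cat A D) Q)
    (precomp_functor (full_subcat (functor_cat B D) P) A K)"
proof -
  let ?S = "full_subcat (functor_cat B D) P" and ?R = "full_subcat (functor_cat A D) Q"
  let ?F = "precomp_functor ?S A K" and ?G = "precomp_functor ?R B L"
  have F: "is_functor ?S ?R ?F" using PQ by (rule is_functor_precomp[OF A B D K])
  have G: "is_functor ?R ?S ?G" using QP by (rule is_functor_precomp[OF B A D L])
  have "nat_isomorphic ?S ?S (comp_functor ?S ?G ?F) (id_functor ?S)"
    using \<theta>_iso by (rule nat_isomorphic_precomp_precomp[OF refl refl A B D K L F G \<theta>])
  moreover have "nat_isomorphic ?R ?R (comp_functor ?R ?F ?G) (id_functor ?R)"
    using \<xi>_iso by (rule nat_isomorphic_precomp_precomp[OF refl refl B A D L K G F \<xi>])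
  moreover have "category ?S" "category ?R"
    by (intro category_full_subcat category_functor_cat A B D)+
  ultimately show ?thesis
    unfolding is_equivalence_def using F G by blast
qed

section \<open>Additive categories and abelian groups\<close>

context additive_category
begin

lemma plus_Hom: "\<lbrakk>f \<in> Hom C x y; g \<in> Hom C x y\<rbrakk> \<Longrightarrow> f \<boxplus> g \<in> Hom C x y"
  and Null_Hom: "\<lbrakk>x \<in> Ob C; y \<in> Ob C\<rbrakk> \<Longrightarrow> Null C x y \<in> Hom C x y"
  and plus_Null: "f \<in> Hom C x y \<Longrightarrow> f \<boxplus> Null C x y = f"
  and plus_comm: "\<lbrakk>f \<in> Hom C x y; g \<in> Hom C x y\<rbrakk> \<Longrightarrow> f \<boxplus> g = g \<boxplus> f"
  and plus_assoc: "\<lbrakk>f \<in> Hom C x y; g \<in> Hom C x y; h \<in> Hom C x y\<rbrakk> \<Longrightarrow> f \<boxplus> g \<boxplus> h = f \<boxplus> (g \<boxplus> h)"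
  and plus_cancel: "\<lbrakk>f \<in> Hom C x y; g \<in> Hom C x y; h \<in> Hom C x y\<rbrakk> \<Longrightarrow> f \<boxplus> h = g \<boxplus> h \<longleftrightarrow> f = g"
  and Neg_Hom: "f \<in> Hom C x y \<Longrightarrow> Neg C f \<in> Hom C x y"
  and plus_Neg: "f \<in> Hom C x y \<Longrightarrow> f \<boxplus> Neg C f = Null C x y"
proof -
  have G: "comm_group (hom_group C x y)" if "f \<in> Hom C x y" for f x y
    using hom_group Hom_Ob[OF that] by blast
  note simps = hom_group_def Neg_def
  show "f \<boxplus> g \<in> Hom C x y" if "f \<in> Hom C x y" "g \<in> Hom C x y" for f g x y
    using monoid.m_closed[OF comm_group.axioms(2)[OF G[OF that(1)], THEN group.is_monoid]] that by (simp add: simps)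
  show "Null C x y \<in> Hom C x y" if "x \<in> Ob C" "y \<in> Ob C" for x y
    using monoid.one_closed[OF comm_group.axioms(2)[OF hom_group[OF that], THEN group.is_monoid]] by (simp add: simps)
  show "f \<boxplus> Null C x y = f" if "f \<in> Hom C x y" for f x y
    using monoid.r_one[OF comm_group.axioms(2)[OF G[OF that(1)], THEN group.is_monoid]] that by (simp add: simps)
  show "f \<boxplus> g = g \<boxplus> f" if "f \<in> Hom C x y" "g \<in> Hom C x y" for f g x y
    using comm_monoid.m_comm[OF comm_group.axioms(1)[OF G[OF that(1)]]] that by (simp add: simps)
  show "f \<boxplus> g \<boxplus> h = f \<boxplus> (g \<boxplus> h)" if "f \<in> Hom C x y" "g \<in> Hom C x y" "h \<in> Hom C x y" for f g h x y
    using monoid.m_assoc[OF comm_group.axioms(2)[OF G[OF that(1)], THEN group.is_monoid]] that by (simp add: simps)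
  show "f \<boxplus> h = g \<boxplus> h \<longleftrightarrow> f = g" if "f \<in> Hom C x y" "g \<in> Hom C x y" "h \<in> Hom C x y" for f g h x y
    using group.right_cancel[OF comm_group.axioms(2)[OF G[OF that(1)]]] that by (simp add: simps)
  show "Neg C f \<in> Hom C x y" if "f \<in> Hom C x y" for f x y
    using group.inv_closed[OF comm_group.axioms(2)[OF G[OF that]]] that by (simp add: simps Hom_def)
  show "f \<boxplus> Neg C f = Null C x y" if "f \<in> Hom C x y" for f x y
    using group.r_inv[OF comm_group.axioms(2)[OF G[OF that]]] that by (simp add: simps Hom_def)
qed

lemma Null_plus: "f \<in> Hom C x y \<Longrightarrow> Null C x y \<boxplus> f = f"
  using plus_comm[OF Null_Hom] plus_Null Hom_Ob by simp

text \<open>Meant for composites with a zero arrow, which by distributivity are equal to their own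
  doubles.\<close>

lemma plus_idem_imp_Null:
  assumes "f \<in> Hom C x y" "f \<boxplus> f = f"
  shows "f = Null C x y"
  using plus_cancel[OF assms(1) Null_Hom assms(1)] Hom_Ob[OF assms(1)] Null_plus[OF assms(1)] assms by simp

lemma comp_Null:
  assumes "g \<in> Hom C y z" "x \<in> Ob C"
  shows "g \<cdot> Null C x y = Null C x z"
proof -
  note n = Null_Hom[OF assms(2) Hom_Ob(1)[OF assms(1)]]
  show ?thesis
    using plus_idem_imp_Null[OF comp[OF n assms(1)]] comp_plus_right[OF n n assms(1)] plus_Null[OF n] by simp
qed

lemma Null_comp:
  assumes "f \<in> Hom C x y" "z \<in> Ob C"
  shows "Null C y z \<cdot> f = Null C x z"
proof -
  note n = Null_Hom[OF Hom_Ob(2)[OF assms(1)] assms(2)]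
  show ?thesis
    using plus_idem_imp_Null[OF comp[OF assms(1) n]] comp_plus_left[OF assms(1) n n] plus_Null[OF n] by simp
qed

lemma Neg_unique:
  assumes "f \<in> Hom C x y" "g \<in> Hom C x y" "f \<boxplus> g = Null C x y"
  shows "g = Neg C f"
proof -
  have n: "Neg C f \<in> Hom C x y" using assms(1) by (rule Neg_Hom)
  have "g \<boxplus> f = Neg C f \<boxplus> f"
    unfolding plus_comm[OF assms(2,1)] plus_comm[OF n assms(1)] plus_Neg[OF assms(1)] assms(3) ..
  then show ?thesis
    using plus_cancel[OF assms(2) n assms(1)] by blast
qed

lemma comp_Neg:
  assumes "f \<in> Hom C x y" "g \<in> Hom C y z"
  shows "g \<cdot> Neg C f = Neg C (g \<cdot> f)" "Neg C g \<cdot> f = Neg C (g \<cdot> f)"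
proof -
  note xyz = Hom_Ob[OF assms(1)] Hom_Ob[OF assms(2)]
  show "g \<cdot> Neg C f = Neg C (g \<cdot> f)"
    using comp_plus_right[OF assms(1) Neg_Hom[OF assms(1)] assms(2)] plus_Neg[OF assms(1)] comp_Null[OF assms(2)] xyz
    by (intro Neg_unique[where x = x and y = z] comp[OF assms] comp[OF Neg_Hom[OF assms(1)] assms(2)]) simp
  show "Neg C g \<cdot> f = Neg C (g \<cdot> f)"
    using comp_plus_left[OF assms(1) assms(2) Neg_Hom[OF assms(2)]] plus_Neg[OF assms(2)] Null_comp[OF assms(1)] xyz
    by (intro Neg_unique[where x = x and y = z] comp[OF assms] comp[OF assms(1) Neg_Hom[OF assms(2)]]) simp
qed

lemma Neg_Neg: "f \<in> Hom C x y \<Longrightarrow> Neg C (Neg C f) = f"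
  using Neg_unique[OF Neg_Hom, of f x y f] plus_Neg[of f x y] plus_comm[OF Neg_Hom, of f x y f] by simp

lemma Neg_Null: "x \<in> Ob C \<Longrightarrow> y \<in> Ob C \<Longrightarrow> Neg C (Null C x y) = Null C x y"
  using Neg_unique[OF Null_Hom Null_Hom plus_Null[OF Null_Hom]] by simp

lemma Neg_eq_Null: 
  assumes "f \<in> Hom C x y" "Neg C f = Null C x y" 
  shows "f = Null C x y"
  using Neg_Neg[OF assms(1)] Neg_Null[OF Hom_Ob[OF assms(1)]] assms(2) by simp

lemma eq_iff_minus_Null:
  assumes "f \<in> Hom C x y" "g \<in> Hom C x y"
  shows "f \<boxplus> Neg C g = Null C x y \<longleftrightarrow> f = g"
  using plus_cancel[OF assms Neg_Hom[OF assms(2)]] plus_Neg[OF assms(2)] by simp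

lemma minus_plus_cancel:
  assumes "f \<in> Hom C x y" "g \<in> Hom C x y"
  shows "f \<boxplus> (g \<boxplus> Neg C f) = g"
proof -
  have n: "Neg C f \<in> Hom C x y" using assms(1) by (rule Neg_Hom)
  have "f \<boxplus> (g \<boxplus> Neg C f) = (g \<boxplus> Neg C f) \<boxplus> f" by (rule plus_comm[OF assms(1) plus_Hom[OF assms(2) n]])
  also have "\<dots> = g \<boxplus> (Neg C f \<boxplus> f)" by (rule plus_assoc[OF assms(2) n assms(1)])
  also have "Neg C f \<boxplus> f = Null C x y" using plus_comm[OF n assms(1)] plus_Neg[OF assms(1)] by simp
  finally show ?thesis using plus_Null[OF assms(2)] by simp
qed

lemma zero_object_unique:
  assumes "zero_object C z"
  shows "f \<in> Hom C x z \<Longrightarrow> f = Null C x z" "f \<in> Hom C z x \<Longrightarrow> f = Null C z x"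
proof -
  have z: "z \<in> Ob C" using assms by (simp add: zero_object_def)
  show "f = Null C x z" if "f \<in> Hom C x z"
    using assms that Null_Hom[OF Hom_Ob(1)[OF that] z] Hom_Ob(1)[OF that] unfolding zero_object_def by auto
  show "f = Null C z x" if "f \<in> Hom C z x"
    using assms that Null_Hom[OF z Hom_Ob(2)[OF that]] Hom_Ob(2)[OF that] unfolding zero_object_def by auto
qed

text \<open>Passing to differences turns injectivity of composition with \<open>c\<close> into
  triviality of its kernel, the form in which exactness of triangles delivers it.\<close>

lemma inj_comp_left:
  assumes c: "c \<in> Hom C x y" and "f \<in> Hom C w x" "g \<in> Hom C w x" "c \<cdot> f = c \<cdot> g"
    and ker: "\<And>h. \<lbrakk>h \<in> Hom C w x; c \<cdot> h = Null C w y\<rbrakk> \<Longrightarrow> h = Null C w x"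
  shows "f = g"
proof -
  have n: "Neg C g \<in> Hom C w x" using assms(3) by (rule Neg_Hom)
  have "c \<cdot> (f \<boxplus> Neg C g) = Null C w y"
    using comp_plus_right[OF assms(2) n c] comp_Neg(1)[OF assms(3) c] plus_Neg[OF comp[OF assms(3) c]] assms(4) by simp
  then show ?thesis
    using ker[OF plus_Hom[OF assms(2) n]] eq_iff_minus_Null[OF assms(2,3)] by simp
qed

end

section \<open>The category of abelian groups and exactness in it\<close>

lemma Hom_Ab:
  "t \<in> Hom Ab G H \<longleftrightarrow> src t = G \<and> tgt t = H \<and> comm_group G \<and> comm_group H \<and>
     dat t \<in> hom G H \<and> dat t \<in> extensional (carrier G)"
  by (cases t) (auto simp: Hom_def Ab_def)

lemma Ob_Ab: "G \<in> Ob Ab \<longleftrightarrow> comm_group G"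
  by (simp add: Ab_def)

lemma Ab_closed: "\<lbrakk>t \<in> Hom Ab G H; x \<in> carrier G\<rbrakk> \<Longrightarrow> dat t x \<in> carrier H"
  unfolding Hom_Ab by (auto simp: hom_def)

lemma Ab_group_hom: "t \<in> Hom Ab G H \<Longrightarrow> group_hom G H (dat t)"
  unfolding Hom_Ab by (simp add: group_hom_def group_hom_axioms_def comm_group_def)

lemma Ab_comp_apply:
  assumes "s \<in> Hom Ab G H" "x \<in> carrier G"
  shows "dat (t \<cdot>\<^bsub>Ab\<^esub> s) x = dat t (dat s x)"
proof -
  have "src s = G" using assms(1) by (simp add: Hom_def Ab_def)
  then show ?thesis using assms(2) by (simp add: Ab_def compose_def)
qed

lemma Ab_Ident_apply: "x \<in> carrier G \<Longrightarrow> dat (Ident Ab G) x = x"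
  by (simp add: Ab_def)

lemma Ab_plus_apply:
  assumes "s \<in> Hom Ab G H" "x \<in> carrier G"
  shows "dat (s \<boxplus>\<^bsub>Ab\<^esub> t) x = dat s x \<otimes>\<^bsub>H\<^esub> dat t x"
proof -
  have "src s = G" "tgt s = H" using assms(1) by (simp_all add: Hom_def Ab_def)
  then show ?thesis using assms(2) by (simp add: Ab_def)
qed

lemma Ab_eqI:
  assumes "s \<in> Hom Ab G H" "t \<in> Hom Ab G H" "\<And>x. x \<in> carrier G \<Longrightarrow> dat s x = dat t x"
  shows "s = t"
proof -
  have "dat s = dat t"
    using assms unfolding Hom_Ab by (auto intro: extensionalityI)
  then show ?thesis using assms unfolding Hom_Ab by (simp add: arrow.expand)
qed

lemma category_Ab: "category Ab"
proof
  fix s t r :: "'e grp_hom" and F G H K :: "'e monoid"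
  show "Dom Ab s \<in> Ob Ab \<and> Cod Ab s \<in> Ob Ab" if "s \<in> Ar Ab"
    using that by (auto simp: Ab_def)
  show id: "Ident Ab G \<in> Hom Ab G G" if "G \<in> Ob Ab" for G :: "'e monoid"
    using that unfolding Hom_Ab by (auto simp: Ab_def hom_def comm_group_def group.is_monoid monoid.m_closed)
  show comp: "t \<cdot>\<^bsub>Ab\<^esub> s \<in> Hom Ab G K" if "s \<in> Hom Ab G H" "t \<in> Hom Ab H K" for s t :: "'e grp_hom" and G H K
    using that unfolding Hom_Ab by (cases s; cases t) (auto simp: Ab_def hom_def compose_def comm_group_def group.is_monoid monoid.m_closed)
  show "s \<cdot>\<^bsub>Ab\<^esub> Ident Ab G = s" "Ident Ab H \<cdot>\<^bsub>Ab\<^esub> s = s" if s: "s \<in> Hom Ab G H"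
  proof -
    have gh: "G \<in> Ob Ab" "H \<in> Ob Ab" using s by (simp_all add: Hom_Ab Ob_Ab)
    show "s \<cdot>\<^bsub>Ab\<^esub> Ident Ab G = s"
      using gh id s by (intro Ab_eqI[OF comp s]) (auto simp: Ab_comp_apply[OF id] Ab_Ident_apply)
    show "Ident Ab H \<cdot>\<^bsub>Ab\<^esub> s = s"
      using gh id s Ab_closed[OF s] by (intro Ab_eqI[OF comp s]) (auto simp: Ab_comp_apply[OF s] Ab_Ident_apply)
  qed
  show "t \<cdot>\<^bsub>Ab\<^esub> (s \<cdot>\<^bsub>Ab\<^esub> r) = t \<cdot>\<^bsub>Ab\<^esub> s \<cdot>\<^bsub>Ab\<^esub> r"
    if r: "r \<in> Hom Ab F G" and s: "s \<in> Hom Ab G H" and t: "t \<in> Hom Ab H K"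
  proof (rule Ab_eqI)
    show "t \<cdot>\<^bsub>Ab\<^esub> (s \<cdot>\<^bsub>Ab\<^esub> r) \<in> Hom Ab F K" "t \<cdot>\<^bsub>Ab\<^esub> s \<cdot>\<^bsub>Ab\<^esub> r \<in> Hom Ab F K"
      using comp[OF comp[OF r s] t] comp[OF r comp[OF s t]] .
    show "dat (t \<cdot>\<^bsub>Ab\<^esub> (s \<cdot>\<^bsub>Ab\<^esub> r)) x = dat (t \<cdot>\<^bsub>Ab\<^esub> s \<cdot>\<^bsub>Ab\<^esub> r) x" if "x \<in> carrier F" for x
      using Ab_closed[OF r that] that
      by (simp add: Ab_comp_apply[OF r] Ab_comp_apply[OF s] Ab_comp_apply[OF comp[OF r s]])
  qed
qed

lemma is_iso_Ab_bij:
  assumes "is_iso Ab t" "t \<in> Hom Ab G H"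
  shows "bij_betw (dat t) (carrier G) (carrier H)"
proof -
  obtain s where s: "s \<in> Hom Ab H G" "s \<cdot>\<^bsub>Ab\<^esub> t = Ident Ab G" "t \<cdot>\<^bsub>Ab\<^esub> s = Ident Ab H"
    using assms by (auto simp: is_iso_iff)
  have "dat s (dat t x) = x" if "x \<in> carrier G" for x
    using Ab_comp_apply[OF assms(2) that] s(2) Ab_Ident_apply[OF that] by metis
  moreover have "dat t (dat s x) = x" if "x \<in> carrier H" for x
    using Ab_comp_apply[OF s(1) that] s(3) Ab_Ident_apply[OF that] by metis
  ultimately show ?thesis
    using Ab_closed[OF assms(2)] Ab_closed[OF s(1)] by (intro bij_betw_byWitness[where f' = "dat s"]) auto
qed

text \<open>\<open>exact_seq\<close> lists groups and maps from last to first and bundles the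
  homomorphism conditions. For arrows of \<open>Ab\<close> these hold anyway, so what remains is
  exactness at the two inner groups.\<close>

lemma exact_seq_Ab:
  assumes "f \<in> Hom Ab A B" "g \<in> Hom Ab B C" "h \<in> Hom Ab C D"
  shows "exact_seq ([D, C, B, A], [dat h, dat g, dat f]) \<longleftrightarrow>
    kernel B C (dat g) = dat f ` carrier A \<and> kernel C D (dat h) = dat g ` carrier B"
  using Ab_group_hom[OF assms(1)] Ab_group_hom[OF assms(2)] Ab_group_hom[OF assms(3)]
  by (auto simp: group_hom_def group_hom_axioms_def)

text \<open>Exactness at the middle group is invariant under isomorphism: \<open>b\<close> maps
  kernel onto kernel because \<open>c\<close> is injective, and image onto image because
  \<open>a\<close> is surjective.\<close>

lemma kernel_image_transport:
  assumes Hom: "f \<in> Hom Ab A B" "g \<in> Hom Ab B C" "f' \<in> Hom Ab A' B'" "g' \<in> Hom Ab B' C'"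
    "a \<in> Hom Ab A A'" "b \<in> Hom Ab B B'" "c \<in> Hom Ab C C'"
    and iso: "is_iso Ab a" "is_iso Ab b" "is_iso Ab c"
    and sq: "b \<cdot>\<^bsub>Ab\<^esub> f = f' \<cdot>\<^bsub>Ab\<^esub> a" "c \<cdot>\<^bsub>Ab\<^esub> g = g' \<cdot>\<^bsub>Ab\<^esub> b"
    and ex: "kernel B C (dat g) = dat f ` carrier A"
  shows "kernel B' C' (dat g') = dat f' ` carrier A'"
proof -
  have bij: "bij_betw (dat a) (carrier A) (carrier A')" "bij_betw (dat b) (carrier B) (carrier B')"
    "bij_betw (dat c) (carrier C) (carrier C')"
    using is_iso_Ab_bij Hom iso by auto
  have sq1: "dat b (dat f x) = dat f' (dat a x)" if "x \<in> carrier A" for x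
    using sq(1) Ab_comp_apply[OF Hom(1) that] Ab_comp_apply[OF Hom(5) that] by metis
  have sq2: "dat c (dat g x) = dat g' (dat b x)" if "x \<in> carrier B" for x
    using sq(2) Ab_comp_apply[OF Hom(2) that] Ab_comp_apply[OF Hom(6) that] by metis
  interpret c: group_hom C C' "dat c" using Ab_group_hom Hom by auto
  have c1: "dat c x = \<one>\<^bsub>C'\<^esub> \<longleftrightarrow> x = \<one>\<^bsub>C\<^esub>" if "x \<in> carrier C" for x
    using bij(3) that c.hom_one c.G.one_closed unfolding bij_betw_def inj_on_def by metis
  have "kernel B' C' (dat g') = dat b ` kernel B C (dat g)"
  proof -
    have "dat g' (dat b x) = \<one>\<^bsub>C'\<^esub> \<longleftrightarrow> dat g x = \<one>\<^bsub>C\<^esub>" if "x \<in> carrier B" for x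
      using sq2[OF that] c1[OF Ab_closed[OF Hom(2) that]] by simp
    then show ?thesis
      using bij(2) unfolding kernel_def bij_betw_def by force
  qed
  also have "\<dots> = dat f' ` dat a ` carrier A"
    unfolding ex image_image using sq1 by simp
  also have "\<dots> = dat f' ` carrier A'"
    using bij(1) by (simp add: bij_betw_def)
  finally show ?thesis .
qed

text \<open>Exactness forces \<open>E\<close> of a biproduct of two copies of \<open>x\<close> to be
  spanned by the images of the two injections, and \<open>f \<boxplus> g\<close> factors through
  that biproduct. The hypothesis \<open>ex\<close> asks for some \<open>g\<close> that kills
  \<open>f\<close> and makes \<open>E\<close> exact, without any universal property; cones are of
  this kind.\<close>

lemma (in additive_category) half_exact_additive:
  assumes E: "is_functor C Ab E" and z: "zero_object C z" and triv: "carrier (omap E z) = {\<one>\<^bsub>omap E z\<^esub>}"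
    and ex: "\<And>f x y. f \<in> Hom C x y \<Longrightarrow> \<exists>w g. g \<in> Hom C y w \<and> g \<cdot> f = Null C x w \<and>
      kernel (omap E y) (omap E w) (dat (amap E g)) = dat (amap E f) ` carrier (omap E x)"
  shows "additive_functor C Ab E"
  unfolding additive_functor_def
proof (intro conjI E allI ballI)
  fix x y f g assume f: "f \<in> Hom C x y" and g: "g \<in> Hom C x y"
  note F = is_functorD[OF E]
  have x: "x \<in> Ob C" and zo: "z \<in> Ob C"
    using Hom_Ob[OF f] z by (auto simp: zero_object_def)
  define e where "e h = dat (amap E h)" for h
  have e_closed: "e h t \<in> carrier (omap E b)" if "h \<in> Hom C a b" "t \<in> carrier (omap E a)" for h a b t
    unfolding e_def using Ab_closed[OF F(2)[OF that(1)] that(2)] .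
  have e_comp: "e (k \<cdot> h) t = e k (e h t)"
    if "h \<in> Hom C a b" "k \<in> Hom C b c" "t \<in> carrier (omap E a)" for h k a b c t
    unfolding e_def F(4)[OF that(1,2)] using Ab_comp_apply[OF F(2)[OF that(1)] that(3)] .
  have e_id: "e (Ident C a) t = t" if "a \<in> Ob C" "t \<in> carrier (omap E a)" for a t
    unfolding e_def using F(3)[OF that(1)] Ab_Ident_apply[OF that(2)] by simp
  have e_hom: "group_hom (omap E a) (omap E b) (e h)" if "h \<in> Hom C a b" for h a b
    unfolding e_def using Ab_group_hom[OF F(2)[OF that]] .
  have e_Null: "e (Null C a b) t = \<one>\<^bsub>omap E b\<^esub>" if "a \<in> Ob C" "b \<in> Ob C" "t \<in> carrier (omap E a)" for a b t
  proof -
    note n = Null_Hom[OF that(1) zo] Null_Hom[OF zo that(2)]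
    \<comment> \<open>A zero arrow factors through \<open>z\<close>, whose group is trivial.\<close>
    have "e (Null C a b) t = e (Null C z b) (e (Null C a z) t)"
      using e_comp[OF n that(3)] comp_Null[OF n(2) that(1)] by simp
    also have "e (Null C a z) t = \<one>\<^bsub>omap E z\<^esub>"
      using e_closed[OF n(1) that(3)] triv by simp
    finally show ?thesis using group_hom.hom_one[OF e_hom[OF n(2)]] by simp
  qed
  obtain s i p j q where "biproduct C x x s i j p q"
    using ex_biproduct[OF x x] by blast
  then have s: "s \<in> Ob C" and i: "i \<in> Hom C x s" and j: "j \<in> Hom C x s" and p: "p \<in> Hom C s x" and q: "q \<in> Hom C s x"
    and pi: "p \<cdot> i = Ident C x" and qj: "q \<cdot> j = Ident C x" and pj: "p \<cdot> j = Null C x x" and qi: "q \<cdot> i = Null C x x"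
    and sum: "(i \<cdot> p) \<boxplus> (j \<cdot> q) = Ident C s"
    by (simp_all add: biproduct_def)
  interpret S: comm_group "omap E s" using F(1)[OF s] by (simp add: Ob_Ab)
  interpret X: comm_group "omap E x" using F(1)[OF x] by (simp add: Ob_Ab)
  interpret i: group_hom "omap E x" "omap E s" "e i" by (rule e_hom[OF i])
  interpret j: group_hom "omap E x" "omap E s" "e j" by (rule e_hom[OF j])
  interpret p: group_hom "omap E s" "omap E x" "e p" by (rule e_hom[OF p])
  interpret q: group_hom "omap E s" "omap E x" "e q" by (rule e_hom[OF q])
  have decomp: "t = e i (e p t) \<otimes>\<^bsub>omap E s\<^esub> e j (e q t)" if t: "t \<in> carrier (omap E s)" for t
  proof -
    obtain w u where u: "u \<in> Hom C s w" "u \<cdot> i = Null C x w"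
      and ker: "kernel (omap E s) (omap E w) (e u) = e i ` carrier (omap E x)"
      using ex[OF i] unfolding e_def by blast
    note w = Hom_Ob(2)[OF u(1)]
    \<comment> \<open>Since \<open>u\<close> kills \<open>i\<close>, splitting the identity of
      \<open>s\<close> makes \<open>u\<close> factor through \<open>q\<close>. So whatever
      \<open>e q\<close> kills is killed by \<open>e u\<close> and hence lies in the image of
      \<open>e i\<close>.\<close>
    have "u = u \<cdot> ((i \<cdot> p) \<boxplus> (j \<cdot> q))" using ident_right[OF u(1)] sum by simp
    also have "\<dots> = ((u \<cdot> i) \<cdot> p) \<boxplus> ((u \<cdot> j) \<cdot> q)"
      using comp_plus_right[OF comp[OF p i] comp[OF q j] u(1)] assoc[OF p i u(1)] assoc[OF q j u(1)] by simp
    also have "\<dots> = (u \<cdot> j) \<cdot> q"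
      using u(2) Null_comp[OF p w] Null_plus[OF comp[OF q comp[OF j u(1)]]] by simp
    finally have uq: "u = (u \<cdot> j) \<cdot> q" .
    \<comment> \<open>What is left of \<open>t\<close> after removing its
      \<open>j\<close>-component. It is killed by \<open>e q\<close>, hence comes from some
      \<open>v\<close> along \<open>e i\<close>, and applying \<open>e p\<close> identifies
      \<open>v\<close> as \<open>e p t\<close>.\<close>
    define r where "r = t \<otimes>\<^bsub>omap E s\<^esub> inv\<^bsub>omap E s\<^esub> e j (e q t)"
    have r: "r \<in> carrier (omap E s)" using t by (simp add: r_def)
    have "e q (e j (e q t)) = e q t"
      using e_comp[OF j q q.hom_closed[OF t]] qj e_id[OF x q.hom_closed[OF t]] by simp
    then have "e q r = \<one>\<^bsub>omap E x\<^esub>" using t by (simp add: r_def)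
    then have "e u r = \<one>\<^bsub>omap E w\<^esub>"
      using e_comp[OF q comp[OF j u(1)] r] uq group_hom.hom_one[OF e_hom[OF comp[OF j u(1)]]] by simp
    then obtain v where v: "v \<in> carrier (omap E x)" "r = e i v"
      using ker r by (auto simp: kernel_def)
    have "e p (e j (e q t)) = \<one>\<^bsub>omap E x\<^esub>"
      using e_comp[OF j p q.hom_closed[OF t]] pj e_Null[OF x x q.hom_closed[OF t]] by simp
    then have "e p r = e p t" using t by (simp add: r_def)
    moreover have "e p r = v" using e_comp[OF i p v(1)] pi e_id[OF x v(1)] v(2) by simp
    ultimately have "e i (e p t) = r" using v(2) by simp
    then show ?thesis using t by (simp add: r_def S.m_assoc)
  qed
  \<comment> \<open>\<open>d\<close> is the diagonal and \<open>n\<close> the map out of the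
    biproduct with components \<open>f\<close> and \<open>g\<close>; their composite is the
    sum.\<close>
  define d where "d = i \<boxplus> j"
  define n where "n = (f \<cdot> p) \<boxplus> (g \<cdot> q)"
  have d: "d \<in> Hom C x s" and n: "n \<in> Hom C s y"
    unfolding d_def n_def using i j f g p q by (auto intro!: plus_Hom comp)
  note idx = ident[OF x]
  have pd: "p \<cdot> d = Ident C x"
    unfolding d_def comp_plus_right[OF i j p] pi pj by (rule plus_Null[OF idx])
  have qd: "q \<cdot> d = Ident C x"
    unfolding d_def comp_plus_right[OF i j q] qj qi by (rule Null_plus[OF idx])
  have ni: "n \<cdot> i = f"
    unfolding n_def comp_plus_left[OF i comp[OF p f] comp[OF q g]] assoc[OF i p f, symmetric] assoc[OF i q g, symmetric] pi qi
    using ident_right[OF f] comp_Null[OF g x] plus_Null[OF f] by simp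
  have nj: "n \<cdot> j = g"
    unfolding n_def comp_plus_left[OF j comp[OF p f] comp[OF q g]] assoc[OF j p f, symmetric] assoc[OF j q g, symmetric] pj qj
    using ident_right[OF g] comp_Null[OF f x] Null_plus[OF g] by simp
  have nd: "n \<cdot> d = f \<boxplus> g"
    unfolding d_def comp_plus_right[OF i j n] ni nj ..
  interpret n: group_hom "omap E s" "omap E y" "e n" by (rule e_hom[OF n])
  interpret d: group_hom "omap E x" "omap E s" "e d" by (rule e_hom[OF d])
  have sum_apply: "e (f \<boxplus> g) t = e f t \<otimes>\<^bsub>omap E y\<^esub> e g t" if t: "t \<in> carrier (omap E x)" for t
  proof -
    have "e d t = e i t \<otimes>\<^bsub>omap E s\<^esub> e j t"
      using decomp[OF d.hom_closed[OF t]] e_comp[OF d p t] e_comp[OF d q t] pd qd e_id[OF x t] by simp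
    then show ?thesis
      using e_comp[OF d n t] e_comp[OF i n t] e_comp[OF j n t] ni nj nd t by simp
  qed
  have E_plus: "amap E f \<boxplus>\<^bsub>Ab\<^esub> amap E g \<in> Hom Ab (omap E x) (omap E y)"
  proof -
    interpret Y: comm_group "omap E y" using F(1)[OF Hom_Ob(2)[OF f]] by (simp add: Ob_Ab)
    show ?thesis
      using F(2)[OF f] F(2)[OF g] unfolding Hom_Ab
      by (auto simp: Ab_def hom_def Pi_iff Y.m_ac)
  qed
  show "amap E (f \<boxplus> g) = amap E f \<boxplus>\<^bsub>Ab\<^esub> amap E g"
    using sum_apply Ab_plus_apply[OF F(2)[OF f]]
    by (intro Ab_eqI[OF F(2)[OF plus_Hom[OF f g]] E_plus]) (auto simp: e_def)
qed


section \<open>Triangulated categories\<close>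

context triangulated_category
begin

lemma shift_functor: "is_functor T T (Shift T)"
  using shift by (simp add: is_equivalence_def)

lemma shift_Hom: "f \<in> Hom T X Y \<Longrightarrow> shift_ar T f \<in> Hom T (shift_ob T X) (shift_ob T Y)"
  by (rule is_functorD(2)[OF shift_functor])

lemma shift_Ob: "X \<in> Ob T \<Longrightarrow> shift_ob T X \<in> Ob T"
  by (rule is_functorD(1)[OF shift_functor])

lemma shift_comp: "\<lbrakk>f \<in> Hom T X Y; g \<in> Hom T Y Z\<rbrakk> \<Longrightarrow> shift_ar T (g \<cdot> f) = shift_ar T g \<cdot> shift_ar T f"
  by (rule is_functorD(4)[OF shift_functor])

lemma Zero_Ob: "Zero T \<in> Ob T"
  using zero by (simp add: zero_object_def)

section \<open>Vanishing composites and exactness of Hom(W, -) on distinguished triangles\<close>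

lemma dist_Hom:
  assumes "(f, g, h) \<in> Dist T" "f \<in> Hom T X Y"
  shows "g \<in> Hom T Y (Cod T g)" "h \<in> Hom T (Cod T g) (shift_ob T X)"
  using dist_triangle[OF assms(1)] assms(2) by (auto simp: triangle_def Hom_def)

text \<open>The identity triangle on \<open>X\<close> maps to the given one by
  \<open>(Ident T X, f, c)\<close>, and its second commuting square factors
  \<open>g \<cdot> f\<close> through the zero object.\<close>

lemma dist_comp_zero:
  assumes d: "(f, g, h) \<in> Dist T" and f: "f \<in> Hom T X Y" and g: "g \<in> Hom T Y Z"
  shows "g \<cdot> f = Null T X Z"
proof -
  note X = Hom_Ob(1)[OF f]
  have h: "h \<in> Hom T Z (shift_ob T X)" using dist_Hom[OF d f] g by (simp add: Hom_def)
  obtain c where "triangle_map T (Ident T X, Null T X (Zero T), Null T (Zero T) (shift_ob T X)) (f, g, h) (Ident T X, f, c)"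
    using TR5[OF TR2[OF X] d, of "Ident T X" f] ident[OF X] f X by (auto simp: Hom_def)
  then have "c \<in> Hom T (Zero T) Z" "c \<cdot> Null T X (Zero T) = g \<cdot> f"
    using h Null_Hom[OF Zero_Ob shift_Ob[OF X]] by (auto simp: triangle_map_def Hom_def)
  then show ?thesis
    using comp_Null X by metis
qed

text \<open>These are rotations of \<open>dist_comp_zero\<close>; the sign that TR3 puts on
  \<open>shift_ar T f\<close> is stripped afterwards.\<close>

lemma dist_comp_zero':
  assumes d: "(f, g, h) \<in> Dist T" and f: "f \<in> Hom T X Y" and g: "g \<in> Hom T Y Z"
  shows "h \<cdot> g = Null T Y (shift_ob T X)" "shift_ar T f \<cdot> h = Null T Z (shift_ob T Y)"
proof -
  have h: "h \<in> Hom T Z (shift_ob T X)" using dist_Hom[OF d f] g by (simp add: Hom_def)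
  show "h \<cdot> g = Null T Y (shift_ob T X)" by (rule dist_comp_zero[OF TR3[OF d] g h])
  have "Neg T (shift_ar T f \<cdot> h) = Null T Z (shift_ob T Y)"
    using dist_comp_zero[OF TR3[OF TR3[OF d]] h Neg_Hom[OF shift_Hom[OF f]]] comp_Neg(2)[OF h shift_Hom[OF f]] by simp
  then show "shift_ar T f \<cdot> h = Null T Z (shift_ob T Y)"
    by (rule Neg_eq_Null[OF comp[OF h shift_Hom[OF f]]])
qed

text \<open>The rotated identity triangle on \<open>W\<close> maps to the rotation of the given one by \<open>k\<close>; its third component is a shifted lift of \<open>k\<close>.\<close>

lemma Hom_exact:
  assumes d: "(f, g, h) \<in> Dist T" and f: "f \<in> Hom T X Y" and g: "g \<in> Hom T Y Z"
    and k: "k \<in> Hom T W Y" "g \<cdot> k = Null T W Z"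
  shows "\<exists>l \<in> Hom T W X. f \<cdot> l = k"
proof -
  note W = Hom_Ob(1)[OF k(1)] and X = Hom_Ob(1)[OF f] and Z = Hom_Ob(2)[OF g]
  have h: "h \<in> Hom T Z (shift_ob T X)" using dist_Hom[OF d f] g by (simp add: Hom_def)
  note WZ = Null_Hom[OF W Zero_Ob] and ZZ = Null_Hom[OF Zero_Ob Z] and f1 = shift_Hom[OF f] and k1 = shift_Hom[OF k(1)]
  note i1 = shift_Hom[OF ident[OF W]]
  have "Null T (Zero T) Z \<cdot> Null T W (Zero T) = g \<cdot> k"
    using comp_Null[OF ZZ W] k(2) by simp
  then obtain c where "triangle_map T
      (Null T W (Zero T), Null T (Zero T) (shift_ob T W), Neg T (shift_ar T (Ident T W)))
      (g, h, Neg T (shift_ar T f)) (k, Null T (Zero T) Z, c)"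
    using TR5[OF TR3[OF TR2[OF W]] TR3[OF d], of k "Null T (Zero T) Z"] WZ ZZ k(1) g by (auto simp: Hom_def)
  then have c: "c \<in> Hom T (shift_ob T W) (shift_ob T X)"
    and eq: "shift_ar T k \<cdot> Neg T (shift_ar T (Ident T W)) = Neg T (shift_ar T f) \<cdot> c"
    using Neg_Hom[OF i1] Neg_Hom[OF f1] by (auto simp: triangle_map_def Hom_def)
  \<comment> \<open>Both rotated triangles carry a sign in their last arrow, so the signs
    cancel.\<close>
  have "Neg T (shift_ar T k) = Neg T (shift_ar T f \<cdot> c)"
    using eq comp_Neg(1)[OF i1 k1] comp_Neg(2)[OF c f1] shift_comp[OF ident[OF W] k(1)] ident_right[OF k(1)] by simp
  then have kc: "shift_ar T k = shift_ar T f \<cdot> c"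
    using Neg_Neg[OF k1] Neg_Neg[OF comp[OF c f1]] by metis
  obtain l where l: "l \<in> Hom T W X" "shift_ar T l = c"
    using equivalence_full[OF shift W X c] by blast
  then have "f \<cdot> l = k"
    using equivalence_faithful[OF shift comp[OF l(1) f] k(1)] shift_comp[OF l(1) f] kc by simp
  then show ?thesis using l by blast
qed

text \<open>Again by rotation. In the second part the sign is harmless because
  \<open>shift_ar T f\<close> and its negative annihilate the same arrows.\<close>

lemma Hom_exact':
  assumes d: "(f, g, h) \<in> Dist T" and f: "f \<in> Hom T X Y" and g: "g \<in> Hom T Y Z"
  shows "\<lbrakk>w \<in> Hom T W Z; h \<cdot> w = Null T W (shift_ob T X)\<rbrakk> \<Longrightarrow> \<exists>y \<in> Hom T W Y. g \<cdot> y = w"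
    and "\<lbrakk>w \<in> Hom T W (shift_ob T X); shift_ar T f \<cdot> w = Null T W (shift_ob T Y)\<rbrakk> \<Longrightarrow> \<exists>z \<in> Hom T W Z. h \<cdot> z = w"
proof -
  have h: "h \<in> Hom T Z (shift_ob T X)" using dist_Hom[OF d f] g by (simp add: Hom_def)
  show "\<exists>y \<in> Hom T W Y. g \<cdot> y = w" if "w \<in> Hom T W Z" "h \<cdot> w = Null T W (shift_ob T X)"
    by (rule Hom_exact[OF TR3[OF d] g h that])
  show "\<exists>z \<in> Hom T W Z. h \<cdot> z = w" if w: "w \<in> Hom T W (shift_ob T X)" "shift_ar T f \<cdot> w = Null T W (shift_ob T Y)"
  proof (rule Hom_exact[OF TR3[OF TR3[OF d]] h Neg_Hom[OF shift_Hom[OF f]] w(1)])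
    show "Neg T (shift_ar T f) \<cdot> w = Null T W (shift_ob T Y)"
      using comp_Neg(2)[OF w(1) shift_Hom[OF f]] w(2) Neg_Null[OF Hom_Ob(1)[OF w(1)] Hom_Ob(2)[OF shift_Hom[OF f]]] by simp
  qed
qed

text \<open>A five lemma for two triangles with the same first arrow, chased with arrows from an
  arbitrary \<open>W\<close>. It serves to compare an arbitrary distinguished triangle with the
  chosen one on \<open>f\<close>.\<close>

lemma dist_cone_iso:
  assumes d: "(f, g, h) \<in> Dist T" "(f, g', h') \<in> Dist T" and f: "f \<in> Hom T X Y"
    and g: "g \<in> Hom T Y Z" "g' \<in> Hom T Y Z'" and c: "c \<in> Hom T Z Z'" "c \<cdot> g = g'" "h' \<cdot> c = h"
  shows "is_iso T c"
proof (rule is_iso_Yoneda[OF c(1)])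
  have h: "h \<in> Hom T Z (shift_ob T X)" "h' \<in> Hom T Z' (shift_ob T X)"
    using dist_Hom[OF d(1) f] dist_Hom[OF d(2) f] g by (simp_all add: Hom_def)
  note X1 = shift_Ob[OF Hom_Ob(1)[OF f]]
  fix W w assume w: "w \<in> Hom T W Z'"
  note W = Hom_Ob(1)[OF w]
  have "shift_ar T f \<cdot> (h' \<cdot> w) = Null T W (shift_ob T Y)"
    using assoc[OF w h(2) shift_Hom[OF f]] dist_comp_zero'(2)[OF d(2) f g(2)] Null_comp[OF w shift_Ob[OF Hom_Ob(2)[OF f]]] by simp
  then obtain z where z: "z \<in> Hom T W Z" "h \<cdot> z = h' \<cdot> w"
    using Hom_exact'(2)[OF d(1) f g(1) comp[OF w h(2)]] by blast
  note cz = comp[OF z(1) c(1)]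
  have "h' \<cdot> (c \<cdot> z) = h' \<cdot> w"
    using assoc[OF z(1) c(1) h(2)] c(3) z(2) by simp
  then have "h' \<cdot> (w \<boxplus> Neg T (c \<cdot> z)) = Null T W (shift_ob T X)"
    using comp_plus_right[OF w Neg_Hom[OF cz] h(2)] comp_Neg(1)[OF cz h(2)] plus_Neg[OF comp[OF w h(2)]] by simp
  then obtain y where y: "y \<in> Hom T W Y" "g' \<cdot> y = w \<boxplus> Neg T (c \<cdot> z)"
    using Hom_exact'(1)[OF d(2) f g(2) plus_Hom[OF w Neg_Hom[OF cz]]] by blast
  \<comment> \<open>\<open>c \<cdot> z\<close> and \<open>w\<close> agree after \<open>h'\<close>,
    so they differ by \<open>g' \<cdot> y\<close>; adding \<open>g \<cdot> y\<close> to
    \<open>z\<close> removes this error.\<close>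
  have "c \<cdot> (z \<boxplus> g \<cdot> y) = c \<cdot> z \<boxplus> (w \<boxplus> Neg T (c \<cdot> z))"
    using comp_plus_right[OF z(1) comp[OF y(1) g(1)] c(1)] assoc[OF y(1) g(1) c(1)] c(2) y(2) by simp
  also have "\<dots> = w" by (rule minus_plus_cancel[OF cz w])
  finally show "\<exists>z \<in> Hom T W Z. c \<cdot> z = w"
    using plus_Hom[OF z(1) comp[OF y(1) g(1)]] by blast
next
  have h: "h \<in> Hom T Z (shift_ob T X)" "h' \<in> Hom T Z' (shift_ob T X)"
    using dist_Hom[OF d(1) f] dist_Hom[OF d(2) f] g by (simp_all add: Hom_def)
  fix W k l assume kl: "k \<in> Hom T W Z" "l \<in> Hom T W Z" "c \<cdot> k = c \<cdot> l"
  show "k = l"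
  proof (rule inj_comp_left[OF c(1) kl])
    fix t assume t: "t \<in> Hom T W Z" "c \<cdot> t = Null T W Z'"
    note W = Hom_Ob(1)[OF t(1)]
    have "h \<cdot> t = Null T W (shift_ob T X)"
      using assoc[OF t(1) c(1) h(2)] c(3) t(2) comp_Null[OF h(2) W] by simp
    then obtain y where y: "y \<in> Hom T W Y" "g \<cdot> y = t"
      using Hom_exact'(1)[OF d(1) f g(1) t(1)] by blast
    have "g' \<cdot> y = Null T W Z'"
      using assoc[OF y(1) g(1) c(1)] c(2) y(2) t(2) by simp
    then obtain x where x: "x \<in> Hom T W X" "f \<cdot> x = y"
      using Hom_exact[OF d(2) f g(2) y(1)] by blast
    then show "t = Null T W Z"
      using assoc[OF x(1) f g(1)] y(2) dist_comp_zero[OF d(1) f g(1)] Null_comp[OF x(1) Hom_Ob(2)[OF g(1)]] by simp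
  qed
qed

section \<open>The shifted zero object and triangles with a zero object at one end\<close>

text \<open>Up to isomorphism every \<open>W\<close> is a shift, and by fullness an arrow from a
  shift to the shifted zero object comes from the unique arrow into \<open>Zero T\<close>. So the
  shifted zero object is terminal.\<close>

lemma shift_Zero_unique:
  assumes w: "w \<in> Hom T W (shift_ob T (Zero T))"
  shows "w = Null T W (shift_ob T (Zero T))"
proof -
  note W = Hom_Ob(1)[OF w]
  obtain V e where V: "V \<in> Ob T" and e: "e \<in> Hom T (shift_ob T V) W" "is_iso T e"
    using equivalence_ess_surj[OF shift W] .
  have uniq: "k = shift_ar T (Null T V (Zero T))" if k: "k \<in> Hom T (shift_ob T V) (shift_ob T (Zero T))" for k
    using equivalence_full[OF shift V Zero_Ob k] zero_object_unique(1)[OF zero] by blast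
  have n: "Null T W (shift_ob T (Zero T)) \<in> Hom T W (shift_ob T (Zero T))"
    by (rule Null_Hom[OF W shift_Ob[OF Zero_Ob]])
  show ?thesis
    using iso_cancel_right[OF e(2,1) w n] uniq[OF comp[OF e(1) w]] uniq[OF comp[OF e(1) n]] by simp
qed

text \<open>The locale states no additivity of the shift, but zero arrows factor through
  \<open>Zero T\<close> and the first factor is handled by \<open>shift_Zero_unique\<close>.\<close>

lemma shift_Null:
  assumes X: "X \<in> Ob T" and Y: "Y \<in> Ob T"
  shows "shift_ar T (Null T X Y) = Null T (shift_ob T X) (shift_ob T Y)"
proof -
  note n = Null_Hom[OF X Zero_Ob] Null_Hom[OF Zero_Ob Y]
  have "shift_ar T (Null T X Y) = shift_ar T (Null T (Zero T) Y) \<cdot> shift_ar T (Null T X (Zero T))"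
    using shift_comp[OF n] comp_Null[OF n(2) X] by simp
  also have "\<dots> = Null T (shift_ob T X) (shift_ob T Y)"
    using shift_Zero_unique[OF shift_Hom[OF n(1)]] comp_Null[OF shift_Hom[OF n(2)] shift_Ob[OF X]] by simp
  finally show ?thesis .
qed

text \<open>In the sequence of Hom(W, -) the term after \<open>Z\<close> is the shifted zero object
  and the term before \<open>Y\<close> is the zero object, so only zero arrows surround the map in
  question. This identifies \<open>X\<close> with the cone of the arrow from zero to
  \<open>X\<close>.\<close>

lemma dist_from_Zero_iso:
  assumes d: "(f, g, h) \<in> Dist T" and f: "f \<in> Hom T (Zero T) Y" and g: "g \<in> Hom T Y Z"
  shows "is_iso T g"
proof (rule is_iso_Yoneda[OF g])
  have h: "h \<in> Hom T Z (shift_ob T (Zero T))" using dist_Hom[OF d f] g by (simp add: Hom_def)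
  show "\<exists>y \<in> Hom T W Y. g \<cdot> y = w" if w: "w \<in> Hom T W Z" for W w
    by (rule Hom_exact'(1)[OF d f g w shift_Zero_unique[OF comp[OF w h]]])
  fix W k l assume kl: "k \<in> Hom T W Y" "l \<in> Hom T W Y" "g \<cdot> k = g \<cdot> l"
  show "k = l"
  proof (rule inj_comp_left[OF g kl])
    fix t assume t: "t \<in> Hom T W Y" "g \<cdot> t = Null T W Z"
    obtain x where x: "x \<in> Hom T W (Zero T)" "f \<cdot> x = t"
      using Hom_exact[OF d f g t] by blast
    then show "t = Null T W Y"
      using zero_object_unique(1)[OF zero x(1)] comp_Null[OF f Hom_Ob(1)[OF t(1)]] by simp
  qed
qed

lemma dist_to_Zero_iso:
  assumes d: "(f, g, h) \<in> Dist T" and f: "f \<in> Hom T X (Zero T)" and h: "h \<in> Hom T Z (shift_ob T X)"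
  shows "is_iso T h"
proof (rule is_iso_Yoneda[OF h])
  have g: "g \<in> Hom T (Zero T) Z" using dist_Hom[OF d f] h by (simp add: Hom_def)
  show "\<exists>z \<in> Hom T W Z. h \<cdot> z = w" if w: "w \<in> Hom T W (shift_ob T X)" for W w
    by (rule Hom_exact'(2)[OF d f g w shift_Zero_unique[OF comp[OF w shift_Hom[OF f]]]])
  fix W k l assume kl: "k \<in> Hom T W Z" "l \<in> Hom T W Z" "h \<cdot> k = h \<cdot> l"
  show "k = l"
  proof (rule inj_comp_left[OF h kl])
    fix t assume t: "t \<in> Hom T W Z" "h \<cdot> t = Null T W (shift_ob T X)"
    obtain x where x: "x \<in> Hom T W (Zero T)" "g \<cdot> x = t"
      using Hom_exact'(1)[OF d f g t] by blast
    then show "t = Null T W Z"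
      using zero_object_unique(1)[OF zero x(1)] comp_Null[OF g Hom_Ob(1)[OF t(1)]] by simp
  qed
qed

end

section \<open>The category of chosen triangles\<close>

context chosen_triangulated_category
begin

lemma Arrow_triangles0_iff:
  "Arrow f g (a, b, c) \<in> Hom (triangles0 T) f g \<longleftrightarrow> f \<in> Ar T \<and> g \<in> Ar T \<and>
     a \<in> Hom T (Dom T f) (Dom T g) \<and> b \<in> Hom T (Cod T f) (Cod T g) \<and> c \<in> Hom T (Cone T f) (Cone T g) \<and>
     b \<cdot> f = g \<cdot> a \<and> c \<cdot> CU T f = CU T g \<cdot> b \<and> shift_ar T a \<cdot> CV T f = CV T g \<cdot> c"
  unfolding Hom_triangles0 by (auto simp: triangle_map_def tri)

lemma Hom_triangles0_cases:
  assumes "t \<in> Hom (triangles0 T) f g"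
  obtains a b c where "t = Arrow f g (a, b, c)" "Arrow f g (a, b, c) \<in> Hom (triangles0 T) f g"
  using assms unfolding Hom_triangles0 by blast

lemma comp_triangles0_Arrow:
  "Arrow g h (a', b', c') \<cdot>\<^bsub>triangles0 T\<^esub> Arrow f g (a, b, c) = Arrow f h (a' \<cdot> a, b' \<cdot> b, c' \<cdot> c)"
  by (simp add: triangles0_def)

section \<open>Lifting commutative squares, and the canonical morphisms\<close>

lemma lift_exists:
  assumes "f \<in> Ar T" "g \<in> Ar T" "a \<in> Hom T (Dom T f) (Dom T g)" "b \<in> Hom T (Cod T f) (Cod T g)" "b \<cdot> f = g \<cdot> a"
  obtains c where "Arrow f g (a, b, c) \<in> Hom (triangles0 T) f g"
  using TR5[OF chosen[OF assms(1)] chosen[OF assms(2)] assms(3-5)] assms(1,2) unfolding Hom_triangles0 by blast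

text \<open>The projection remembers source, target and the first two components, so the definite
  description in \<open>unique_lift\<close> reduces to uniqueness of the third.\<close>

lemma unique_lift_eq:
  assumes "Arrow f g (a, b, c) \<in> Hom (triangles0 T) f g"
    and "\<And>c'. Arrow f g (a, b, c') \<in> Hom (triangles0 T) f g \<Longrightarrow> c' = c"
  shows "unique_lift T (Arrow f g (a, b)) = Arrow f g (a, b, c)"
  unfolding unique_lift_def
proof (rule the_equality)
  show "Arrow f g (a, b, c) \<in> Ar (triangles0 T) \<and> amap (proj_functor T) (Arrow f g (a, b, c)) = Arrow f g (a, b)"
    using assms(1) by (simp add: proj_functor_def Ar_triangles0)
  fix t assume t: "t \<in> Ar (triangles0 T) \<and> amap (proj_functor T) t = Arrow f g (a, b)"
  then obtain f' g' a' b' c' where "t = Arrow f' g' (a', b', c')"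
    by (metis arrow.exhaust prod_cases3)
  with t assms(2) show "t = Arrow f g (a, b, c)"
    by (auto simp: proj_functor_def Ar_triangles0)
qed

lemma from_zero_Hom: "X \<in> Ob T \<Longrightarrow> from_zero T X \<in> Hom T (Zero T) X"
  unfolding from_zero_def by (rule Null_Hom[OF Zero_Ob])

lemma to_zero_Hom: "X \<in> Ob T \<Longrightarrow> to_zero T X \<in> Hom T X (Zero T)"
  unfolding to_zero_def by (rule Null_Hom[OF _ Zero_Ob])

lemma from_zero_Ar [simp]:
  assumes "X \<in> Ob T"
  shows "from_zero T X \<in> Ar T" "Dom T (from_zero T X) = Zero T" "Cod T (from_zero T X) = X"
  using from_zero_Hom[OF assms] by (simp_all add: Hom_def)

lemma to_zero_Ar [simp]:
  assumes "X \<in> Ob T"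
  shows "to_zero T X \<in> Ar T" "Dom T (to_zero T X) = X" "Cod T (to_zero T X) = Zero T"
  using to_zero_Hom[OF assms] by (simp_all add: Hom_def)

lemma chosen_Hom:
  assumes "f \<in> Hom T X Y"
  shows "f \<in> Ar T" "CU T f \<in> Hom T Y (Cone T f)" "CV T f \<in> Hom T (Cone T f) (shift_ob T X)"
    "Cone T f \<in> Ob T"
  using assms tri[of f] by (auto simp: Hom_def)

lemma CU_from_zero_Hom: "X \<in> Ob T \<Longrightarrow> CU T (from_zero T X) \<in> Hom T X (Cone T (from_zero T X))"
  by (rule chosen_Hom(2)[OF from_zero_Hom])

lemma CU_from_zero_iso: "X \<in> Ob T \<Longrightarrow> is_iso T (CU T (from_zero T X))"
  using dist_from_Zero_iso[OF chosen from_zero_Hom CU_from_zero_Hom] by simp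

lemma CV_to_zero_Hom: "X \<in> Ob T \<Longrightarrow> CV T (to_zero T X) \<in> Hom T (Cone T (to_zero T X)) (shift_ob T X)"
  by (rule chosen_Hom(3)[OF to_zero_Hom])

lemma CV_to_zero_iso: "X \<in> Ob T \<Longrightarrow> is_iso T (CV T (to_zero T X))"
  using dist_to_Zero_iso[OF chosen to_zero_Hom CV_to_zero_Hom] by simp

lemma CV_from_zero:
  assumes "X \<in> Ob T"
  shows "CV T (from_zero T X) = Null T (Cone T (from_zero T X)) (shift_ob T (Zero T))"
  by (rule shift_Zero_unique[OF chosen_Hom(3)[OF from_zero_Hom[OF assms]]])

lemma CU_to_zero:
  assumes "X \<in> Ob T"
  shows "CU T (to_zero T X) = Null T (Zero T) (Cone T (to_zero T X))"
  by (rule zero_object_unique(2)[OF zero chosen_Hom(2)[OF to_zero_Hom[OF assms]]])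

text \<open>The square \<open>c \<cdot> CU T (from_zero T X) = CU T g \<cdot> b\<close> fixes
  \<open>c\<close>, because the arrow on its left is invertible. This makes \<open>bang_map\<close>
  and \<open>i_map\<close> well defined.\<close>

lemma from_zero_lift_unique:
  assumes X: "X \<in> Ob T" and t: "Arrow (from_zero T X) g (a, b, c) \<in> Hom (triangles0 T) (from_zero T X) g"
    and t': "Arrow (from_zero T X) g (a', b, c') \<in> Hom (triangles0 T) (from_zero T X) g"
  shows "c' = c"
proof (rule iso_cancel_right[OF CU_from_zero_iso[OF X] CU_from_zero_Hom[OF X]])
  show "c' \<cdot> CU T (from_zero T X) = c \<cdot> CU T (from_zero T X)"
    "c' \<in> Hom T (Cone T (from_zero T X)) (Cone T g)" "c \<in> Hom T (Cone T (from_zero T X)) (Cone T g)"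
    using t t' by (simp_all add: Arrow_triangles0_iff)
qed

text \<open>Here the last square fixes \<open>c\<close>, through the invertible
  \<open>CV T (to_zero T X)\<close>. This makes \<open>k_map\<close> well defined.\<close>

lemma to_zero_lift_unique:
  assumes X: "X \<in> Ob T" and t: "Arrow f (to_zero T X) (a, b, c) \<in> Hom (triangles0 T) f (to_zero T X)"
    and t': "Arrow f (to_zero T X) (a, b', c') \<in> Hom (triangles0 T) f (to_zero T X)"
  shows "c' = c"
proof (rule iso_cancel_left[OF CV_to_zero_iso[OF X] CV_to_zero_Hom[OF X]])
  show "CV T (to_zero T X) \<cdot> c' = CV T (to_zero T X) \<cdot> c"
    "c' \<in> Hom T (Cone T f) (Cone T (to_zero T X))" "c \<in> Hom T (Cone T f) (Cone T (to_zero T X))"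
    using t t' by (simp_all add: Arrow_triangles0_iff)
qed

text \<open>Resolves the definite description once and for all. The last equation determines the
  third component and later supplies the naturality of both comparison maps.\<close>

lemma bang_map_eq:
  assumes f: "f \<in> Hom T X Y"
  obtains c where "c \<in> Hom T (Cone T (from_zero T X)) (Cone T (from_zero T Y))"
    "bang_map T f = Arrow (from_zero T X) (from_zero T Y) (Null T (Zero T) (Zero T), f, c)"
    "bang_map T f \<in> Hom (triangles0 T) (from_zero T X) (from_zero T Y)"
    "c \<cdot> CU T (from_zero T X) = CU T (from_zero T Y) \<cdot> f"
proof -
  note X = Hom_Ob(1)[OF f] and Y = Hom_Ob(2)[OF f]
  have "f \<cdot> from_zero T X = from_zero T Y \<cdot> Null T (Zero T) (Zero T)"
    using comp_Null[OF f Zero_Ob] comp_Null[OF from_zero_Hom[OF Y] Zero_Ob] by (simp add: from_zero_def)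
  then obtain c where c: "Arrow (from_zero T X) (from_zero T Y) (Null T (Zero T) (Zero T), f, c)
      \<in> Hom (triangles0 T) (from_zero T X) (from_zero T Y)"
    using lift_exists[of "from_zero T X" "from_zero T Y" "Null T (Zero T) (Zero T)" f]
      X Y f Null_Hom[OF Zero_Ob Zero_Ob] by auto
  have "bang_map T f = Arrow (from_zero T X) (from_zero T Y) (Null T (Zero T) (Zero T), f, c)"
    using unique_lift_eq[OF c from_zero_lift_unique[OF X c]] f by (simp add: bang_map_def Hom_def)
  then show ?thesis using that[of c] c c[unfolded Arrow_triangles0_iff] by simp
qed

lemma i_map_eq:
  assumes f: "f \<in> Hom T X Y"
  obtains c where "c \<in> Hom T (Cone T (from_zero T Y)) (Cone T f)"
    "i_map T f = Arrow (from_zero T Y) f (Null T (Zero T) X, Ident T Y, c)"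
    "i_map T f \<in> Hom (triangles0 T) (from_zero T Y) f"
    "c \<cdot> CU T (from_zero T Y) = CU T f"
proof -
  note X = Hom_Ob(1)[OF f] and Y = Hom_Ob(2)[OF f]
  have eq: "Ident T Y \<cdot> from_zero T Y = f \<cdot> Null T (Zero T) X"
    using comp_Null[OF f Zero_Ob] ident_left[OF from_zero_Hom[OF Y]] by (simp add: from_zero_def)
  have "Null T (Zero T) X \<in> Hom T (Dom T (from_zero T Y)) (Dom T f)" "Ident T Y \<in> Hom T (Cod T (from_zero T Y)) (Cod T f)"
    using Y Null_Hom[OF Zero_Ob X] ident[OF Y] by (simp_all add: HomD[OF f])
  then obtain c where c: "Arrow (from_zero T Y) f (Null T (Zero T) X, Ident T Y, c)
      \<in> Hom (triangles0 T) (from_zero T Y) f"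
    by (rule lift_exists[OF from_zero_Ar(1)[OF Y] chosen_Hom(1)[OF f] _ _ eq])
  have "i_map T f = Arrow (from_zero T Y) f (Null T (Zero T) X, Ident T Y, c)"
    using unique_lift_eq[OF c from_zero_lift_unique[OF Y c]] f by (simp add: i_map_def Hom_def)
  then show ?thesis
    using that[of c] c c[unfolded Arrow_triangles0_iff] ident_right[OF chosen_Hom(2)[OF f]] by simp
qed

lemma k_map_eq:
  assumes f: "f \<in> Hom T X Y"
  obtains c where "c \<in> Hom T (Cone T f) (Cone T (to_zero T X))"
    "k_map T f = Arrow f (to_zero T X) (Ident T X, Null T Y (Zero T), c)"
    "k_map T f \<in> Hom (triangles0 T) f (to_zero T X)"
    "CV T (to_zero T X) \<cdot> c = CV T f"
proof -
  note X = Hom_Ob(1)[OF f] and Y = Hom_Ob(2)[OF f]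
  have "Null T Y (Zero T) \<cdot> f = to_zero T X \<cdot> Ident T X"
    using Null_comp[OF f Zero_Ob] ident_right[OF to_zero_Hom[OF X]] by (simp add: to_zero_def)
  then obtain c where c: "Arrow f (to_zero T X) (Ident T X, Null T Y (Zero T), c)
      \<in> Hom (triangles0 T) f (to_zero T X)"
    using lift_exists[of f "to_zero T X" "Ident T X" "Null T Y (Zero T)"]
      X Y f Null_Hom[OF Y Zero_Ob] ident[OF X] by (auto simp: HomD[OF f])
  have "k_map T f = Arrow f (to_zero T X) (Ident T X, Null T Y (Zero T), c)"
    using unique_lift_eq[OF c to_zero_lift_unique[OF X c]] f by (simp add: k_map_def Hom_def)
  moreover have "shift_ar T (Ident T X) \<cdot> CV T f = CV T f"
    using is_functorD(3)[OF shift_functor X] ident_left[OF chosen_Hom(3)[OF f]] by simp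
  ultimately show ?thesis
    using that[of c] c c[unfolded Arrow_triangles0_iff] by simp
qed

lemma j_ob_eq:
  assumes X: "X \<in> Ob T"
  shows "j_ob T X = Arrow (to_zero T X) (from_zero T (shift_ob T X))
    (Null T X (Zero T), Null T (Zero T) (shift_ob T X), CU T (from_zero T (shift_ob T X)) \<cdot> CV T (to_zero T X))"
    "j_ob T X \<in> Hom (triangles0 T) (to_zero T X) (from_zero T (shift_ob T X))"
proof -
  note X1 = shift_Ob[OF X]
  note u = CU_from_zero_Hom[OF X1] and v = CV_to_zero_Hom[OF X]
  note vu = comp[OF v u]
  let ?c = "CU T (from_zero T (shift_ob T X)) \<cdot> CV T (to_zero T X)"
  \<comment> \<open>The two equations put \<open>?c\<close> into \<open>Theta\<close>: one composite
    starts at the zero object, the other ends in its shift. Outside \<open>Theta\<close> the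
    restricted function \<open>theta_arrow\<close> is unspecified, so membership comes before
    unfolding \<open>j_ob\<close>.\<close>
  have e1: "?c \<cdot> CU T (to_zero T X) = Null T (Zero T) (Cone T (from_zero T (shift_ob T X)))"
    using comp_Null[OF vu Zero_Ob] CU_to_zero[OF X] by simp
  have e2: "CV T (from_zero T (shift_ob T X)) \<cdot> ?c = Null T (Cone T (to_zero T X)) (shift_ob T (Zero T))"
    using Null_comp[OF vu shift_Ob[OF Zero_Ob]] CV_from_zero[OF X1] by simp
  have th: "?c \<in> Theta T (to_zero T X) (from_zero T (shift_ob T X))"
    using vu e1 e2 X X1 by (simp add: Theta_def)
  show j: "j_ob T X = Arrow (to_zero T X) (from_zero T (shift_ob T X))
    (Null T X (Zero T), Null T (Zero T) (shift_ob T X), ?c)"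
    using th X X1 ident_right[OF u] by (simp add: j_ob_def Let_def theta_arrow_def)
  have "shift_ar T (Null T X (Zero T)) \<cdot> CV T (to_zero T X) = Null T (Cone T (to_zero T X)) (shift_ob T (Zero T))"
    using shift_Null[OF X Zero_Ob] Null_comp[OF v shift_Ob[OF Zero_Ob]] by simp
  then show "j_ob T X \<in> Hom (triangles0 T) (to_zero T X) (from_zero T (shift_ob T X))"
    unfolding j Arrow_triangles0_iff
    using X X1 vu e1 e2 Null_Hom[OF X Zero_Ob] Null_Hom[OF Zero_Ob X1] comp_Null[OF u Zero_Ob]
      Null_comp[OF to_zero_Hom[OF X] X1] comp_Null[OF from_zero_Hom[OF X1] X] by simp
qed

text \<open>The detour through \<open>to_zero T X\<close> disappears from the third component,
  because \<open>CV T (to_zero T X)\<close> composed with that of \<open>k_map T f\<close> is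
  \<open>CV T f\<close>.\<close>

lemma j_map_eq:
  assumes f: "f \<in> Hom T X Y"
  shows "j_map T f = Arrow f (from_zero T (shift_ob T X))
    (Null T X (Zero T), Null T Y (shift_ob T X), CU T (from_zero T (shift_ob T X)) \<cdot> CV T f)"
    "j_map T f \<in> Hom (triangles0 T) f (from_zero T (shift_ob T X))"
proof -
  note X = Hom_Ob(1)[OF f] and Y = Hom_Ob(2)[OF f]
  note X1 = shift_Ob[OF X]
  obtain c where c: "c \<in> Hom T (Cone T f) (Cone T (to_zero T X))"
    "k_map T f = Arrow f (to_zero T X) (Ident T X, Null T Y (Zero T), c)"
    "k_map T f \<in> Hom (triangles0 T) f (to_zero T X)"
    "CV T (to_zero T X) \<cdot> c = CV T f"
    using k_map_eq[OF f] .
  have j: "j_map T f = j_ob T X \<cdot>\<^bsub>triangles0 T\<^esub> k_map T f"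
    by (simp add: j_map_def HomD[OF f])
  show "j_map T f \<in> Hom (triangles0 T) f (from_zero T (shift_ob T X))"
    unfolding j by (rule Comp_triangles0[OF c(3) j_ob_eq(2)[OF X]])
  show "j_map T f = Arrow f (from_zero T (shift_ob T X))
    (Null T X (Zero T), Null T Y (shift_ob T X), CU T (from_zero T (shift_ob T X)) \<cdot> CV T f)"
    unfolding j c(2) j_ob_eq(1)[OF X] comp_triangles0_Arrow
    using ident_right[OF Null_Hom[OF X Zero_Ob]] comp_Null[OF Null_Hom[OF Zero_Ob X1] Y]
      assoc[OF c(1) CV_to_zero_Hom[OF X] CU_from_zero_Hom[OF X1]] c(4) by simp
qed

text \<open>By the next two lemmas, taking third components is a bijection from morphisms \<open>to_zero T X \<rightarrow> f\<close>
  onto arrows from the cone of \<open>to_zero T X\<close>, an object isomorphic to \<open>X[1]\<close>; hence a morphism is excising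
  exactly if its third component is an isomorphism.\<close>

lemma to_zero_source_exists:
  assumes X: "X \<in> Ob T" and f: "f \<in> Ar T" and c: "c \<in> Hom T (Cone T (to_zero T X)) (Cone T f)"
  obtains a b where "Arrow (to_zero T X) f (a, b, c) \<in> Hom (triangles0 T) (to_zero T X) f"
proof -
  note t = tri[OF f] and v = CV_to_zero_Hom[OF X]
  obtain w where w: "w \<in> Hom T (shift_ob T X) (Cone T (to_zero T X))"
    "w \<cdot> CV T (to_zero T X) = Ident T (Cone T (to_zero T X))"
    using is_iso_inverse[OF CV_to_zero_iso[OF X] v] .
  note cw = comp[OF w(1) c]
  \<comment> \<open>Moved to the shift of \<open>X\<close> by \<open>w\<close> and continued by
    \<open>CV T f\<close>, the arrow \<open>c\<close> becomes an arrow between shifts, which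
    fullness desuspends to \<open>a\<close>. Faithfulness then gives \<open>f \<cdot> a = 0\<close>,
    since \<open>shift_ar T f \<cdot> CV T f\<close> vanishes.\<close>
  obtain a where a: "a \<in> Hom T X (Dom T f)" "shift_ar T a = CV T f \<cdot> (c \<cdot> w)"
    using equivalence_full[OF shift X t(6) comp[OF cw t(3)]] by blast
  have "shift_ar T (f \<cdot> a) = shift_ar T f \<cdot> (CV T f \<cdot> (c \<cdot> w))"
    using shift_comp[OF a(1) t(1)] a(2) by simp
  also have "\<dots> = shift_ar T (Null T X (Cod T f))"
    using assoc[OF cw t(3) shift_Hom[OF t(1)]] dist_comp_zero'(2)[OF chosen[OF f] t(1,2)]
      Null_comp[OF cw shift_Ob[OF t(7)]] shift_Null[OF X t(7)] by simp
  finally have fa: "f \<cdot> a = Null T X (Cod T f)"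
    by (rule equivalence_faithful[OF shift comp[OF a(1) t(1)] Null_Hom[OF X t(7)]])
  have cwv: "(c \<cdot> w) \<cdot> CV T (to_zero T X) = c"
    using assoc[OF v w(1) c] w(2) ident_right[OF c] by simp
  have av: "shift_ar T a \<cdot> CV T (to_zero T X) = CV T f \<cdot> c"
    using assoc[OF v cw t(3)] a(2) cwv by simp
  note n = Null_Hom[OF Zero_Ob t(7)]
  have "Arrow (to_zero T X) f (a, Null T (Zero T) (Cod T f), c) \<in> Hom (triangles0 T) (to_zero T X) f"
    unfolding Arrow_triangles0_iff
    using X f a(1) c av n fa Null_comp[OF to_zero_Hom[OF X] t(7)] CU_to_zero[OF X] comp_Null[OF c Zero_Ob]
      comp_Null[OF t(2) Zero_Ob] by simp
  then show ?thesis by (rule that)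
qed

lemma to_zero_source_unique:
  assumes X: "X \<in> Ob T"
    and t: "Arrow (to_zero T X) f (a, b, c) \<in> Hom (triangles0 T) (to_zero T X) f"
    and t': "Arrow (to_zero T X) f (a', b', c) \<in> Hom (triangles0 T) (to_zero T X) f"
  shows "a' = a \<and> b' = b"
proof
  have h: "a \<in> Hom T X (Dom T f)" "a' \<in> Hom T X (Dom T f)" "b \<in> Hom T (Zero T) (Cod T f)" "b' \<in> Hom T (Zero T) (Cod T f)"
    "shift_ar T a' \<cdot> CV T (to_zero T X) = shift_ar T a \<cdot> CV T (to_zero T X)"
    using t t' X unfolding Arrow_triangles0_iff by simp_all
  show "b' = b" using zero_object_unique(2)[OF zero h(3)] zero_object_unique(2)[OF zero h(4)] by simp
  have "shift_ar T a' = shift_ar T a"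
    by (rule iso_cancel_right[OF CV_to_zero_iso[OF X] CV_to_zero_Hom[OF X] shift_Hom[OF h(2)] shift_Hom[OF h(1)] h(5)])
  then show "a' = a" by (rule equivalence_faithful[OF shift h(2,1)])
qed

lemma excising_if_iso:
  assumes x: "Arrow f g (a, b, c) \<in> Hom (triangles0 T) f g" and c: "is_iso T c"
  shows "excising T (Arrow f g (a, b, c))"
  unfolding excising_def
proof (intro conjI ballI)
  show "Arrow f g (a, b, c) \<in> Ar (triangles0 T)" using x by (simp add: Ar_triangles0)
  fix X assume X: "X \<in> Ob T"
  let ?x = "Arrow f g (a, b, c)" and ?X = "to_zero T X"
  have h: "f \<in> Ar T" "g \<in> Ar T" "a \<in> Hom T (Dom T f) (Dom T g)" "b \<in> Hom T (Cod T f) (Cod T g)"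
    "c \<in> Hom T (Cone T f) (Cone T g)"
    using x unfolding Arrow_triangles0_iff by simp_all
  have hom: "(\<lambda>y. ?x \<cdot>\<^bsub>triangles0 T\<^esub> y) \<in> hom (hom_group (triangles0 T) ?X f) (hom_group (triangles0 T) ?X g)"
  proof (rule homI)
    fix y assume "y \<in> carrier (hom_group (triangles0 T) ?X f)"
    then have y: "y \<in> Hom (triangles0 T) ?X f" by (simp add: hom_group_def)
    show "?x \<cdot>\<^bsub>triangles0 T\<^esub> y \<in> carrier (hom_group (triangles0 T) ?X g)"
      using Comp_triangles0[OF y x] by (simp add: hom_group_def)
    fix y' assume "y' \<in> carrier (hom_group (triangles0 T) ?X f)"
    then have y': "y' \<in> Hom (triangles0 T) ?X f" by (simp add: hom_group_def)
    obtain a1 b1 c1 where y: "y = Arrow ?X f (a1, b1, c1)" "y \<in> Hom (triangles0 T) ?X f"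
      using Hom_triangles0_cases[OF y] by metis
    obtain a2 b2 c2 where y': "y' = Arrow ?X f (a2, b2, c2)" "y' \<in> Hom (triangles0 T) ?X f"
      using Hom_triangles0_cases[OF y'] by metis
    have k: "a1 \<in> Hom T (Dom T ?X) (Dom T f)" "b1 \<in> Hom T (Cod T ?X) (Cod T f)" "c1 \<in> Hom T (Cone T ?X) (Cone T f)"
       "a2 \<in> Hom T (Dom T ?X) (Dom T f)" "b2 \<in> Hom T (Cod T ?X) (Cod T f)" "c2 \<in> Hom T (Cone T ?X) (Cone T f)"
      using y y' by (simp_all add: Arrow_triangles0_iff)
    show "?x \<cdot>\<^bsub>triangles0 T\<^esub> (y \<otimes>\<^bsub>hom_group (triangles0 T) ?X f\<^esub> y') =
        (?x \<cdot>\<^bsub>triangles0 T\<^esub> y) \<otimes>\<^bsub>hom_group (triangles0 T) ?X g\<^esub> (?x \<cdot>\<^bsub>triangles0 T\<^esub> y')"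
      unfolding y(1) y'(1)
      using comp_plus_right[OF k(1,4) h(3)] comp_plus_right[OF k(2,5) h(4)] comp_plus_right[OF k(3,6) h(5)]
      by (simp add: hom_group_def triangles0_def)
  qed
  have bij: "bij_betw (\<lambda>y. ?x \<cdot>\<^bsub>triangles0 T\<^esub> y) (Hom (triangles0 T) ?X f) (Hom (triangles0 T) ?X g)"
    unfolding bij_betw_def
  proof
    show "inj_on (\<lambda>y. ?x \<cdot>\<^bsub>triangles0 T\<^esub> y) (Hom (triangles0 T) ?X f)"
    proof (rule inj_onI)
      fix y y' assume y: "y \<in> Hom (triangles0 T) ?X f" and y': "y' \<in> Hom (triangles0 T) ?X f"
        and eq: "?x \<cdot>\<^bsub>triangles0 T\<^esub> y = ?x \<cdot>\<^bsub>triangles0 T\<^esub> y'"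
      obtain a1 b1 c1 where y: "y = Arrow ?X f (a1, b1, c1)" "Arrow ?X f (a1, b1, c1) \<in> Hom (triangles0 T) ?X f"
        using Hom_triangles0_cases[OF y] .
      obtain a2 b2 c2 where y': "y' = Arrow ?X f (a2, b2, c2)" "Arrow ?X f (a2, b2, c2) \<in> Hom (triangles0 T) ?X f"
        using Hom_triangles0_cases[OF y'] .
      have "c1 = c2"
      proof (rule iso_cancel_left[OF c h(5)])
        show "c1 \<in> Hom T (Cone T ?X) (Cone T f)" "c2 \<in> Hom T (Cone T ?X) (Cone T f)"
          using y(2) y'(2) by (simp_all add: Arrow_triangles0_iff)
        show "c \<cdot> c1 = c \<cdot> c2"
          using eq by (simp add: y(1) y'(1) comp_triangles0_Arrow)
      qed
      then show "y = y'"
        using to_zero_source_unique[OF X] y y' by simp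
    qed
    show "(\<lambda>y. ?x \<cdot>\<^bsub>triangles0 T\<^esub> y) ` Hom (triangles0 T) ?X f = Hom (triangles0 T) ?X g"
    proof (intro equalityI subsetI)
      fix y assume "y \<in> (\<lambda>y. ?x \<cdot>\<^bsub>triangles0 T\<^esub> y) ` Hom (triangles0 T) ?X f"
      then show "y \<in> Hom (triangles0 T) ?X g" using Comp_triangles0[OF _ x] by auto
    next
      fix y assume "y \<in> Hom (triangles0 T) ?X g"
      then obtain a2 b2 c2 where y: "y = Arrow ?X g (a2, b2, c2)" "Arrow ?X g (a2, b2, c2) \<in> Hom (triangles0 T) ?X g"
        by (rule Hom_triangles0_cases)
      then have c2: "c2 \<in> Hom T (Cone T ?X) (Cone T g)" by (simp add: Arrow_triangles0_iff)
      obtain d where d: "d \<in> Hom T (Cone T g) (Cone T f)" "c \<cdot> d = Ident T (Cone T g)"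
        using is_iso_inverse[OF c h(5)] .
      \<comment> \<open>Only the third component of the preimage is prescribed;
        \<open>to_zero_source_unique\<close> then makes the other two components of the composite
        agree with those of \<open>y\<close>.\<close>
      obtain a1 b1 where t: "Arrow ?X f (a1, b1, d \<cdot> c2) \<in> Hom (triangles0 T) ?X f"
        using to_zero_source_exists[OF X h(1) comp[OF c2 d(1)]] .
      have "c \<cdot> (d \<cdot> c2) = c2"
        using assoc[OF c2 d(1) h(5)] d(2) ident_left[OF c2] by simp
      then have "?x \<cdot>\<^bsub>triangles0 T\<^esub> Arrow ?X f (a1, b1, d \<cdot> c2) = y"
        using Comp_triangles0[OF t x] to_zero_source_unique[OF X y(2)] unfolding comp_triangles0_Arrow y(1) by simp
      then show "y \<in> (\<lambda>y. ?x \<cdot>\<^bsub>triangles0 T\<^esub> y) ` Hom (triangles0 T) ?X f"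
        using t by blast
    qed
  qed
  show "(\<lambda>y. ?x \<cdot>\<^bsub>triangles0 T\<^esub> y) \<in> iso (hom_group (triangles0 T) ?X (src ?x)) (hom_group (triangles0 T) ?X (tgt ?x))"
    using hom bij unfolding iso_def by (simp add: hom_group_def)
qed

lemma excising_imp_iso:
  assumes "excising T x"
  obtains f g a b c where "x = Arrow f g (a, b, c)" "x \<in> Hom (triangles0 T) f g" "is_iso T c"
proof -
  define f g where "f = src x" and "g = tgt x"
  have x: "x \<in> Hom (triangles0 T) f g"
    using assms unfolding excising_def Ar_triangles0 f_def g_def by blast
  then obtain a b c where e: "x = Arrow f g (a, b, c)" and x': "Arrow f g (a, b, c) \<in> Hom (triangles0 T) f g"
    by (rule Hom_triangles0_cases)
  have h: "f \<in> Ar T" "g \<in> Ar T" "c \<in> Hom T (Cone T f) (Cone T g)"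
    using x' unfolding Arrow_triangles0_iff by simp_all
  have bij: "bij_betw (\<lambda>y. x \<cdot>\<^bsub>triangles0 T\<^esub> y) (Hom (triangles0 T) (to_zero T X) f) (Hom (triangles0 T) (to_zero T X) g)"
    if "X \<in> Ob T" for X
    using assms that unfolding excising_def iso_def f_def g_def by (simp add: hom_group_def)
  \<comment> \<open>Excision is tested only on the objects \<open>to_zero T X\<close>. Their cones
    exhaust the objects of \<open>T\<close> up to isomorphism, as the shift is essentially
    surjective, so the test reaches Hom(W, -) for every \<open>W\<close>.\<close>
  have cover: "\<exists>X e. X \<in> Ob T \<and> e \<in> Hom T (Cone T (to_zero T X)) W \<and> is_iso T e" if W: "W \<in> Ob T" for W
  proof -
    obtain X e where X: "X \<in> Ob T" and e: "e \<in> Hom T (shift_ob T X) W" "is_iso T e"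
      using equivalence_ess_surj[OF shift W] .
    then show ?thesis
      using comp[OF CV_to_zero_Hom[OF X] e(1)] is_iso_comp[OF CV_to_zero_iso[OF X] CV_to_zero_Hom[OF X] e(2,1)] by blast
  qed
  have "is_iso T c"
  proof (rule is_iso_Yoneda[OF h(3)])
    fix W w assume w: "w \<in> Hom T W (Cone T g)"
    obtain X k where X: "X \<in> Ob T" and k: "k \<in> Hom T (Cone T (to_zero T X)) W" "is_iso T k"
      using cover[OF Hom_Ob(1)[OF w]] by blast
    obtain k' where k': "k' \<in> Hom T W (Cone T (to_zero T X))" "k \<cdot> k' = Ident T W"
      using is_iso_inverse[OF k(2,1)] .
    obtain a2 b2 where "Arrow (to_zero T X) g (a2, b2, w \<cdot> k) \<in> Hom (triangles0 T) (to_zero T X) g"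
      using to_zero_source_exists[OF X h(2) comp[OF k(1) w]] .
    then have "Arrow (to_zero T X) g (a2, b2, w \<cdot> k) \<in> (\<lambda>y. x \<cdot>\<^bsub>triangles0 T\<^esub> y) ` Hom (triangles0 T) (to_zero T X) f"
      unfolding bij_betw_imp_surj_on[OF bij[OF X]] .
    then obtain t where t: "t \<in> Hom (triangles0 T) (to_zero T X) f" "Arrow (to_zero T X) g (a2, b2, w \<cdot> k) = x \<cdot>\<^bsub>triangles0 T\<^esub> t"
      by blast
    obtain a1 b1 c1 where t': "t = Arrow (to_zero T X) f (a1, b1, c1)"
        "Arrow (to_zero T X) f (a1, b1, c1) \<in> Hom (triangles0 T) (to_zero T X) f"
      using Hom_triangles0_cases[OF t(1)] .
    then have c1: "c1 \<in> Hom T (Cone T (to_zero T X)) (Cone T f)" "c \<cdot> c1 = w \<cdot> k"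
      using t(2) unfolding e t'(1) comp_triangles0_Arrow Arrow_triangles0_iff by simp_all
    have "c \<cdot> (c1 \<cdot> k') = w"
      using assoc[OF k'(1) c1(1) h(3)] c1(2) assoc[OF k'(1) k(1) w] k'(2) ident_right[OF w] by simp
    then show "\<exists>z \<in> Hom T W (Cone T f). c \<cdot> z = w"
      using comp[OF k'(1) c1(1)] by blast
  next
    fix W w w' assume w: "w \<in> Hom T W (Cone T f)" "w' \<in> Hom T W (Cone T f)" and eq: "c \<cdot> w = c \<cdot> w'"
    obtain X k where X: "X \<in> Ob T" and k: "k \<in> Hom T (Cone T (to_zero T X)) W" "is_iso T k"
      using cover[OF Hom_Ob(1)[OF w(1)]] by blast
    obtain a1 b1 where t: "Arrow (to_zero T X) f (a1, b1, w \<cdot> k) \<in> Hom (triangles0 T) (to_zero T X) f"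
      using to_zero_source_exists[OF X h(1) comp[OF k(1) w(1)]] .
    obtain a2 b2 where t': "Arrow (to_zero T X) f (a2, b2, w' \<cdot> k) \<in> Hom (triangles0 T) (to_zero T X) f"
      using to_zero_source_exists[OF X h(1) comp[OF k(1) w(2)]] .
    have ck: "c \<cdot> (w \<cdot> k) = c \<cdot> (w' \<cdot> k)"
      using assoc[OF k(1) w(1) h(3)] assoc[OF k(1) w(2) h(3)] eq by simp
    \<comment> \<open>The two composites have the same third component, and this determines the
      rest.\<close>
    have "x \<cdot>\<^bsub>triangles0 T\<^esub> Arrow (to_zero T X) f (a1, b1, w \<cdot> k) = x \<cdot>\<^bsub>triangles0 T\<^esub> Arrow (to_zero T X) f (a2, b2, w' \<cdot> k)"
      using to_zero_source_unique[OF X] Comp_triangles0[OF t x] Comp_triangles0[OF t' x] ck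
      unfolding e comp_triangles0_Arrow by simp
    then have "w \<cdot> k = w' \<cdot> k"
      using bij[OF X] t t' unfolding bij_betw_def inj_on_def by blast
    then show "w = w'"
      by (rule iso_cancel_right[OF k(2,1) w])
  qed
  then show ?thesis using that e x by blast
qed

end

section \<open>The two comparison functors\<close>

definition cone_functor ::
  "('o, 'm, 'z) chosen_tricat_scheme \<Rightarrow> ('m, ('m, 'm \<times> 'm \<times> 'm) arrow, 'o, 'm) functr" where
  "cone_functor T =
     Functr (\<lambda>f \<in> Ob (triangles0 T). Cone T f) (\<lambda>t \<in> Ar (triangles0 T). case dat t of (a, b, c) \<Rightarrow> c)"

text \<open>The candidate inverse: \<open>X\<close> is recovered, up to the isomorphism
  \<open>CU T (from_zero T X)\<close>, as the cone of its image.\<close>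

definition bang_functor ::
  "('o, 'm, 'z) chosen_tricat_scheme \<Rightarrow> ('o, 'm, 'm, ('m, 'm \<times> 'm \<times> 'm) arrow) functr" where
  "bang_functor T = Functr (\<lambda>X \<in> Ob T. from_zero T X) (\<lambda>f \<in> Ar T. bang_map T f)"

definition cone_map :: "('o, 'm, 'z) chosen_tricat_scheme \<Rightarrow> 'm \<Rightarrow> ('m, 'm \<times> 'm \<times> 'm) arrow" where
  "cone_map T f = Arrow f (from_zero T (Cone T f))
     (Null T (Dom T f) (Zero T), CU T f, CU T (from_zero T (Cone T f)))"

text \<open>The squares commute in \<open>C\<close>, but the vertical maps are inverted only by
  \<open>E\<close>; this admits vertical maps that are merely excising.\<close>

lemma functor_kernel_image_transport:
  assumes C: "category C" and E: "is_functor C Ab E"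
    and Hom: "f \<in> Hom C x y" "g \<in> Hom C y z" "f' \<in> Hom C x' y'" "g' \<in> Hom C y' z'"
      "a \<in> Hom C x x'" "b \<in> Hom C y y'" "c \<in> Hom C z z'"
    and iso: "is_iso Ab (amap E a)" "is_iso Ab (amap E b)" "is_iso Ab (amap E c)"
    and sq: "b \<cdot>\<^bsub>C\<^esub> f = f' \<cdot>\<^bsub>C\<^esub> a" "c \<cdot>\<^bsub>C\<^esub> g = g' \<cdot>\<^bsub>C\<^esub> b"
    and ex: "kernel (omap E y) (omap E z) (dat (amap E g)) = dat (amap E f) ` carrier (omap E x)"
  shows "kernel (omap E y') (omap E z') (dat (amap E g')) = dat (amap E f') ` carrier (omap E x')"
proof -
  note F = is_functorD[OF E]
  show ?thesis
    using ex F(4)[OF Hom(1,6)] F(4)[OF Hom(5,3)] F(4)[OF Hom(2,7)] F(4)[OF Hom(6,4)] sq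
    by (intro kernel_image_transport[OF F(2)[OF Hom(1)] F(2)[OF Hom(2)] F(2)[OF Hom(3)] F(2)[OF Hom(4)]
      F(2)[OF Hom(5)] F(2)[OF Hom(6)] F(2)[OF Hom(7)] iso]) simp_all
qed

context chosen_triangulated_category
begin

lemma cone_functor_simps:
  "f \<in> Ar T \<Longrightarrow> omap (cone_functor T) f = Cone T f"
  "Arrow f g (a, b, c) \<in> Hom (triangles0 T) f g \<Longrightarrow> amap (cone_functor T) (Arrow f g (a, b, c)) = c"
  by (simp add: cone_functor_def triangles0_def) (simp add: cone_functor_def Ar_triangles0)

lemma Ob_triangles0: "Ob (triangles0 T) = Ar T"
  by (simp add: triangles0_def)

lemma is_functor_cone: "is_functor (triangles0 T) T (cone_functor T)"
proof (rule is_functorI)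
  fix f assume "f \<in> Ob (triangles0 T)"
  then have f: "f \<in> Ar T" by (simp add: Ob_triangles0)
  show "omap (cone_functor T) f \<in> Ob T" using tri[OF f] f by (simp add: cone_functor_simps)
  have i: "Ident (triangles0 T) f = Arrow f f (Ident T (Dom T f), Ident T (Cod T f), Ident T (Cone T f))"
    by (simp add: triangles0_def)
  show "amap (cone_functor T) (Ident (triangles0 T) f) = Ident T (omap (cone_functor T) f)"
    using cone_functor_simps Ident_triangles0[OF f] f unfolding i by simp
next
  fix t f g assume "t \<in> Hom (triangles0 T) f g"
  then obtain a b c where t: "t = Arrow f g (a, b, c)" "Arrow f g (a, b, c) \<in> Hom (triangles0 T) f g"
    by (rule Hom_triangles0_cases)
  then show "amap (cone_functor T) t \<in> Hom T (omap (cone_functor T) f) (omap (cone_functor T) g)"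
    unfolding t(1) cone_functor_simps(2)[OF t(2)] Arrow_triangles0_iff by (simp add: cone_functor_simps)
next
  fix s t f g h assume s: "s \<in> Hom (triangles0 T) f g" and t: "t \<in> Hom (triangles0 T) g h"
  obtain a b c where s: "s = Arrow f g (a, b, c)" "Arrow f g (a, b, c) \<in> Hom (triangles0 T) f g"
    using Hom_triangles0_cases[OF s] .
  obtain a' b' c' where t: "t = Arrow g h (a', b', c')" "Arrow g h (a', b', c') \<in> Hom (triangles0 T) g h"
    using Hom_triangles0_cases[OF t] .
  show "amap (cone_functor T) (t \<cdot>\<^bsub>triangles0 T\<^esub> s) = amap (cone_functor T) t \<cdot> amap (cone_functor T) s"
    using Comp_triangles0[OF s(2) t(2)] s(2) t(2) unfolding s(1) t(1) comp_triangles0_Arrow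
    by (simp add: cone_functor_simps)
qed (auto simp: cone_functor_def)

lemma cone_homology_eq: "cone_homology T E = comp_functor (triangles0 T) E (cone_functor T)"
  by (auto simp: cone_homology_def comp_functor_def cone_functor_def compose_def fun_eq_iff restrict_def
      split: prod.split)

lemma cone_homology_functor_eq:
  "cone_homology_functor T = precomp_functor (classical_homologies T) (triangles0 T) (cone_functor T)"
  by (simp add: cone_homology_functor_def precomp_functor_def cone_homology_eq cone_functor_simps Ob_triangles0
      cong: restrict_cong)

section \<open>Functoriality of \<open>bang_functor\<close> and the comparison of \<open>[f]\<close>
  with its cone\<close>

text \<open>The first component starts at a zero object and the third is fixed by
  \<open>from_zero_lift_unique\<close>, so the second decides. This stands in for the missing
  functoriality of fill-ins.\<close>

lemma from_zero_source_eqI: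
  assumes X: "X \<in> Ob T"
    and t: "Arrow (from_zero T X) g (a, b, c) \<in> Hom (triangles0 T) (from_zero T X) g"
    and t': "Arrow (from_zero T X) g (a', b, c') \<in> Hom (triangles0 T) (from_zero T X) g"
  shows "Arrow (from_zero T X) g (a, b, c) = Arrow (from_zero T X) g (a', b, c')"
proof -
  have "a \<in> Hom T (Zero T) (Dom T g)" "a' \<in> Hom T (Zero T) (Dom T g)"
    using t t' X unfolding Arrow_triangles0_iff by simp_all
  then have "a = a'" using zero_object_unique(2)[OF zero] by metis
  then show ?thesis using from_zero_lift_unique[OF X t t'] by simp
qed

lemma bang_map_Ident:
  assumes X: "X \<in> Ob T"
  shows "bang_map T (Ident T X) = Ident (triangles0 T) (from_zero T X)"
proof -
  obtain c where b: "bang_map T (Ident T X) = Arrow (from_zero T X) (from_zero T X) (Null T (Zero T) (Zero T), Ident T X, c)"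
    "bang_map T (Ident T X) \<in> Hom (triangles0 T) (from_zero T X) (from_zero T X)"
    using bang_map_eq[OF ident[OF X]] by metis
  have i: "Ident (triangles0 T) (from_zero T X) =
      Arrow (from_zero T X) (from_zero T X) (Ident T (Zero T), Ident T X, Ident T (Cone T (from_zero T X)))"
    using X by (simp add: triangles0_def)
  show ?thesis
    using from_zero_source_eqI[OF X b(2)[unfolded b(1)] Ident_triangles0[OF from_zero_Ar(1)[OF X], unfolded i]]
    by (simp add: b(1) i)
qed

lemma bang_map_comp:
  assumes f: "f \<in> Hom T X Y" and g: "g \<in> Hom T Y Z"
  shows "bang_map T (g \<cdot> f) = bang_map T g \<cdot>\<^bsub>triangles0 T\<^esub> bang_map T f"
proof -
  obtain c where b: "bang_map T f = Arrow (from_zero T X) (from_zero T Y) (Null T (Zero T) (Zero T), f, c)"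
    "bang_map T f \<in> Hom (triangles0 T) (from_zero T X) (from_zero T Y)"
    using bang_map_eq[OF f] by metis
  obtain c' where b': "bang_map T g = Arrow (from_zero T Y) (from_zero T Z) (Null T (Zero T) (Zero T), g, c')"
    "bang_map T g \<in> Hom (triangles0 T) (from_zero T Y) (from_zero T Z)"
    using bang_map_eq[OF g] by metis
  obtain c'' where b'': "bang_map T (g \<cdot> f) = Arrow (from_zero T X) (from_zero T Z) (Null T (Zero T) (Zero T), g \<cdot> f, c'')"
    "bang_map T (g \<cdot> f) \<in> Hom (triangles0 T) (from_zero T X) (from_zero T Z)"
    using bang_map_eq[OF comp[OF f g]] by metis
  show ?thesis
    using from_zero_source_eqI[OF Hom_Ob(1)[OF f] b''(2)[unfolded b''(1)]
      Comp_triangles0[OF b(2) b'(2), unfolded b(1) b'(1) comp_triangles0_Arrow]]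
    unfolding b(1) b'(1) b''(1) comp_triangles0_Arrow .
qed

lemma bang_map_Hom:
  "f \<in> Hom T X Y \<Longrightarrow> bang_map T f \<in> Hom (triangles0 T) (from_zero T X) (from_zero T Y)"
  using bang_map_eq by metis

lemma bang_functor_simps:
  "X \<in> Ob T \<Longrightarrow> omap (bang_functor T) X = from_zero T X"
  "f \<in> Hom T X Y \<Longrightarrow> amap (bang_functor T) f = bang_map T f"
  by (simp_all add: bang_functor_def Hom_def)

lemma is_functor_bang: "is_functor T (triangles0 T) (bang_functor T)"
proof (rule is_functorI)
  fix X assume X: "X \<in> Ob T"
  show "omap (bang_functor T) X \<in> Ob (triangles0 T)"
    using X by (simp add: bang_functor_simps Ob_triangles0)
  show "amap (bang_functor T) (Ident T X) = Ident (triangles0 T) (omap (bang_functor T) X)"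
    using bang_functor_simps(2)[OF ident[OF X]] bang_map_Ident[OF X] X by (simp add: bang_functor_simps)
next
  fix f X Y assume f: "f \<in> Hom T X Y"
  show "amap (bang_functor T) f \<in> Hom (triangles0 T) (omap (bang_functor T) X) (omap (bang_functor T) Y)"
    using bang_map_Hom[OF f] Hom_Ob[OF f] by (simp add: bang_functor_simps(1) bang_functor_simps(2)[OF f])
next
  fix f g X Y Z assume fg: "f \<in> Hom T X Y" "g \<in> Hom T Y Z"
  show "amap (bang_functor T) (g \<cdot> f) = amap (bang_functor T) g \<cdot>\<^bsub>triangles0 T\<^esub> amap (bang_functor T) f"
    using bang_functor_simps(2)[OF fg(1)] bang_functor_simps(2)[OF fg(2)] bang_functor_simps(2)[OF comp[OF fg]]
      bang_map_comp[OF fg] by simp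
qed (auto simp: bang_functor_def)

text \<open>The first square says that \<open>CU T f \<cdot> f\<close> vanishes; both sides of the
  last square end in the shifted zero object.\<close>

lemma cone_map_Hom:
  assumes f: "f \<in> Ar T"
  shows "cone_map T f \<in> Hom (triangles0 T) f (from_zero T (Cone T f))"
proof -
  note t = tri[OF f]
  note u = CU_from_zero_Hom[OF t(8)]
  note n = Null_Hom[OF t(6) Zero_Ob]
  have "CU T f \<cdot> f = from_zero T (Cone T f) \<cdot> Null T (Dom T f) (Zero T)"
    using dist_comp_zero[OF chosen[OF f] t(1,2)] comp_Null[OF from_zero_Hom[OF t(8)] t(6)] by simp
  moreover have "shift_ar T (Null T (Dom T f) (Zero T)) \<cdot> CV T f = CV T (from_zero T (Cone T f)) \<cdot> CU T (from_zero T (Cone T f))"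
    using shift_Null[OF t(6) Zero_Ob] Null_comp[OF t(3) shift_Ob[OF Zero_Ob]] CV_from_zero[OF t(8)]
      Null_comp[OF u shift_Ob[OF Zero_Ob]] by simp
  ultimately show ?thesis
    unfolding cone_map_def Arrow_triangles0_iff using f t n u by simp
qed

lemma excising_cone_map:
  assumes f: "f \<in> Ar T"
  shows "excising T (cone_map T f)"
  using excising_if_iso[OF cone_map_Hom[OF f, unfolded cone_map_def] CU_from_zero_iso] tri[OF f]
  by (simp add: cone_map_def)

text \<open>The first components are zero, the second components agree by the middle square of
  \<open>t\<close>, and the third by the equation that determines
  \<open>bang_map T c\<close>.\<close>

lemma cone_map_natural:
  assumes t: "Arrow f g (a, b, c) \<in> Hom (triangles0 T) f g"
  shows "bang_map T c \<cdot>\<^bsub>triangles0 T\<^esub> cone_map T f = cone_map T g \<cdot>\<^bsub>triangles0 T\<^esub> Arrow f g (a, b, c)"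
proof -
  have h: "f \<in> Ar T" "g \<in> Ar T" "a \<in> Hom T (Dom T f) (Dom T g)" "c \<in> Hom T (Cone T f) (Cone T g)"
    "c \<cdot> CU T f = CU T g \<cdot> b"
    using t unfolding Arrow_triangles0_iff by simp_all
  obtain d where d: "bang_map T c = Arrow (from_zero T (Cone T f)) (from_zero T (Cone T g)) (Null T (Zero T) (Zero T), c, d)"
    "d \<cdot> CU T (from_zero T (Cone T f)) = CU T (from_zero T (Cone T g)) \<cdot> c"
    using bang_map_eq[OF h(4)] by metis
  have "Null T (Zero T) (Zero T) \<cdot> Null T (Dom T f) (Zero T) = Null T (Dom T g) (Zero T) \<cdot> a"
    using comp_Null[OF Null_Hom[OF Zero_Ob Zero_Ob]] Null_comp[OF h(3) Zero_Ob] tri(6)[OF h(1)] by simp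
  then show ?thesis
    unfolding d(1) cone_map_def comp_triangles0_Arrow using d(2) h(5) by simp
qed

text \<open>Up to excision \<open>i_map T f\<close> is the image of \<open>CU T f\<close> under
  \<open>bang_functor\<close>. The source is \<open>from_zero T Y\<close>, so comparing second
  components suffices.\<close>

lemma cone_map_i_map:
  assumes f: "f \<in> Hom T X Y"
  shows "cone_map T f \<cdot>\<^bsub>triangles0 T\<^esub> i_map T f = bang_map T (CU T f)"
proof -
  note fA = chosen_Hom[OF f]
  obtain c where c: "i_map T f = Arrow (from_zero T Y) f (Null T (Zero T) X, Ident T Y, c)"
    "i_map T f \<in> Hom (triangles0 T) (from_zero T Y) f"
    using i_map_eq[OF f] by metis
  obtain d where d: "bang_map T (CU T f) = Arrow (from_zero T Y) (from_zero T (Cone T f)) (Null T (Zero T) (Zero T), CU T f, d)"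
    "bang_map T (CU T f) \<in> Hom (triangles0 T) (from_zero T Y) (from_zero T (Cone T f))"
    using bang_map_eq[OF fA(2)] by metis
  have e: "cone_map T f \<cdot>\<^bsub>triangles0 T\<^esub> i_map T f = Arrow (from_zero T Y) (from_zero T (Cone T f))
      (Null T (Dom T f) (Zero T) \<cdot> Null T (Zero T) X, CU T f, CU T (from_zero T (Cone T f)) \<cdot> c)"
    unfolding c(1) cone_map_def comp_triangles0_Arrow ident_right[OF fA(2)] ..
  show ?thesis
    using from_zero_source_eqI[OF Hom_Ob(2)[OF f] Comp_triangles0[OF c(2) cone_map_Hom[OF fA(1)], unfolded e] d(2)[unfolded d(1)]]
    by (simp add: d(1) e)
qed

text \<open>Together with \<open>cone_map_i_map\<close> this rewrites the exactness axiom at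
  \<open>f\<close> as exactness on the image of the chosen triangle. The source \<open>f\<close> is
  arbitrary, so all components are compared; the middle one vanishes as a composite of consecutive
  arrows of a triangle.\<close>

lemma bang_map_cone_map:
  assumes f: "f \<in> Hom T X Y"
  shows "bang_map T (CV T f) \<cdot>\<^bsub>triangles0 T\<^esub> cone_map T f = j_map T f"
proof -
  note fA = chosen_Hom[OF f] and XY = Hom_Ob[OF f]
  obtain d where d: "bang_map T (CV T f) = Arrow (from_zero T (Cone T f)) (from_zero T (shift_ob T X)) (Null T (Zero T) (Zero T), CV T f, d)"
    "d \<cdot> CU T (from_zero T (Cone T f)) = CU T (from_zero T (shift_ob T X)) \<cdot> CV T f"
    using bang_map_eq[OF fA(3)] by metis
  have "CV T f \<cdot> CU T f = Null T Y (shift_ob T X)"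
    by (rule dist_comp_zero'(1)[OF chosen[OF fA(1)] f fA(2)])
  then show ?thesis
    unfolding d(1) cone_map_def comp_triangles0_Arrow j_map_eq(1)[OF f]
    using d(2) comp_Null[OF Null_Hom[OF Zero_Ob Zero_Ob] XY(1)] HomD[OF f] by simp
qed

section \<open>The equivalence\<close>

text \<open>Exactness is that of \<open>E\<close> on the chosen triangle, with \<open>X\<close>,
  \<open>Y\<close> and the shift of \<open>X\<close> replaced by isomorphic cones. Excision holds
  because excising morphisms have invertible third components.\<close>

lemma pt_homology_cone_homology:
  assumes E: "classical_homology T E"
  shows "pt_homology T (cone_homology T E)"
proof -
  let ?H = "cone_homology T E"
  have FE: "is_functor T Ab E"
    using E by (simp add: classical_homology_def additive_functor_def)
  note F = is_functorD[OF FE]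
  have FH: "is_functor (triangles0 T) Ab ?H"
    unfolding cone_homology_eq by (rule is_functor_comp[OF category_triangles0 is_functor_cone FE])
  have Ho: "omap ?H f = omap E (Cone T f)" if "f \<in> Ar T" for f
    using that by (simp add: cone_homology_def Ob_triangles0)
  have Ha: "amap ?H t = amap E c" if "t = Arrow f g (a, b, c)" "t \<in> Hom (triangles0 T) f g" for t f g a b c
    using Hom_imp_Ar[OF that(2)] by (simp add: cone_homology_def that(1))
  have exact: "exact_seq ([omap ?H (from_zero T (shift_ob T (Dom T f))), omap ?H f,
        omap ?H (from_zero T (Cod T f)), omap ?H (from_zero T (Dom T f))],
      [dat (amap ?H (j_map T f)), dat (amap ?H (i_map T f)), dat (amap ?H (bang_map T f))])"
    if fA: "f \<in> Ar T" for f
  proof -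
    define X Y where "X = Dom T f" and "Y = Cod T f"
    have f: "f \<in> Hom T X Y" using fA by (simp add: Hom_def X_def Y_def)
    note XY = Hom_Ob[OF f] and t = chosen_Hom[OF f]
    note X1 = shift_Ob[OF XY(1)]
    obtain cb where b: "cb \<in> Hom T (Cone T (from_zero T X)) (Cone T (from_zero T Y))"
      "bang_map T f = Arrow (from_zero T X) (from_zero T Y) (Null T (Zero T) (Zero T), f, cb)"
      "bang_map T f \<in> Hom (triangles0 T) (from_zero T X) (from_zero T Y)"
      "cb \<cdot> CU T (from_zero T X) = CU T (from_zero T Y) \<cdot> f"
      using bang_map_eq[OF f] .
    obtain ci where i: "ci \<in> Hom T (Cone T (from_zero T Y)) (Cone T f)"
      "i_map T f = Arrow (from_zero T Y) f (Null T (Zero T) X, Ident T Y, ci)"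
      "i_map T f \<in> Hom (triangles0 T) (from_zero T Y) f"
      "ci \<cdot> CU T (from_zero T Y) = CU T f"
      using i_map_eq[OF f] .
    note j = j_map_eq[OF f]
    note u = CU_from_zero_Hom[OF XY(1)] CU_from_zero_Hom[OF XY(2)] CU_from_zero_Hom[OF X1]
    have iso: "is_iso Ab (amap E (CU T (from_zero T Z)))" if "Z \<in> Ob T" for Z
      by (rule functor_is_iso[OF category_axioms FE CU_from_zero_iso[OF that]])
    have iso_id: "is_iso Ab (amap E (Ident T (Cone T f)))"
      by (rule functor_is_iso[OF category_axioms FE is_iso_Ident[OF t(4)]])
    note vj = comp[OF t(3) u(3)]
    have "exact_seq ([omap E (shift_ob T X), omap E (Cone T f), omap E Y, omap E X],
        [dat (amap E (CV T f)), dat (amap E (CU T f)), dat (amap E f)])"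
      using E chosen[OF fA] HomD[OF f] HomD[OF t(2)] HomD[OF t(3)] unfolding classical_homology_def by auto
    then have K: "kernel (omap E Y) (omap E (Cone T f)) (dat (amap E (CU T f))) = dat (amap E f) ` carrier (omap E X)"
      "kernel (omap E (Cone T f)) (omap E (shift_ob T X)) (dat (amap E (CV T f))) = dat (amap E (CU T f)) ` carrier (omap E Y)"
      unfolding exact_seq_Ab[OF F(2)[OF f] F(2)[OF t(2)] F(2)[OF t(3)]] by auto
    \<comment> \<open>A ladder whose vertical maps are \<open>CU\<close> at \<open>X\<close>,
      \<open>CU\<close> at \<open>Y\<close> and the identity of the cone.\<close>
    have "kernel (omap E (Cone T (from_zero T Y))) (omap E (Cone T f)) (dat (amap E ci)) =
        dat (amap E cb) ` carrier (omap E (Cone T (from_zero T X)))"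
      by (rule functor_kernel_image_transport[OF category_axioms FE f t(2) b(1) i(1) u(1,2) ident[OF t(4)]
        iso[OF XY(1)] iso[OF XY(2)] iso_id _ _ K(1)])
        (use b(4) i(4) ident_left[OF t(2)] in simp_all)
    \<comment> \<open>Here the right vertical map is \<open>CU\<close> at the shift of
      \<open>X\<close>, the very factor that \<open>j_map_eq\<close> puts in front of
      \<open>CV T f\<close>.\<close>
    moreover have "kernel (omap E (Cone T f)) (omap E (Cone T (from_zero T (shift_ob T X))))
        (dat (amap E (CU T (from_zero T (shift_ob T X)) \<cdot> CV T f))) =
        dat (amap E ci) ` carrier (omap E (Cone T (from_zero T Y)))"
      by (rule functor_kernel_image_transport[OF category_axioms FE t(2,3) i(1) vj u(2) ident[OF t(4)] u(3)
        iso[OF XY(2)] iso_id iso[OF X1] _ _ K(2)])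
        (use i(4) ident_left[OF t(2)] ident_right[OF vj] in simp_all)
    ultimately show ?thesis
      unfolding X_def[symmetric] Y_def[symmetric] Ha[OF b(2,3)] Ha[OF i(2,3)] Ha[OF j]
      using exact_seq_Ab[OF F(2)[OF b(1)] F(2)[OF i(1)] F(2)[OF vj]] XY X1 fA by (simp add: Ho)
  qed
  have "is_iso Ab (amap ?H x)" if x: "excising T x" for x
  proof -
    obtain f g a b c where x: "x = Arrow f g (a, b, c)" "x \<in> Hom (triangles0 T) f g" "is_iso T c"
      using excising_imp_iso[OF x] .
    then show ?thesis
      using Ha[OF x(1,2)] functor_is_iso[OF category_axioms FE x(3)] by simp
  qed
  then show ?thesis
    unfolding pt_homology_def using FH exact by blast
qed

text \<open>The axioms for \<open>H\<close> speak of the chosen triangles only. An arbitrary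
  distinguished triangle is compared with the chosen one on the same first arrow, and additivity
  then follows from exactness.\<close>

lemma classical_homology_bang:
  assumes H: "pt_homology T H"
  shows "classical_homology T (comp_functor T H (bang_functor T))"
proof -
  let ?E = "comp_functor T H (bang_functor T)"
  have FH: "is_functor (triangles0 T) Ab H" using H by (simp add: pt_homology_def)
  note F = is_functorD[OF FH]
  have FE: "is_functor T Ab ?E"
    by (rule is_functor_comp[OF category_axioms is_functor_bang FH])
  have Ea: "amap ?E f = amap H (bang_map T f)" if "f \<in> Hom T X Y" for f X Y
    using Hom_imp_Ar[OF that] by (simp add: bang_functor_simps(2)[OF that])
  note G = category_triangles0
  have exact: "kernel (omap ?E Y) (omap ?E Z) (dat (amap ?E g)) = dat (amap ?E f) ` carrier (omap ?E X) \<and>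
      kernel (omap ?E Z) (omap ?E (shift_ob T X)) (dat (amap ?E h)) = dat (amap ?E g) ` carrier (omap ?E Y)"
    if d: "(f, g, h) \<in> Dist T" and f: "f \<in> Hom T X Y" and g: "g \<in> Hom T Y Z" and h: "h \<in> Hom T Z (shift_ob T X)"
    for f g h X Y Z
  proof -
    interpret G: category "triangles0 T" by (rule category_triangles0)
    note XYZ = Hom_Ob[OF f] Hom_Ob(2)[OF g] and t = chosen_Hom[OF f]
    note X1 = shift_Ob[OF XYZ(1)]
    have "Ident T Y \<cdot> f = f \<cdot> Ident T X" using ident_left[OF f] ident_right[OF f] by simp
    then obtain c where "triangle_map T (f, CU T f, CV T f) (f, g, h) (Ident T X, Ident T Y, c)"
      using TR5[OF chosen[OF t(1)] d] ident[OF XYZ(1)] ident[OF XYZ(2)] HomD[OF f] by metis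
    then have c: "c \<in> Hom T (Cone T f) Z" "c \<cdot> CU T f = g" "h \<cdot> c = CV T f"
      using HomD[OF f] HomD[OF g] HomD[OF h] HomD[OF t(3)] ident_right[OF g] is_functorD(3)[OF shift_functor XYZ(1)]
        ident_left[OF t(3)] by (auto simp: triangle_map_def)
    have iso_c: "is_iso T c"
      by (rule dist_cone_iso[OF chosen[OF t(1)] d f t(2) g c])
    \<comment> \<open>Relates the object \<open>f\<close>, where exactness of \<open>H\<close> is
      known, to \<open>from_zero T Z\<close>. It is inverted by \<open>H\<close>: one factor comes
      from the isomorphism \<open>c\<close>, the other is excising.\<close>
    define \<gamma> where "\<gamma> = bang_map T c \<cdot>\<^bsub>triangles0 T\<^esub> cone_map T f"
    note bc = bang_map_Hom[OF c(1)] and m = cone_map_Hom[OF t(1)]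
    have \<gamma>: "\<gamma> \<in> Hom (triangles0 T) f (from_zero T Z)"
      unfolding \<gamma>_def by (rule Comp_triangles0[OF m bc])
    have "is_iso Ab (amap H (bang_map T c))"
      using functor_is_iso[OF category_axioms FE iso_c] Ea[OF c(1)] by simp
    moreover have "is_iso Ab (amap H (cone_map T f))"
      using H excising_cone_map[OF t(1)] by (simp add: pt_homology_def)
    ultimately have iso_\<gamma>: "is_iso Ab (amap H \<gamma>)"
      using category.is_iso_comp[OF category_Ab _ F(2)[OF m] _ F(2)[OF bc]] F(4)[OF m bc] by (simp add: \<gamma>_def)
    have iso_id: "is_iso Ab (amap H (Ident (triangles0 T) k))" if "k \<in> Ar T" for k
      using functor_is_iso[OF G FH G.is_iso_Ident] that by (simp add: Ob_triangles0)
    have zA: "from_zero T X \<in> Ar T" "from_zero T Y \<in> Ar T" "from_zero T (shift_ob T X) \<in> Ar T"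
      using XYZ X1 by simp_all
    note id = Ident_triangles0[OF zA(1)] Ident_triangles0[OF zA(2)] Ident_triangles0[OF zA(3)]
    note bf = bang_map_Hom[OF f] and bg = bang_map_Hom[OF g] and bh = bang_map_Hom[OF h]
    have i: "i_map T f \<in> Hom (triangles0 T) (from_zero T Y) f" using i_map_eq[OF f] by metis
    note j = j_map_eq(2)[OF f]
    have "exact_seq ([omap H (from_zero T (shift_ob T X)), omap H f, omap H (from_zero T Y), omap H (from_zero T X)],
        [dat (amap H (j_map T f)), dat (amap H (i_map T f)), dat (amap H (bang_map T f))])"
      using H t(1) HomD[OF f] unfolding pt_homology_def by auto
    then have K: "kernel (omap H (from_zero T Y)) (omap H f) (dat (amap H (i_map T f))) =
        dat (amap H (bang_map T f)) ` carrier (omap H (from_zero T X))"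
      "kernel (omap H f) (omap H (from_zero T (shift_ob T X))) (dat (amap H (j_map T f))) =
        dat (amap H (i_map T f)) ` carrier (omap H (from_zero T Y))"
      unfolding exact_seq_Ab[OF F(2)[OF bf] F(2)[OF i] F(2)[OF j]] by auto
    have sq_i: "\<gamma> \<cdot>\<^bsub>triangles0 T\<^esub> i_map T f = bang_map T g"
      using G.assoc[OF i m bc] cone_map_i_map[OF f] bang_map_comp[OF t(2) c(1)] c(2) by (simp add: \<gamma>_def)
    have sq_j: "bang_map T h \<cdot>\<^bsub>triangles0 T\<^esub> \<gamma> = j_map T f"
      using G.assoc[OF m bc bh] bang_map_cone_map[OF f] bang_map_comp[OF c(1) h] c(3) by (simp add: \<gamma>_def)
    have "kernel (omap H (from_zero T Y)) (omap H (from_zero T Z)) (dat (amap H (bang_map T g))) =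
        dat (amap H (bang_map T f)) ` carrier (omap H (from_zero T X))"
      by (rule functor_kernel_image_transport[OF G FH bf i bf bg id(1,2) \<gamma> iso_id[OF zA(1)] iso_id[OF zA(2)] iso_\<gamma> _ _ K(1)])
        (use G.ident_left[OF bf] G.ident_right[OF bf] G.ident_right[OF bg] sq_i in simp_all)
    moreover have "kernel (omap H (from_zero T Z)) (omap H (from_zero T (shift_ob T X))) (dat (amap H (bang_map T h))) =
        dat (amap H (bang_map T g)) ` carrier (omap H (from_zero T Y))"
      by (rule functor_kernel_image_transport[OF G FH i j bg bh id(2) \<gamma> id(3) iso_id[OF zA(2)] iso_\<gamma> iso_id[OF zA(3)] _ _ K(2)])
        (use G.ident_left[OF j] G.ident_right[OF bg] sq_i sq_j in simp_all)
    ultimately show ?thesis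
      using XYZ X1 by (simp add: bang_functor_simps(1) Ea[OF f] Ea[OF g] Ea[OF h])
  qed
  \<comment> \<open>In the identity triangle on \<open>Zero T\<close> the first two arrows are both
    the identity, so exactness makes the whole group the kernel of an identity map.\<close>
  have trivial: "carrier (omap ?E (Zero T)) = {\<one>\<^bsub>omap ?E (Zero T)\<^esub>}"
  proof -
    note n = Null_Hom[OF Zero_Ob Zero_Ob]
    have id: "Null T (Zero T) (Zero T) = Ident T (Zero T)"
      using zero_object_unique(1)[OF zero ident[OF Zero_Ob]] by simp
    have apply_id: "dat (amap ?E (Ident T (Zero T))) x = x" if "x \<in> carrier (omap ?E (Zero T))" for x
      using is_functorD(3)[OF FE Zero_Ob] Ab_Ident_apply[OF that] by simp
    have "kernel (omap ?E (Zero T)) (omap ?E (Zero T)) (dat (amap ?E (Ident T (Zero T)))) =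
        dat (amap ?E (Ident T (Zero T))) ` carrier (omap ?E (Zero T))"
      using exact[OF TR2[OF Zero_Ob] ident[OF Zero_Ob] n Null_Hom[OF Zero_Ob shift_Ob[OF Zero_Ob]]] id by simp
    also have "\<dots> = carrier (omap ?E (Zero T))"
      using apply_id by force
    finally have "x \<in> kernel (omap ?E (Zero T)) (omap ?E (Zero T)) (dat (amap ?E (Ident T (Zero T))))"
      if "x \<in> carrier (omap ?E (Zero T))" for x
      using that by blast
    then have "x = \<one>\<^bsub>omap ?E (Zero T)\<^esub>" if "x \<in> carrier (omap ?E (Zero T))" for x
      using apply_id[OF that] that unfolding kernel_def by force
    then have "carrier (omap ?E (Zero T)) \<subseteq> {\<one>\<^bsub>omap ?E (Zero T)\<^esub>}"
      by blast
    moreover have "\<one>\<^bsub>omap ?E (Zero T)\<^esub> \<in> carrier (omap ?E (Zero T))"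
      using is_functorD(1)[OF FE Zero_Ob]
      by (simp add: Ob_Ab comm_group_def group.is_monoid monoid.one_closed)
    ultimately show ?thesis by blast
  qed
  have add: "additive_functor T Ab ?E"
  \<comment> \<open>The arrow that kills \<open>f\<close> and makes \<open>?E\<close> exact is
    \<open>CU T f\<close>, the map into the cone.\<close>
  proof (rule half_exact_additive[OF FE zero trivial])
    fix f X Y assume f: "f \<in> Hom T X Y"
    note t = chosen_Hom[OF f]
    show "\<exists>Z g. g \<in> Hom T Y Z \<and> g \<cdot> f = Null T X Z \<and>
        kernel (omap ?E Y) (omap ?E Z) (dat (amap ?E g)) = dat (amap ?E f) ` carrier (omap ?E X)"
      using t(2) dist_comp_zero[OF chosen[OF t(1)] f t(2)] exact[OF chosen[OF t(1)] f t(2,3)] by blast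
  qed
  have "exact_seq ([omap ?E (Cod T h), omap ?E (Dom T h), omap ?E (Dom T g), omap ?E (Dom T f)],
      [dat (amap ?E h), dat (amap ?E g), dat (amap ?E f)])" if d: "(f, g, h) \<in> Dist T" for f g h
  proof -
    obtain X Y Z where t: "f \<in> Hom T X Y" "g \<in> Hom T Y Z" "h \<in> Hom T Z (shift_ob T X)"
      using dist_triangle[OF d] by (auto simp: triangle_def)
    show ?thesis
      using exact[OF d t] exact_seq_Ab[OF is_functorD(2)[OF FE t(1)] is_functorD(2)[OF FE t(2)] is_functorD(2)[OF FE t(3)]]
      by (simp add: HomD[OF t(1)] HomD[OF t(2)] HomD[OF t(3)])
  qed
  then show ?thesis
    unfolding classical_homology_def using add by auto
qed

section \<open>The two comparison transformations and the equivalence\<close>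

text \<open>Naturality is precisely the equation in \<open>bang_map_eq\<close>.\<close>

lemma unit_nat_trans:
  "nat_trans T T (id_functor T) (comp_functor T (cone_functor T) (bang_functor T)) (\<lambda>X \<in> Ob T. CU T (from_zero T X))"
  unfolding nat_trans_def
proof (intro conjI allI ballI)
  fix X assume X: "X \<in> Ob T"
  then show "(\<lambda>X \<in> Ob T. CU T (from_zero T X)) X
      \<in> Hom T (omap (id_functor T) X) (omap (comp_functor T (cone_functor T) (bang_functor T)) X)"
    using CU_from_zero_Hom[OF X] by (simp add: id_functor_def bang_functor_simps cone_functor_simps)
next
  fix f X Y assume f: "f \<in> Hom T X Y"
  obtain c where c: "bang_map T f = Arrow (from_zero T X) (from_zero T Y) (Null T (Zero T) (Zero T), f, c)"
    "bang_map T f \<in> Hom (triangles0 T) (from_zero T X) (from_zero T Y)"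
    "c \<cdot> CU T (from_zero T X) = CU T (from_zero T Y) \<cdot> f"
    using bang_map_eq[OF f] by metis
  have "amap (cone_functor T) (bang_map T f) = c"
    using cone_functor_simps(2) c(2) unfolding c(1) by blast
  then show "amap (comp_functor T (cone_functor T) (bang_functor T)) f \<cdot> (\<lambda>X \<in> Ob T. CU T (from_zero T X)) X =
      (\<lambda>X \<in> Ob T. CU T (from_zero T X)) Y \<cdot> amap (id_functor T) f"
    using Hom_Ob[OF f] Hom_imp_Ar[OF f] c(3) by (simp add: id_functor_def bang_functor_simps(2)[OF f])
qed simp

text \<open>Unlike a usual counit it starts at the identity, the direction that
  \<open>is_equivalence_precomp\<close> expects. Its components are excising, which is enough for
  homologies to invert them.\<close>

lemma counit_nat_trans:
  "nat_trans (triangles0 T) (triangles0 T) (id_functor (triangles0 T))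
    (comp_functor (triangles0 T) (bang_functor T) (cone_functor T)) (\<lambda>f \<in> Ar T. cone_map T f)"
  unfolding nat_trans_def
proof (intro conjI allI ballI)
  fix f assume "f \<in> Ob (triangles0 T)"
  then have f: "f \<in> Ar T" by (simp add: Ob_triangles0)
  then show "(\<lambda>f \<in> Ar T. cone_map T f) f \<in> Hom (triangles0 T) (omap (id_functor (triangles0 T)) f)
      (omap (comp_functor (triangles0 T) (bang_functor T) (cone_functor T)) f)"
    using cone_map_Hom[OF f] tri(8)[OF f]
    by (simp add: id_functor_def Ob_triangles0 cone_functor_simps bang_functor_simps)
next
  fix t f g assume tH: "t \<in> Hom (triangles0 T) f g"
  then obtain a b c where t: "t = Arrow f g (a, b, c)" "Arrow f g (a, b, c) \<in> Hom (triangles0 T) f g"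
    by (rule Hom_triangles0_cases)
  then have h: "f \<in> Ar T" "g \<in> Ar T" "c \<in> Hom T (Cone T f) (Cone T g)" by (simp_all add: Arrow_triangles0_iff)
  show "amap (comp_functor (triangles0 T) (bang_functor T) (cone_functor T)) t \<cdot>\<^bsub>triangles0 T\<^esub> (\<lambda>f \<in> Ar T. cone_map T f) f =
      (\<lambda>f \<in> Ar T. cone_map T f) g \<cdot>\<^bsub>triangles0 T\<^esub> amap (id_functor (triangles0 T)) t"
    using Hom_imp_Ar[OF tH] cone_functor_simps(2)[OF t(2)] bang_functor_simps(2)[OF h(3)] cone_map_natural[OF t(2)] h
    by (simp add: id_functor_def t(1))
qed (simp add: Ob_triangles0)

text \<open>The transformation on \<open>T\<close> consists of isomorphisms and is inverted by every
  functor; the one on the chosen triangles is inverted by a homology through its excision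
  axiom.\<close>

lemma is_equivalence_cone_homology_functor:
  "is_equivalence (classical_homologies T :: ('o, 'm, 'e) ab_functr_cat) (pt_homologies T) (cone_homology_functor T)"
  unfolding cone_homology_functor_eq classical_homologies_def pt_homologies_def
proof (rule is_equivalence_precomp[OF category_triangles0 category_axioms category_Ab is_functor_cone is_functor_bang
      _ _ unit_nat_trans _ counit_nat_trans])
  fix E :: "('o, 'm, 'e) ab_functr" assume "is_functor T Ab E" "classical_homology T E"
  then show "pt_homology T (comp_functor (triangles0 T) E (cone_functor T))"
    using pt_homology_cone_homology unfolding cone_homology_eq by blast
next
  fix H :: "('m, ('m, 'm \<times> 'm \<times> 'm) arrow, 'e) ab_functr" assume "pt_homology T H"
  then show "classical_homology T (comp_functor T H (bang_functor T))"
    by (rule classical_homology_bang)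
next
  fix E :: "('o, 'm, 'e) ab_functr" and X assume "is_functor T Ab E" "X \<in> Ob T"
  then show "is_iso Ab (amap E ((\<lambda>X \<in> Ob T. CU T (from_zero T X)) X))"
    using functor_is_iso[OF category_axioms _ CU_from_zero_iso] by simp
next
  fix H :: "('m, ('m, 'm \<times> 'm \<times> 'm) arrow, 'e) ab_functr" and f assume "pt_homology T H" "f \<in> Ob (triangles0 T)"
  then show "is_iso Ab (amap H ((\<lambda>f \<in> Ar T. cone_map T f) f))"
    using excising_cone_map by (simp add: pt_homology_def Ob_triangles0)
qed

end

theorem lemma4p2p6:
  fixes T :: "('o, 'm, 'z) chosen_tricat_scheme"
  assumes "chosen_triangulated_category T"
  shows "(\<forall>E :: ('o, 'm, 'e) ab_functr. classical_homology T E \<longrightarrow> pt_homology T (cone_homology T E)) \<and>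
    is_equivalence (classical_homologies T :: ('o, 'm, 'e) ab_functr_cat) (pt_homologies T)
      (cone_homology_functor T)"
proof -
  interpret chosen_triangulated_category T by fact
  show ?thesis
    using pt_homology_cone_homology is_equivalence_cone_homology_functor by blast
qed

end
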